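(* All maximal open subalgebras of $L=E(1,6)$ are, up to conjugation, the graded subalgebras of type $(2|1,1,1,1,1,1)$, $(2|2,1,1,0,1,1)$, $(1|1,1,1,0,0,0)$ and $(1|1,1,0,0,0,1)$.
   Context: The ground field is $\mathbb{C}$. Let $t$ be an even and $\xi_1,\xi_2,\xi_3,\eta_1,\eta_2,\eta_3$ odd indeterminates; $\Lambda(1,6)=\Lambda(\xi_i,\eta_i)[[t]]$ with the formal topology. $K(1,6)$ is the Lie superalgebra of continuous derivations $X$ of $\Lambda(1,6)$ with $X\tau'=f\tau'$ for some $f\in\Lambda(1,6)$, where $\tau'=dt+\sum_{i=1}^3(\xi_id\eta_i+\eta_id\xi_i)$. It is identified with $\Lambda(1,6)$ with bracket $[f,g]=(2-E)f\frac{\partial g}{\partial t}-\frac{\partial f}{\partial t}(2-E)g+(-1)^{p(f)}\sum_{i=1}^3(\frac{\partial f}{\partial\xi_i}\frac{\partial g}{\partial\eta_i}+\frac{\partial f}{\partial\eta_i}\frac{\partial g}{\partial\xi_i})$, $E=\sum_i(\xi_i\frac{\partial}{\partial\xi_i}+\eta_i\frac{\partial}{\partial\eta_i})$, via $f\mapsto(2-E)f\frac{\partial}{\partial t}+\frac{\partial f}{\partial t}E+(-1)^{p(f)}\sum_i(\frac{\partial f}{\partial\xi_i}\frac{\partial}{\partial\eta_i}+\frac{\partial f}{\partial\eta_i}\frac{\partial}{\partial\xi_i})$. The grading of type $(2|1,1,1,1,1,1)$ is $K(1,6)=\prod_{j\ge-2}\mathfrak{g}_j$ with $\mathfrak{g}_{-2}=\mathbb{C}1$,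 $\mathfrak{g}_{-1}=\langle\xi_i,\eta_i\rangle$, $\mathfrak{g}_0$ spanned by $t$ and the quadratic monomials in the odd variables, and $\mathfrak{g}_1=\mathfrak{g}_{-1}^*\oplus\mathfrak{g}_1^+\oplus\mathfrak{g}_1^-$, with $\mathfrak{g}_{-1}^*=\langle t\xi_i,t\eta_i\rangle$, $\mathfrak{g}_1^+=\langle\xi_1\xi_2\xi_3,\ \xi_1\eta_2\eta_3,\ \xi_2\eta_1\eta_3,\ \xi_3\eta_1\eta_2,\ \xi_1(\xi_2\eta_2+\xi_3\eta_3),\ \xi_2(\xi_1\eta_1+\xi_3\eta_3),\ \eta_3(\xi_1\eta_1-\xi_2\eta_2),\ \xi_3(\xi_1\eta_1+\xi_2\eta_2),\ \eta_2(\xi_1\eta_1-\xi_3\eta_3),\ \eta_1(\xi_2\eta_2-\xi_3\eta_3)\rangle$, and $\mathfrak{g}_1^-$ obtained from $\mathfrak{g}_1^+$ by exchanging $\xi_i$ with $\eta_i$ for all $i$. $E(1,6)$ is the (completed) graded subalgebra of $K(1,6)$ generated by $\mathfrak{g}_{-1}+\mathfrak{g}_0+(\mathfrak{g}_{-1}^*+\mathfrak{g}_1^+)$; it is a simple linearly compact Lie superalgebra. The grading of type $(a|b_1,\dots,b_6)$ (with $b_i+b_{i+3}=a$) is given by $\deg t=a$, $\deg\xi_i=b_i$, $\deg\eta_i=b_{i+3}$ ($i=1,2,3$), partial derivatives having opposite degrees; it induces a grading $L=\prod_jL_j$, and the graded subalgebra of this type is $\prod_{j\ge0}L_j$. Maximal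 open subalgebras are taken among proper subalgebras. "Conjugation" means conjugation by the group of inner automorphisms of $\mathrm{Der}\,L$ $(=L)$, generated by $\exp(\mathrm{ad}\,a)$ for exponentiable even elements $a$ (those for which $\exp(s\,\mathrm{ad}\,a)$ converges for all $s\in\mathbb{C}$ to a continuous automorphism). *)

theory Defs
  imports
    "HOL-Computational_Algebra.Formal_Power_Series"
    "HOL-Analysis.Analysis"
    "HOL-Algebra.Bij"
    "HOL-Algebra.Generated_Groups"
begin

section \<open>The Grassmann algebra in six odd indeterminates\<close>

text \<open>
  The odd indeterminates carry the indices 1 to 6: index \<open>i\<close> stands for \<open>\<xi>\<^sub>i\<close> and index
  \<open>i + 3\<close> for \<open>\<eta>\<^sub>i\<close> (\<open>i = 1, 2, 3\<close>).  An element is given by its coefficients with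
  respect to the monomials \<open>e\<^sub>S\<close>, the product of the indeterminates with index in \<open>S\<close> in
  increasing order.
\<close>

typedef grassmann = "{f :: nat set \<Rightarrow> complex. \<forall>S. \<not> S \<subseteq> {1..6} \<longrightarrow> f S = 0}"
  morphisms gcoeff Abs_grassmann
  by (rule exI[of _ "\<lambda>_. 0"]) simp

setup_lifting type_definition_grassmann

lemma grassmann_eqI: "(\<And>S. gcoeff f S = gcoeff g S) \<Longrightarrow> f = g"
  by (simp add: gcoeff_inject[symmetric] fun_eq_iff)

text \<open>\<open>e\<^sub>I e\<^sub>J = (-1) ^ inversions I J e\<^bsub>I \<union> J\<^esub>\<close> for disjoint \<open>I\<close> and \<open>J\<close>.\<close>

definition inversions :: "nat set \<Rightarrow> nat set \<Rightarrow> nat" where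
  "inversions I J = card {(i, j). i \<in> I \<and> j \<in> J \<and> j < i}"

lemma finite_inversions:
  "finite I \<Longrightarrow> finite J \<Longrightarrow> finite {(i, j). i \<in> I \<and> j \<in> J \<and> j < (i::nat)}"
  by (rule finite_subset[of _ "I \<times> J"]) auto

lemma inversions_Un_left:
  assumes "finite I" "finite J" "finite K" "I \<inter> J = {}"
  shows "inversions (I \<union> J) K = inversions I K + inversions J K"
proof -
  have "{(i, j). i \<in> I \<union> J \<and> j \<in> K \<and> j < i} =
      {(i, j). i \<in> I \<and> j \<in> K \<and> j < i} \<union> {(i, j). i \<in> J \<and> j \<in> K \<and> j < i}"
    by auto
  then show ?thesis
    unfolding inversions_def
    using assms by (simp only:) (rule card_Un_disjoint; auto intro!: finite_inversions)
qed

lemma inversions_Un_right: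
  assumes "finite I" "finite J" "finite K" "J \<inter> K = {}"
  shows "inversions I (J \<union> K) = inversions I J + inversions I K"
proof -
  have "{(i, j). i \<in> I \<and> j \<in> J \<union> K \<and> j < i} =
      {(i, j). i \<in> I \<and> j \<in> J \<and> j < i} \<union> {(i, j). i \<in> I \<and> j \<in> K \<and> j < i}"
    by auto
  then show ?thesis
    unfolding inversions_def
    using assms by (simp only:) (rule card_Un_disjoint; auto intro!: finite_inversions)
qed

lemma inversions_empty [simp]: "inversions {} J = 0" "inversions I {} = 0"
  by (simp_all add: inversions_def)

lemma sum_splittings_left:
  fixes a b c :: "nat set \<Rightarrow> 'a::comm_ring_1" and t :: "nat set \<Rightarrow> nat set \<Rightarrow> 'a"
  assumes fin: "finite S"
  shows "(\<Sum>J\<in>Pow S. t J (S - J) * (\<Sum>I\<in>Pow J. t I (J - I) * a I * b (J - I)) * c (S - J)) =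
    (\<Sum>(J, I)\<in>(SIGMA J:Pow S. Pow J). t J (S - J) * t I (J - I) * a I * b (J - I) * c (S - J))"
proof -
  have "\<forall>J\<in>Pow S. finite (Pow J)" using fin finite_subset by blast
  then have "(\<Sum>(J, I)\<in>(SIGMA J:Pow S. Pow J). t J (S - J) * t I (J - I) * a I * b (J - I) * c (S - J))
    = (\<Sum>J\<in>Pow S. \<Sum>I\<in>Pow J. t J (S - J) * t I (J - I) * a I * b (J - I) * c (S - J))"
    using fin by (intro sum.Sigma[symmetric]) simp_all
  then show ?thesis by (simp add: sum_distrib_left sum_distrib_right mult.assoc)
qed

lemma sum_splittings_right:
  fixes a b c :: "nat set \<Rightarrow> 'a::comm_ring_1" and t :: "nat set \<Rightarrow> nat set \<Rightarrow> 'a"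
  assumes fin: "finite S"
  shows "(\<Sum>(I, K)\<in>(SIGMA I:Pow S. Pow (S - I)). t I (S - I) * t K (S - I - K) * a I * b K * c (S - I - K)) =
  (\<Sum>I\<in>Pow S. t I (S - I) * a I * (\<Sum>K\<in>Pow (S - I). t K (S - I - K) * b K * c (S - I - K)))"
proof -
  have "(\<Sum>(I, K)\<in>(SIGMA I:Pow S. Pow (S - I)). t I (S - I) * t K (S - I - K) * a I * b K * c (S - I - K))
    = (\<Sum>I\<in>Pow S. \<Sum>K\<in>Pow (S - I). t I (S - I) * t K (S - I - K) * a I * b K * c (S - I - K))"
    using fin by (intro sum.Sigma[symmetric]) simp_all
  then show ?thesis by (simp add: sum_distrib_left mult_ac)
qed

lemma sum_splittings_reindex:
  fixes a b c :: "nat set \<Rightarrow> complex"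
  assumes fin: "finite S"
  defines "s \<equiv> \<lambda>I J. (-1) ^ inversions I J :: complex"
  shows "(\<Sum>(J, I)\<in>(SIGMA J:Pow S. Pow J).
            s J (S - J) * s I (J - I) * a I * b (J - I) * c (S - J)) =
         (\<Sum>(I, K)\<in>(SIGMA I:Pow S. Pow (S - I)).
            s I (S - I) * s K (S - I - K) * a I * b K * c (S - I - K))"
    (is "sum ?f ?A = sum ?g ?B")
proof (rule sum.reindex_bij_witness[where
      i = "\<lambda>(I, K). (I \<union> K, I)" and j = "\<lambda>(J, I). (I, J - I)"])
  fix p assume p: "p \<in> ?A"
  then obtain J I where JI: "p = (J, I)" "I \<subseteq> J" "J \<subseteq> S"
    by auto
  show "(case case p of (J, I) \<Rightarrow> (I, J - I) of (I, K) \<Rightarrow> (I \<union> K, I)) = p"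
    using JI by auto
  show "(case p of (J, I) \<Rightarrow> (I, J - I)) \<in> ?B"
    using JI by auto
  define K R where "K = J - I" and "R = S - J"
  have fins: "finite I" "finite K" "finite R"
    using fin finite_subset[OF JI(3)] finite_subset[OF JI(2)] by (auto simp: K_def R_def)
  have J: "J = I \<union> K" and eqs: "S - I = K \<union> R" "S - I - K = R"
    using JI by (auto simp: K_def R_def)
  have "I \<inter> K = {}" "K \<inter> R = {}"
    by (auto simp: K_def R_def)
  then have "s (I \<union> K) R * s I K = s I (K \<union> R) * s K R"
    using fins by (simp add: s_def inversions_Un_left inversions_Un_right power_add)
  then have "s I (S - I) * s K (S - I - K) = s J R * s I K"
    unfolding eqs(2) unfolding eqs(1) J by (rule sym)
  then show "?g (case p of (J, I) \<Rightarrow> (I, J - I)) = ?f p"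
    unfolding JI(1) prod.case K_def[symmetric] R_def[symmetric] eqs(2) by simp
next
  fix p assume "p \<in> ?B"
  then obtain I K where IK: "p = (I, K)" "I \<subseteq> S" "K \<subseteq> S - I"
    by auto
  show "(case case p of (I, K) \<Rightarrow> (I \<union> K, I) of (J, I) \<Rightarrow> (I, J - I)) = p"
    using IK by auto
  show "(case p of (I, K) \<Rightarrow> (I \<union> K, I)) \<in> ?A"
    using IK by auto
qed

instantiation grassmann :: ring_1
begin

lift_definition zero_grassmann :: grassmann is "\<lambda>_. 0" by simp
lift_definition one_grassmann :: grassmann is "\<lambda>S. if S = {} then 1 else 0" by auto
lift_definition plus_grassmann :: "grassmann \<Rightarrow> grassmann \<Rightarrow> grassmann"
  is "\<lambda>f g S. f S + g S" by simp
lift_definition minus_grassmann :: "grassmann \<Rightarrow> grassmann \<Rightarrow> grassmann"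
  is "\<lambda>f g S. f S - g S" by simp
lift_definition uminus_grassmann :: "grassmann \<Rightarrow> grassmann"
  is "\<lambda>f S. - f S" by simp
lift_definition times_grassmann :: "grassmann \<Rightarrow> grassmann \<Rightarrow> grassmann"
  is "\<lambda>f g S. \<Sum>I\<in>Pow S. (-1) ^ inversions I (S - I) * f I * g (S - I)"
proof -
  fix f g :: "nat set \<Rightarrow> complex" and S :: "nat set"
  assume f: "\<And>S. \<not> S \<subseteq> {1..6} \<Longrightarrow> f S = 0"
    and g: "\<And>S. \<not> S \<subseteq> {1..6} \<Longrightarrow> g S = 0"
    and S: "\<not> S \<subseteq> {1..6}"
  show "(\<Sum>I\<in>Pow S. (-1) ^ inversions I (S - I) * f I * g (S - I)) = 0"
  proof (rule sum.neutral, rule ballI)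
    fix I assume "I \<in> Pow S"
    then have "\<not> I \<subseteq> {1..6} \<or> \<not> S - I \<subseteq> {1..6}" using S by blast
    then have "f I = 0 \<or> g (S - I) = 0" by (metis f g)
    then show "(-1) ^ inversions I (S - I) * f I * g (S - I) = 0" by auto
  qed
qed

instance
proof
  fix a b c :: grassmann
  show "a + b + c = a + (b + c)" "a + b = b + a" "0 + a = a" "- a + a = 0" "a - b = a + - b"
    by (simp_all add: gcoeff_inject[symmetric] fun_eq_iff zero_grassmann.rep_eq
        plus_grassmann.rep_eq minus_grassmann.rep_eq uminus_grassmann.rep_eq)
  have "gcoeff 0 {} \<noteq> gcoeff 1 {}"
    by (simp add: zero_grassmann.rep_eq one_grassmann.rep_eq)
  then show "(0::grassmann) \<noteq> 1"
    by metis
  show "(a + b) * c = a * c + b * c" "a * (b + c) = a * b + a * c"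
    by (simp_all add: gcoeff_inject[symmetric] fun_eq_iff plus_grassmann.rep_eq
        times_grassmann.rep_eq distrib_left distrib_right sum.distrib)
  have supp: "gcoeff f S = 0" if "infinite S" for f S
    using gcoeff[of f] that finite_subset[of S "{1..6}"] by auto
  show "1 * a = a"
  proof (rule grassmann_eqI)
    fix S
    show "gcoeff (1 * a) S = gcoeff a S"
    proof (cases "finite S")
      case True
      have "gcoeff (1 * a) S = (\<Sum>I\<in>Pow S. if I = {} then gcoeff a S else 0)"
        unfolding times_grassmann.rep_eq one_grassmann.rep_eq
        by (rule sum.cong) auto
      then show ?thesis using True by (simp add: sum.delta)
    qed (simp add: supp)
  qed
  show "a * 1 = a"
  proof (rule grassmann_eqI)
    fix S
    show "gcoeff (a * 1) S = gcoeff a S"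
    proof (cases "finite S")
      case True
      have "gcoeff (a * 1) S = (\<Sum>I\<in>Pow S. if I = S then gcoeff a S else 0)"
        unfolding times_grassmann.rep_eq one_grassmann.rep_eq
        by (rule sum.cong) auto
      then show ?thesis using True by (simp add: sum.delta)
    qed (simp add: supp)
  qed
  show "a * b * c = a * (b * c)"
  proof (rule grassmann_eqI)
    fix S
    show "gcoeff (a * b * c) S = gcoeff (a * (b * c)) S"
    proof (cases "finite S")
      case fin: True
      let ?s = "\<lambda>I J. (-1) ^ inversions I J :: complex"
      have "gcoeff (a * b * c) S =
          (\<Sum>(J, I)\<in>(SIGMA J:Pow S. Pow J).
            ?s J (S - J) * ?s I (J - I) * gcoeff a I * gcoeff b (J - I) * gcoeff c (S - J))"
        unfolding times_grassmann.rep_eq by (rule sum_splittings_left[OF fin, where a = "gcoeff a"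
              and b = "gcoeff b" and c = "gcoeff c" and t = "?s"])
      also have "\<dots> = (\<Sum>(I, K)\<in>(SIGMA I:Pow S. Pow (S - I)).
            ?s I (S - I) * ?s K (S - I - K) * gcoeff a I * gcoeff b K * gcoeff c (S - I - K))"
        by (rule sum_splittings_reindex[OF fin, where a = "gcoeff a"
              and b = "gcoeff b" and c = "gcoeff c"])
      also have "\<dots> = gcoeff (a * (b * c)) S"
        unfolding times_grassmann.rep_eq by (rule sum_splittings_right[OF fin, where a = "gcoeff a"
              and b = "gcoeff b" and c = "gcoeff c" and t = "?s"])
      finally show ?thesis .
    qed (simp add: supp)
  qed
qed

end

lift_definition gscalar :: "complex \<Rightarrow> grassmann"
  is "\<lambda>c S. if S = {} then c else 0" by auto

lift_definition gvar :: "nat \<Rightarrow> grassmann"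
  is "\<lambda>i S. if i \<in> {1..6} \<and> S = {i} then 1 else 0" by auto

text \<open>
  Left derivative by the indeterminate with index \<open>i\<close>: the sign is the one needed to move this
  indeterminate to the front of the monomial.
\<close>

lift_definition gderiv :: "nat \<Rightarrow> grassmann \<Rightarrow> grassmann"
  is "\<lambda>i f S. if i \<in> S then 0 else (-1) ^ card {j \<in> S. j < i} * f (insert i S)" by auto

lift_definition gparity :: "grassmann \<Rightarrow> grassmann"
  is "\<lambda>f S. (-1) ^ card S * f S" by simp

lift_definition gfilter :: "(nat set \<Rightarrow> bool) \<Rightarrow> grassmann \<Rightarrow> grassmann"
  is "\<lambda>P f S. if P S then f S else 0" by simp


section \<open>The Lie superalgebra $K(1,6)$\<close>

text \<open>
  The whole type \<open>\<Lambda>(1,6)\<close> below is the underlying space of $K(1,6)$.  The library makes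
  \<^typ>\<open>grassmann fps\<close> a metric space whose topology is the formal (\<open>t\<close>-adic) one.
\<close>

type_synonym lambda16 = "grassmann fps"

definition coeff16 :: "lambda16 \<Rightarrow> nat \<Rightarrow> nat set \<Rightarrow> complex" where
  "coeff16 f n S = gcoeff (fps_nth f n) S"

definition scale16 :: "complex \<Rightarrow> lambda16 \<Rightarrow> lambda16" where
  "scale16 c f = fps_const (gscalar c) * f"

lemma gscalar_add: "gscalar (a + b) = gscalar a + gscalar b"
  by transfer (simp add: fun_eq_iff)

lemma gscalar_one: "gscalar 1 = 1"
  by transfer simp

lemma gcoeff_gscalar_mult: "gcoeff (gscalar c * f) S = c * gcoeff f S"
proof (cases "finite S")
  case True
  have "gcoeff (gscalar c * f) S = (\<Sum>I\<in>Pow S. if I = {} then c * gcoeff f S else 0)"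
    unfolding times_grassmann.rep_eq gscalar.rep_eq by (rule sum.cong) auto
  then show ?thesis using True by (simp add: sum.delta)
next
  case False
  then have "\<not> S \<subseteq> {1..6}" using finite_subset[of S "{1..6}"] by auto
  then have "gcoeff g S = 0" for g using gcoeff[of g] by auto
  then show ?thesis by simp
qed

lemma gscalar_mult: "gscalar (a * b) = gscalar a * gscalar b"
  by (rule grassmann_eqI) (simp add: gcoeff_gscalar_mult gscalar.rep_eq)

lemma coeff16_scale16: "coeff16 (scale16 c f) n S = c * coeff16 f n S"
  by (simp add: coeff16_def scale16_def gcoeff_gscalar_mult)

lemma coeff16_eqI: "(\<And>n S. coeff16 f n S = coeff16 g n S) \<Longrightarrow> f = g"
  by (rule fps_ext, rule grassmann_eqI) (simp add: coeff16_def)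

lemma coeff16_add: "coeff16 (f + g) n S = coeff16 f n S + coeff16 g n S"
  by (simp add: coeff16_def plus_grassmann.rep_eq)

interpretation K16: vector_space scale16
  by standard
    (rule coeff16_eqI; simp add: coeff16_add coeff16_scale16 distrib_left distrib_right mult.assoc)+

definition t16 :: lambda16 where "t16 = fps_X"
definition xi :: "nat \<Rightarrow> lambda16" where "xi i = fps_const (gvar i)"
definition eta :: "nat \<Rightarrow> lambda16" where "eta i = fps_const (gvar (i + 3))"

definition d_odd :: "nat \<Rightarrow> lambda16 \<Rightarrow> lambda16" where
  "d_odd i f = Abs_fps (\<lambda>n. gderiv i (fps_nth f n))"

definition d_xi :: "nat \<Rightarrow> lambda16 \<Rightarrow> lambda16" where "d_xi i = d_odd i"
definition d_eta :: "nat \<Rightarrow> lambda16 \<Rightarrow> lambda16" where "d_eta i = d_odd (i + 3)"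

definition euler16 :: "lambda16 \<Rightarrow> lambda16" where
  "euler16 f = (\<Sum>i = 1..3. xi i * d_xi i f + eta i * d_eta i f)"

text \<open>
  \<open>f \<mapsto> (-1)\<^sup>p\<^sup>(\<^sup>f\<^sup>) f\<close>, extended linearly from homogeneous to arbitrary elements.  Its fixed points
  are the even elements, and the linear subspaces that it preserves are the \<open>\<int>/2\<close>-graded ones.
\<close>

definition parity16 :: "lambda16 \<Rightarrow> lambda16" where
  "parity16 f = Abs_fps (\<lambda>n. gparity (fps_nth f n))"

definition bracket16 :: "lambda16 \<Rightarrow> lambda16 \<Rightarrow> lambda16" where
  "bracket16 f g =
     (2 * f - euler16 f) * fps_deriv g - fps_deriv f * (2 * g - euler16 g)
     + (\<Sum>i = 1..3. d_xi i (parity16 f) * d_eta i g + d_eta i (parity16 f) * d_xi i g)"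

definition lie_subalgebra16 :: "lambda16 set \<Rightarrow> bool" where
  "lie_subalgebra16 M \<longleftrightarrow>
     K16.subspace M \<and> (\<forall>f\<in>M. parity16 f \<in> M) \<and> (\<forall>f\<in>M. \<forall>g\<in>M. bracket16 f g \<in> M)"


section \<open>The Lie superalgebra $E(1,6)$\<close>

definition g_minus1 :: "lambda16 set" where
  "g_minus1 = K16.span (xi ` {1..3} \<union> eta ` {1..3})"

definition g_0 :: "lambda16 set" where
  "g_0 = K16.span ({t16} \<union> {u * v |u v. u \<in> xi ` {1..3} \<union> eta ` {1..3} \<and>
                                        v \<in> xi ` {1..3} \<union> eta ` {1..3}})"

definition g_minus1_dual :: "lambda16 set" where
  "g_minus1_dual = K16.span ((\<lambda>i. t16 * xi i) ` {1..3} \<union> (\<lambda>i. t16 * eta i) ` {1..3})"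

definition g_1_plus :: "lambda16 set" where
  "g_1_plus = K16.span
     {xi 1 * xi 2 * xi 3,
      xi 1 * eta 2 * eta 3,
      xi 2 * eta 1 * eta 3,
      xi 3 * eta 1 * eta 2,
      xi 1 * (xi 2 * eta 2 + xi 3 * eta 3),
      xi 2 * (xi 1 * eta 1 + xi 3 * eta 3),
      eta 3 * (xi 1 * eta 1 - xi 2 * eta 2),
      xi 3 * (xi 1 * eta 1 + xi 2 * eta 2),
      eta 2 * (xi 1 * eta 1 - xi 3 * eta 3),
      eta 1 * (xi 2 * eta 2 - xi 3 * eta 3)}"

text \<open>
  The generated subalgebra is the direct sum of its (finite-dimensional) components for the
  grading of type \<open>(2|1,1,1,1,1,1)\<close>; its closure is the product of these components.
\<close>

definition E16 :: "lambda16 set" where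
  "E16 = closure (lie_subalgebra16 hull (g_minus1 \<union> g_0 \<union> g_minus1_dual \<union> g_1_plus))"


section \<open>Gradings\<close>

text \<open>
  Type \<open>(a|b\<^sub>1,\<dots>,b\<^sub>6)\<close> is represented by \<open>a\<close> and the list of the \<open>b\<^sub>i\<close>.  The derivation attached
  to the monomial \<open>t\<^sup>n e\<^sub>S\<close> involves \<open>t\<^sup>n e\<^sub>S \<partial>/\<partial>t\<close>, and all its other terms have the same degree
  since \<open>b\<^sub>i + b\<^bsub>i+3\<^esub> = a\<close>; hence the shift by \<open>a\<close> between the degree of a monomial as an
  element of \<open>\<Lambda>(1,6)\<close> and its degree in $K(1,6)$.
\<close>

definition deg16 :: "int \<Rightarrow> int list \<Rightarrow> nat \<Rightarrow> nat set \<Rightarrow> int" where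
  "deg16 a b n S = int n * a + (\<Sum>i\<in>S. b ! (i - 1)) - a"

definition component16 :: "int \<Rightarrow> int list \<Rightarrow> int \<Rightarrow> lambda16 \<Rightarrow> lambda16" where
  "component16 a b j f = Abs_fps (\<lambda>n. gfilter (\<lambda>S. deg16 a b n S = j) (fps_nth f n))"

definition graded_part :: "lambda16 set \<Rightarrow> int \<Rightarrow> int list \<Rightarrow> int \<Rightarrow> lambda16 set" where
  "graded_part L a b j = {f \<in> L. component16 a b j f = f}"

text \<open>The product of the \<open>L\<^sub>j\<close> over \<open>j \<ge> 0\<close>, described by the homogeneous components.\<close>

definition graded_subalgebra :: "lambda16 set \<Rightarrow> int \<Rightarrow> int list \<Rightarrow> lambda16 set" where
  "graded_subalgebra L a b =
     {f. \<forall>j. component16 a b j f \<in> (if j \<ge> 0 then graded_part L a b j else {0})}"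


section \<open>Maximal open subalgebras\<close>

definition maximal_open_subalgebra :: "lambda16 set \<Rightarrow> lambda16 set \<Rightarrow> bool" where
  "maximal_open_subalgebra L M \<longleftrightarrow>
     lie_subalgebra16 M \<and> M \<subset> L \<and> openin (top_of_set L) M \<and>
     (\<forall>N. lie_subalgebra16 N \<and> N \<subset> L \<and> openin (top_of_set L) N \<and> M \<subseteq> N \<longrightarrow> N = M)"


section \<open>Inner automorphisms\<close>

definition continuous_automorphism :: "lambda16 set \<Rightarrow> (lambda16 \<Rightarrow> lambda16) \<Rightarrow> bool" where
  "continuous_automorphism L \<phi> \<longleftrightarrow>
     \<phi> \<in> Bij L \<and>
     (\<forall>f\<in>L. \<forall>g\<in>L. \<phi> (f + g) = \<phi> f + \<phi> g) \<and>
     (\<forall>c. \<forall>f\<in>L. \<phi> (scale16 c f) = scale16 c (\<phi> f)) \<and>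
     (\<forall>f\<in>L. \<phi> (parity16 f) = parity16 (\<phi> f)) \<and>
     (\<forall>f\<in>L. \<forall>g\<in>L. \<phi> (bracket16 f g) = bracket16 (\<phi> f) (\<phi> g)) \<and>
     continuous_on L \<phi>"

text \<open>
  \<open>y = \<Sum>\<^sub>k (ad a)\<^sup>k x / k!\<close>, each coefficient of the power series converging in \<open>\<complex>\<close> with its usual
  topology.  (Convergence in the \<open>t\<close>-adic topology would exclude semisimple even elements such as
  \<open>t\<close>.  Open subspaces and continuous linear maps are the same for the \<open>t\<close>-adic topology and for
  the topology of coefficientwise convergence.)
\<close>

definition exp_ad_sums :: "lambda16 \<Rightarrow> lambda16 \<Rightarrow> lambda16 \<Rightarrow> bool" where
  "exp_ad_sums a x y \<longleftrightarrow>
     (\<forall>n S. (\<lambda>k. coeff16 (scale16 (1 / fact k) ((bracket16 a ^^ k) x)) n S) sums coeff16 y n S)"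

definition exp_ad :: "lambda16 set \<Rightarrow> lambda16 \<Rightarrow> lambda16 \<Rightarrow> lambda16" where
  "exp_ad L a = (\<lambda>x\<in>L. THE y. exp_ad_sums a x y)"

definition exponentiable :: "lambda16 set \<Rightarrow> lambda16 \<Rightarrow> bool" where
  "exponentiable L a \<longleftrightarrow>
     a \<in> L \<and> parity16 a = a \<and>
     (\<forall>s. (\<forall>x\<in>L. \<exists>y. exp_ad_sums (scale16 s a) x y) \<and>
          continuous_automorphism L (exp_ad L (scale16 s a)))"

text \<open>
  All continuous derivations of $E(1,6)$ are inner, so \<open>a\<close> ranges over \<open>L\<close> itself.
\<close>

definition inner_automorphisms :: "lambda16 set \<Rightarrow> (lambda16 \<Rightarrow> lambda16) set" where
  "inner_automorphisms L = generate (BijGroup L) {exp_ad L a |a. exponentiable L a}"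

end

(*
Let M be a proper open subalgebra of L = E(1,6). If an even element of M had a non-zero constant
term c, its adjoint action would be 2c d/dt to leading order; as d/dt maps L onto L and M contains
all elements of large degree, descending induction on the degree would give M = L. Hence, at t = 0,
the linear parts of the elements of M form a totally isotropic subspace U of the six-dimensional
space spanned by the xi_i and eta_i, the quadratic parts of M preserve U, and if dim U >= 2 then
brackets of odd elements force one cubic coefficient to vanish. The unipotent automorphisms
exp(ad s uv), with u, v among the xi_i and eta_i, move U into standard position, and M is then
contained in one of the four graded subalgebras: U = 0 and dim U = 1 give the first two types, and
the two families of maximal isotropic subspaces containing a given plane give the last two. The
same restrictions, applied to a subalgebra containing a graded one, show maximality.
*)

theory Submission
  imports Defs
begin

section \<open>The Grassmann algebra\<close>

text \<open>The obstacle is that \<open>E16\<close> is known only through generators, so that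
  monomials cannot be assumed to lie in it, while the descent needs d/dt to be onto. The way out is
  the operator ad 1 ad t^2, which is diagonal on monomials with eigenvalue 4(n+1)(n+|S|-2) on
  \<open>t^n e_S\<close>: polynomials in it preserve \<open>E16\<close> and invert it away from the
  eigenvalue 0. There remain t^2, the t xi and the products of two odd variables. All of them come
  from t^2 by brackets with odd variables, and t^2 comes from an element with a t^3 term, built from
  one cubic element of g_1^+. No other step uses a particular element of g_1^+. Everything else
  concerns coefficients at t^0: in the four types a monomial of negative degree contains no t and
  has at most three odd factors. Quadratic elements uv with u, v spanning an isotropic plane satisfy
  (ad uv)^3 = 0, so their exponentials are polynomials and raise no question of convergence.\<close>

lemma gcoeff_outside: "\<not> S \<subseteq> {1..6} \<Longrightarrow> gcoeff f S = 0"
  using gcoeff[of f] by auto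

lemma gcoeff_infinite: "infinite S \<Longrightarrow> gcoeff f S = 0"
  by (rule gcoeff_outside) (meson finite_atLeastAtMost finite_subset)

lemma gcoeff_simps [simp]:
  "gcoeff 0 S = 0" "gcoeff (f + g) S = gcoeff f S + gcoeff g S"
  "gcoeff (f - g) S = gcoeff f S - gcoeff g S" "gcoeff (- f) S = - gcoeff f S"
  by (simp_all add: zero_grassmann.rep_eq plus_grassmann.rep_eq minus_grassmann.rep_eq
      uminus_grassmann.rep_eq)

lemma gcoeff_sum [simp]: "gcoeff (sum f A) S = (\<Sum>i\<in>A. gcoeff (f i) S)"
  by (induction A rule: infinite_finite_induct) auto

lemma of_nat_grassmann: "of_nat n = gscalar (of_nat n)"
proof (induction n)
  case 0
  show ?case by (rule grassmann_eqI) (simp add: gscalar.rep_eq)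
qed (simp add: gscalar_add gscalar_one)

lemma gcoeff_of_nat_mult [simp]: "gcoeff (of_nat n * f) S = of_nat n * gcoeff f S"
  by (simp add: of_nat_grassmann gcoeff_gscalar_mult)

lemma gcoeff_mult_gscalar: "gcoeff (f * gscalar c) S = c * gcoeff f S"
proof (cases "finite S")
  case True
  have "gcoeff (f * gscalar c) S = (\<Sum>I\<in>Pow S. if I = S then c * gcoeff f S else 0)"
    unfolding times_grassmann.rep_eq gscalar.rep_eq by (rule sum.cong) auto
  then show ?thesis using True by (simp add: sum.delta)
qed (simp add: gcoeff_infinite)

lemma gscalar_commute: "f * gscalar c = gscalar c * f"
  by (rule grassmann_eqI) (simp add: gcoeff_gscalar_mult gcoeff_mult_gscalar)

lemma gparity_simps [simp]:
  "gparity 0 = 0" "gparity (f + g) = gparity f + gparity g" "gparity (f - g) = gparity f - gparity g"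
  "gparity (- f) = - gparity f" "gparity (gscalar c) = gscalar c" "gparity (gparity f) = f"
  by (rule grassmann_eqI;
      simp add: gparity.rep_eq gscalar.rep_eq algebra_simps flip: power_mult_distrib)+

lemma gparity_gvar [simp]: "gparity (gvar i) = - gvar i"
  by (rule grassmann_eqI) (auto simp add: gparity.rep_eq gvar.rep_eq)

lemma gparity_mult: "gparity (f * g) = gparity f * gparity g"
proof (rule grassmann_eqI)
  fix S
  show "gcoeff (gparity (f * g)) S = gcoeff (gparity f * gparity g) S"
  proof (cases "finite S")
    case True
    have "(-1) ^ card S = (-1) ^ card I * ((-1) ^ card (S - I) :: complex)" if "I \<subseteq> S" for I
    proof -
      have "card S = card I + card (S - I)"
        using True that by (metis card_mono card_Diff_subset finite_subset le_add_diff_inverse)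
      then show ?thesis by (simp add: power_add)
    qed
    then show ?thesis
      by (auto simp: gparity.rep_eq times_grassmann.rep_eq sum_distrib_left intro!: sum.cong)
  qed (simp add: gcoeff_infinite)
qed

text \<open>The sign for moving the indeterminate \<open>i\<close> to the front of
  \<open>e_S\<close>, past the factors of smaller index.\<close>

definition gsign :: "nat \<Rightarrow> nat set \<Rightarrow> complex" where
  "gsign i S = (-1) ^ card {j \<in> S. j < i}"

lemma gsign_empty [simp]: "gsign i {} = 1"
  by (simp add: gsign_def)

lemma gsign_square [simp]: "gsign i S * gsign i S = 1" "gsign i S * (gsign i S * c) = c"
  by (simp_all add: gsign_def mult.assoc[symmetric] flip: power_mult_distrib)

lemma gsign_insert:
  assumes "finite S" "k \<notin> S"
  shows "gsign i (insert k S) = (if k < i then - gsign i S else gsign i S)"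
proof -
  have "{j \<in> insert k S. j < i} = (if k < i then insert k {j \<in> S. j < i} else {j \<in> S. j < i})"
    by auto
  then show ?thesis using assms by (simp add: gsign_def)
qed

lemma gsign_remove:
  assumes "finite S" "k \<in> S"
  shows "gsign i (S - {k}) = (if k < i then - gsign i S else gsign i S)"
  using gsign_insert[of "S - {k}" k i] assms by (simp add: insert_absorb split: if_splits)

lemma gcoeff_gderiv:
  "gcoeff (gderiv i f) S = (if i \<in> S then 0 else gsign i S * gcoeff f (insert i S))"
  by (simp add: gderiv.rep_eq gsign_def)

lemma gcoeff_gvar_mult:
  assumes i: "i \<in> {1..6}"
  shows "gcoeff (gvar i * f) S = (if i \<in> S then gsign i S * gcoeff f (S - {i}) else 0)"
proof (cases "finite S")
  case True
  have "inversions {i} (S - {i}) = card {j \<in> S. j < i}"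
    unfolding inversions_def
    by (rule bij_betw_same_card[of snd]) (auto simp: bij_betw_def inj_on_def image_def)
  then have "gcoeff (gvar i * f) S =
      (\<Sum>I\<in>Pow S. if I = {i} then gsign i S * gcoeff f (S - {i}) else 0)"
    unfolding times_grassmann.rep_eq gvar.rep_eq using i
    by (intro sum.cong) (auto simp: gsign_def)
  then show ?thesis using True by (simp add: sum.delta)
next
  case False
  then have "infinite (S - {i})" by simp
  then show ?thesis using False by (simp add: gcoeff_infinite)
qed

section \<open>Left derivatives of the Grassmann algebra\<close>

lemma gderiv_simps [simp]:
  "gderiv i 0 = 0" "gderiv i (f + g) = gderiv i f + gderiv i g"
  "gderiv i (f - g) = gderiv i f - gderiv i g" "gderiv i (- f) = - gderiv i f"
  "gderiv i (gscalar c) = 0"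
  by (rule grassmann_eqI; auto simp add: gcoeff_gderiv gscalar.rep_eq algebra_simps)+

lemma gderiv_gscalar_mult: "gderiv i (gscalar c * f) = gscalar c * gderiv i f"
  by (rule grassmann_eqI) (simp add: gcoeff_gderiv gcoeff_gscalar_mult)

lemma gderiv_gparity: "gderiv i (gparity f) = - gparity (gderiv i f)"
proof (rule grassmann_eqI)
  fix S
  show "gcoeff (gderiv i (gparity f)) S = gcoeff (- gparity (gderiv i f)) S"
    by (cases "finite S") (simp_all add: gcoeff_gderiv gparity.rep_eq gcoeff_infinite)
qed

text \<open>The canonical anticommutation relation between multiplication and differentiation. It is
  the only sign count behind the super Leibniz rule \<open>gderiv_mult\<close>.\<close>

lemma gderiv_gvar_mult:
  assumes "i \<in> {1..6}" "j \<in> {1..6}"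
  shows "gderiv i (gvar j * f) = (if i = j then f else 0) - gvar j * gderiv i f"
proof (rule grassmann_eqI)
  fix S
  show "gcoeff (gderiv i (gvar j * f)) S = gcoeff ((if i = j then f else 0) - gvar j * gderiv i f) S"
  proof (cases "finite S")
    case True
    show ?thesis
    proof (cases "i = j")
      case eq: True
      show ?thesis
        using assms True eq
        by (auto simp: gcoeff_gderiv gcoeff_gvar_mult gsign_remove gsign_insert insert_absorb)
    next
      case False
      have "insert i S - {j} = insert i (S - {j})" using False by auto
      then show ?thesis
        using assms True False
        by (auto simp: gcoeff_gderiv gcoeff_gvar_mult gsign_remove gsign_insert)
    qed
  next
    case False
    then show ?thesis by (simp add: gcoeff_infinite)
  qed
qed

lemma gderiv_gderiv:
  "gderiv i (gderiv j f) = - gderiv j (gderiv i f)"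
proof (rule grassmann_eqI)
  fix S
  show "gcoeff (gderiv i (gderiv j f)) S = gcoeff (- gderiv j (gderiv i f)) S"
  proof (cases "finite S")
    case True
    then show ?thesis
      by (cases "i = j") (auto simp: gcoeff_gderiv gsign_insert insert_commute)
  qed (simp add: gcoeff_infinite)
qed

lemma gderiv_gvar:
  assumes "i \<in> {1..6}" "j \<in> {1..6}"
  shows "gderiv i (gvar j) = (if i = j then 1 else 0)"
  using gderiv_gvar_mult[OF assms, of 1] gderiv_simps(5)[of i 1] by (simp add: gscalar_one)

lemma gvar_anticommute:
  assumes "i \<in> {1..6}" "j \<in> {1..6}"
  shows "gvar i * (gvar j * f) = - (gvar j * (gvar i * f))"
proof (rule grassmann_eqI)
  fix S
  have "S - {i} - {j} = S - {j} - {i}" by auto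
  then show "gcoeff (gvar i * (gvar j * f)) S = gcoeff (- (gvar j * (gvar i * f))) S"
    using assms
    by (cases "finite S"; cases "i = j") (auto simp: gcoeff_gvar_mult gsign_remove gcoeff_infinite)
qed

lift_definition gmonomial :: "complex \<Rightarrow> nat set \<Rightarrow> grassmann"
  is "\<lambda>c S T. if T = S \<and> S \<subseteq> {1..6} then c else 0" by auto

text \<open>Monomials span, and every nonconstant one is an indeterminate times a shorter one. Sign
  rules can thus be checked on one factor at a time rather than in the sum over splittings that
  defines the product.\<close>

lemma grassmann_induct [case_names scalar add gvar]:
  assumes scalar: "\<And>c. P (gscalar c)" and add: "\<And>f g. P f \<Longrightarrow> P g \<Longrightarrow> P (f + g)"
    and gvar: "\<And>i f. i \<in> {1..6} \<Longrightarrow> P f \<Longrightarrow> P (gvar i * f)"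
  shows "P f"
proof -
  have zero: "P 0"
  proof -
    have "gscalar 0 = 0" by (rule grassmann_eqI) (simp add: gscalar.rep_eq)
    then show ?thesis using scalar[of 0] by simp
  qed
  have mono: "P (gmonomial c S)" if "S \<subseteq> {1..6}" for c S
    using finite_subset[OF that finite_atLeastAtMost] that
  proof (induction S arbitrary: c rule: finite_induct)
    case empty
    have "gmonomial c {} = gscalar c"
      by (rule grassmann_eqI) (simp add: gmonomial.rep_eq gscalar.rep_eq)
    then show ?case using scalar by simp
  next
    case (insert i S)
    have "gmonomial c (insert i S) = gvar i * gmonomial (gsign i (insert i S) * c) S"
    proof (rule grassmann_eqI)
      fix T
      have "i \<in> T \<Longrightarrow> T - {i} = S \<longleftrightarrow> T = insert i S" using insert.hyps by auto
      then show "gcoeff (gmonomial c (insert i S)) T =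
          gcoeff (gvar i * gmonomial (gsign i (insert i S) * c) S) T"
        using insert.prems by (auto simp: gmonomial.rep_eq gcoeff_gvar_mult)
    qed
    then show ?case using insert gvar by auto
  qed
  have "P (\<Sum>S\<in>A. gmonomial (gcoeff f S) S)" if "A \<subseteq> Pow {1..6}" for A
    using finite_subset[OF that] that
    by (induction A rule: infinite_finite_induct) (auto simp del: One_nat_def intro: add mono zero)
  moreover have "f = (\<Sum>S\<in>Pow {1..6}. gmonomial (gcoeff f S) S)"
  proof (rule grassmann_eqI)
    fix T
    have "gcoeff (\<Sum>S\<in>Pow {1..6}. gmonomial (gcoeff f S) S) T =
        (\<Sum>S\<in>Pow {1..6}. if S = T then gcoeff f T else 0)"
      unfolding gcoeff_sum by (rule sum.cong) (auto simp: gmonomial.rep_eq)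
    then show "gcoeff f T = gcoeff (\<Sum>S\<in>Pow {1..6}. gmonomial (gcoeff f S) S) T"
      by (auto simp: sum.delta gcoeff_outside)
  qed
  ultimately show ?thesis by (metis order_refl)
qed

lemma gvar_supercommute:
  assumes "i \<in> {1..6}"
  shows "f * gvar i = gvar i * gparity f"
proof (induction f rule: grassmann_induct)
  case (scalar c)
  show ?case by (simp add: gscalar_commute)
next
  case (gvar j f)
  then show ?case
    using gvar_anticommute[OF assms gvar(1), of "gparity f"]
    by (simp add: mult.assoc gparity_mult)
qed (simp add: algebra_simps)

lemma gderiv_mult:
  assumes "i \<in> {1..6}"
  shows "gderiv i (f * g) = gderiv i f * g + gparity f * gderiv i g"
proof (induction f rule: grassmann_induct)
  case (gvar j f)
  then show ?case
    using assms by (simp add: mult.assoc gparity_mult gderiv_gvar_mult algebra_simps)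
qed (simp_all add: gderiv_gscalar_mult algebra_simps)

lemma gcoeff_mult_low:
  "gcoeff (f * g) {} = gcoeff f {} * gcoeff g {}"
  "gcoeff (f * g) {i} = gcoeff f {} * gcoeff g {i} + gcoeff f {i} * gcoeff g {}"
  "i < j \<Longrightarrow> gcoeff (f * g) {i, j} = gcoeff f {} * gcoeff g {i, j} + gcoeff f {i, j} * gcoeff g {}
     + gcoeff f {i} * gcoeff g {j} - gcoeff f {j} * gcoeff g {i}"
proof -
  have inv: "inversions {j} {i} = (if i < j then 1 else 0)" for i j :: nat
  proof -
    have "{(x, y). x \<in> {j} \<and> y \<in> {i} \<and> y < x} = (if i < j then {(j, i)} else {})" by auto
    then show ?thesis by (simp add: inversions_def)
  qed
  show "gcoeff (f * g) {} = gcoeff f {} * gcoeff g {}"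
    by (simp add: times_grassmann.rep_eq)
  have P: "Pow {i} = {{}, {i}}" by auto
  show "gcoeff (f * g) {i} = gcoeff f {} * gcoeff g {i} + gcoeff f {i} * gcoeff g {}"
    by (simp add: times_grassmann.rep_eq P)
  assume ij: "i < j"
  have P: "Pow {i, j} = {{}, {i}, {j}, {i, j}}" by auto
  have S: "{i, j} - {i} = {j}" "{i, j} - {j} = {i}" "{i, j} - {i, j} = {}" using ij by auto
  have "{j} \<noteq> {i, j}" "{i} \<noteq> {i, j}" using ij by auto
  then show "gcoeff (f * g) {i, j} = gcoeff f {} * gcoeff g {i, j} + gcoeff f {i, j} * gcoeff g {}
     + gcoeff f {i} * gcoeff g {j} - gcoeff f {j} * gcoeff g {i}"
    using ij by (simp add: times_grassmann.rep_eq P S inv)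
qed

section \<open>The bracket of $K(1,6)$\<close>

definition ovar :: "nat \<Rightarrow> lambda16" where
  "ovar i = fps_const (gvar i)"

lemma xi_eq_ovar: "xi i = ovar i" and eta_eq_ovar: "eta i = ovar (i + 3)"
  by (simp_all add: xi_def eta_def ovar_def)

lemma sum_upto_3_6:
  "(\<Sum>i = 1..3. h i) = h 1 + h 2 + h (3::nat)"
  "(\<Sum>i = 1..6. h i) = h 1 + h 2 + h 3 + h 4 + h 5 + h (6::nat)"
  for h :: "nat \<Rightarrow> 'a::comm_monoid_add"
  by (simp_all add: eval_nat_numeral)

text \<open>The pairing of \<open>xi_i\<close> with \<open>eta_i\<close>: the invariant form on the
  odd variables is the sum of \<open>u_k v_(dual k)\<close>. With it the two families become one sum
  over six indices.\<close>

definition dual :: "nat \<Rightarrow> nat" where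
  "dual k = (if k \<le> 3 then k + 3 else k - 3)"

lemma dual_in [simp]: "k \<in> {1..6} \<Longrightarrow> dual k \<in> {1..6}"
  and dual_dual [simp]: "k \<in> {1..6} \<Longrightarrow> dual (dual k) = k"
  and dual_neq [simp]: "k \<in> {1..6} \<Longrightarrow> dual k \<noteq> k"
  by (auto simp: dual_def)

lemma dual_eq_iff: "k \<in> {1..6} \<Longrightarrow> i \<in> {1..6} \<Longrightarrow> dual k = i \<longleftrightarrow> k = dual i"
  by (auto simp: dual_def)

section \<open>Coefficients and differential calculus on \<open>Lambda(1,6)\<close>\<close>

lemma coeff16_simps [simp]:
  "coeff16 0 n S = 0" "coeff16 (f + g) n S = coeff16 f n S + coeff16 g n S"
  "coeff16 (f - g) n S = coeff16 f n S - coeff16 g n S"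
  "coeff16 (- f) n S = - coeff16 f n S"
  "coeff16 (scale16 c f) n S = c * coeff16 f n S"
  "coeff16 (fps_deriv f) n S = of_nat (Suc n) * coeff16 f (Suc n) S"
  "coeff16 (parity16 f) n S = (-1) ^ card S * coeff16 f n S"
  "coeff16 (d_odd i f) n S = (if i \<in> S then 0 else gsign i S * coeff16 f n (insert i S))"
proof -
  show "coeff16 (fps_deriv f) n S = of_nat (Suc n) * coeff16 f (Suc n) S"
    unfolding coeff16_def fps_deriv_nth gcoeff_of_nat_mult by simp
qed (simp_all add: coeff16_scale16, simp_all add: coeff16_def parity16_def d_odd_def
      gparity.rep_eq gcoeff_gderiv)

lemma coeff16_sum [simp]: "coeff16 (sum f A) n S = (\<Sum>i\<in>A. coeff16 (f i) n S)"
  by (induction A rule: infinite_finite_induct) auto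

lemma coeff16_outside: "\<not> S \<subseteq> {1..6} \<Longrightarrow> coeff16 f n S = 0"
  and coeff16_infinite: "infinite S \<Longrightarrow> coeff16 f n S = 0"
  by (simp_all add: coeff16_def gcoeff_outside gcoeff_infinite)

lemma coeff16_ovar_mult [simp]:
  "i \<in> {1..6} \<Longrightarrow>
    coeff16 (ovar i * f) n S = (if i \<in> S then gsign i S * coeff16 f n (S - {i}) else 0)"
  unfolding coeff16_def ovar_def fps_mult_left_const_nth by (rule gcoeff_gvar_mult)

lemma coeff16_t16_mult [simp]:
  "coeff16 (t16 * f) n S = (if n = 0 then 0 else coeff16 f (n - 1) S)"
  by (simp add: coeff16_def t16_def)

lemma coeff16_ovar:
  "i \<in> {1..6} \<Longrightarrow> coeff16 (ovar i) n S = (if n = 0 \<and> S = {i} then 1 else 0)"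
  unfolding coeff16_def ovar_def by (auto simp: gvar.rep_eq)

lemma coeff16_one: "coeff16 1 n S = (if n = 0 \<and> S = {} then 1 else 0)"
  by (simp add: coeff16_def one_grassmann.rep_eq)

lemma coeff16_t16: "coeff16 t16 n S = (if n = 1 \<and> S = {} then 1 else 0)"
  by (simp add: coeff16_def t16_def fps_X_def one_grassmann.rep_eq)

lemma scale16_mult_left: "scale16 c f * g = scale16 c (f * g)"
  by (simp add: scale16_def mult.assoc)

lemma scale16_mult_right: "f * scale16 c g = scale16 c (f * g)"
proof -
  have "f * fps_const (gscalar c) = fps_const (gscalar c) * f"
    by (simp add: fps_eq_iff gscalar_commute)
  then show ?thesis by (simp add: scale16_def flip: mult.assoc)
qed

lemma scale16_simps [simp]:
  "fps_deriv (scale16 c f) = scale16 c (fps_deriv f)" "parity16 (scale16 c f) = scale16 c (parity16 f)"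
  "d_odd i (scale16 c f) = scale16 c (d_odd i f)"
  by (rule coeff16_eqI; simp del: of_nat_Suc)+

lemma parity16_simps [simp]:
  "parity16 0 = 0" "parity16 (f + g) = parity16 f + parity16 g"
  "parity16 (f - g) = parity16 f - parity16 g" "parity16 (- f) = - parity16 f"
  "parity16 (parity16 f) = f" "parity16 (fps_deriv f) = fps_deriv (parity16 f)"
  by (rule coeff16_eqI; simp add: algebra_simps flip: power_mult_distrib)+

lemma d_odd_simps [simp]:
  "d_odd i 0 = 0" "d_odd i (f + g) = d_odd i f + d_odd i g"
  "d_odd i (f - g) = d_odd i f - d_odd i g" "d_odd i (- f) = - d_odd i f"
  "d_odd i (fps_deriv f) = fps_deriv (d_odd i f)"
  by (rule coeff16_eqI; simp add: algebra_simps)+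

lemma d_odd_parity16: "d_odd i (parity16 f) = - parity16 (d_odd i f)"
  by (rule fps_ext) (simp add: d_odd_def parity16_def gderiv_gparity)

lemma parity16_mult: "parity16 (f * g) = parity16 f * parity16 g"
proof -
  have "gparity (sum h A) = (\<Sum>i\<in>A. gparity (h i))" for h :: "nat \<Rightarrow> grassmann" and A
    by (induction A rule: infinite_finite_induct) auto
  then show ?thesis by (simp add: fps_eq_iff parity16_def fps_mult_nth gparity_mult)
qed

lemma d_odd_mult:
  assumes "i \<in> {1..6}"
  shows "d_odd i (f * g) = d_odd i f * g + parity16 f * d_odd i g"
proof -
  have "gderiv i (sum h A) = (\<Sum>j\<in>A. gderiv i (h j))" for h :: "nat \<Rightarrow> grassmann" and A
    by (induction A rule: infinite_finite_induct) auto
  then show ?thesis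
    by (simp add: fps_eq_iff parity16_def d_odd_def fps_mult_nth gderiv_mult[OF assms] sum.distrib)
qed

lemma ovar_supercommute: "i \<in> {1..6} \<Longrightarrow> f * ovar i = ovar i * parity16 f"
  by (simp add: fps_eq_iff ovar_def parity16_def gvar_supercommute)

lemma d_odd_d_odd: "d_odd i (d_odd j f) = - d_odd j (d_odd i f)"
  by (rule fps_ext) (simp add: d_odd_def gderiv_gderiv[of i])

lemma parity16_ovar [simp]: "parity16 (ovar i) = - ovar i"
  by (rule fps_ext) (simp add: parity16_def ovar_def)

lemma d_odd_ovar: 
  "i \<in> {1..6} \<Longrightarrow> j \<in> {1..6} \<Longrightarrow> d_odd i (ovar j) = (if i = j then 1 else 0)"
  by (rule fps_ext) (simp add: d_odd_def ovar_def gderiv_gvar)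

lemma d_odd_ovar_mult:
  "i \<in> {1..6} \<Longrightarrow> j \<in> {1..6} \<Longrightarrow>
    d_odd i (ovar j * f) = (if i = j then f else 0) - ovar j * d_odd i f"
  by (simp add: d_odd_mult d_odd_ovar)

lemma ovar_anticommute:
  "i \<in> {1..6} \<Longrightarrow> j \<in> {1..6} \<Longrightarrow> ovar i * (ovar j * f) = - (ovar j * (ovar i * f))"
  by (rule fps_ext) (simp add: ovar_def gvar_anticommute[of i])

text \<open>\<open>ovar k * d_odd k\<close> is the projection to the monomials containing
  \<open>k\<close>, so the sum over \<open>k\<close> counts the factors of
  \<open>e_S\<close>.\<close>

lemma coeff16_euler16: "coeff16 (euler16 f) n S = of_nat (card S) * coeff16 f n S"
proof (cases "S \<subseteq> {1..6}")
  case True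
  then have fin: "finite S" using finite_subset by blast
  have *: "coeff16 (ovar k * d_odd k f) n S = (if k \<in> S then coeff16 f n S else 0)"
    if "k \<in> {1..6}" for k
    using that fin by (auto simp: gsign_remove insert_absorb)
  have "euler16 f = (\<Sum>k = 1..6. ovar k * d_odd k f)"
    by (simp add: euler16_def xi_eq_ovar eta_eq_ovar d_xi_def d_eta_def
        sum_upto_3_6 add_ac del: One_nat_def)
  then have "coeff16 (euler16 f) n S = (\<Sum>k = 1..6. if k \<in> S then coeff16 f n S else 0)"
    using * by simp
  also have "\<dots> = (\<Sum>k\<in>{1..6} \<inter> S. coeff16 f n S)"
    by (rule sum.inter_restrict[symmetric]) simp
  also have "\<dots> = of_nat (card S) * coeff16 f n S"
    using True by (simp add: Int_absorb1)
  finally show ?thesis .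
qed (simp add: coeff16_outside)

section \<open>The bracket as a bilinear operation\<close>

definition two_minus_euler :: "lambda16 \<Rightarrow> lambda16" where
  "two_minus_euler f = 2 * f - euler16 f"

lemma coeff16_two_minus_euler [simp]:
  "coeff16 (two_minus_euler f) n S = (2 - of_nat (card S)) * coeff16 f n S"
  unfolding two_minus_euler_def mult_2 by (simp add: coeff16_euler16 algebra_simps)

lemma two_minus_euler_simps [simp]:
  "two_minus_euler (f + g) = two_minus_euler f + two_minus_euler g"
  "two_minus_euler (f - g) = two_minus_euler f - two_minus_euler g"
  "two_minus_euler (scale16 c f) = scale16 c (two_minus_euler f)"
  "two_minus_euler (parity16 f) = parity16 (two_minus_euler f)"
  "two_minus_euler (fps_deriv f) = fps_deriv (two_minus_euler f)"
  by (rule coeff16_eqI; simp add: algebra_simps)+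

text \<open>The Poisson bracket of the Grassmann algebra without its parity sign, which enters
  through \<open>parity16\<close> in the first argument.\<close>

definition contraction :: "lambda16 \<Rightarrow> lambda16 \<Rightarrow> lambda16" where
  "contraction f g = (\<Sum>k = 1..6. d_odd k f * d_odd (dual k) g)"

lemma bracket16_eq:
  "bracket16 f g = two_minus_euler f * fps_deriv g - fps_deriv f * two_minus_euler g
     + contraction (parity16 f) g"
  unfolding bracket16_def two_minus_euler_def contraction_def d_xi_def d_eta_def sum_upto_3_6
  by (simp add: dual_def add_ac)

lemma contraction_simps:
  "contraction (f + f') g = contraction f g + contraction f' g"
  "contraction f (g + g') = contraction f g + contraction f g'"
  "contraction (scale16 c f) g = scale16 c (contraction f g)"
  "contraction f (scale16 c g) = scale16 c (contraction f g)"
  by (simp_all add: contraction_def distrib_left distrib_right sum.distrib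
      scale16_mult_left scale16_mult_right K16.scale_sum_right)

lemma bracket16_add:
  "bracket16 (f + f') g = bracket16 f g + bracket16 f' g"
  "bracket16 f (g + g') = bracket16 f g + bracket16 f g'"
  by (simp_all add: bracket16_eq contraction_simps algebra_simps)

lemma bracket16_scale:
  "bracket16 (scale16 c f) g = scale16 c (bracket16 f g)"
  "bracket16 f (scale16 c g) = scale16 c (bracket16 f g)"
  by (simp_all add: bracket16_eq contraction_simps scale16_mult_left scale16_mult_right
      K16.scale_right_distrib K16.scale_right_diff_distrib)

lemma scale16_minus_one: "scale16 (-1) f = - f"
  by (rule coeff16_eqI) simp

lemma bracket16_zero [simp]: "bracket16 f 0 = 0" "bracket16 0 g = 0"
  using bracket16_add(2)[of f 0 0] bracket16_add(1)[of 0 0 g] by simp_all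

lemma bracket16_minus:
  "bracket16 (- f) g = - bracket16 f g" "bracket16 f (- g) = - bracket16 f g"
  using bracket16_scale[of "-1"] bracket16_scale(2)[of f "-1"] by (simp_all add: scale16_minus_one)

lemma bracket16_diff:
  "bracket16 (f - f') g = bracket16 f g - bracket16 f' g"
  "bracket16 f (g - g') = bracket16 f g - bracket16 f g'"
  using bracket16_add(1)[of f "- f'" g] bracket16_add(2)[of f g "- g'"]
  by (simp_all add: bracket16_minus)

lemma bracket16_sum:
  "bracket16 (sum F A) g = (\<Sum>i\<in>A. bracket16 (F i) g)"
  "bracket16 f (sum G A) = (\<Sum>i\<in>A. bracket16 f (G i))"
  by (induction A rule: infinite_finite_induct) (simp_all add: bracket16_add)

text \<open>Continuity of the bracket: it differentiates at most once in t, hence order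
  \<open>n\<close> of the result depends on the arguments up to order \<open>n + 1\<close>.\<close>

lemma bracket16_cong:
  assumes f: "\<And>k. k \<le> Suc n \<Longrightarrow> fps_nth f k = fps_nth f' k"
    and g: "\<And>k. k \<le> Suc n \<Longrightarrow> fps_nth g k = fps_nth g' k"
  shows "fps_nth (bracket16 f g) n = fps_nth (bracket16 f' g') n"
proof -
  have mult: "fps_nth (u * v) n = fps_nth (u' * v') n"
    if "\<And>k. k \<le> n \<Longrightarrow> fps_nth u k = fps_nth u' k" "\<And>k. k \<le> n \<Longrightarrow> fps_nth v k = fps_nth v' k"
    for u v u' v' :: lambda16
    unfolding fps_mult_nth by (intro sum.cong refl arg_cong2[where f = "(*)"] that) simp_all
  have deg: "fps_nth (two_minus_euler u) k = fps_nth (two_minus_euler u') k"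
    if "fps_nth u k = fps_nth u' k" for u u' k
  proof (rule grassmann_eqI)
    fix S
    have "coeff16 u k S = coeff16 u' k S" using that by (simp add: coeff16_def)
    then have "coeff16 (two_minus_euler u) k S = coeff16 (two_minus_euler u') k S" by simp
    then show "gcoeff (fps_nth (two_minus_euler u) k) S = gcoeff (fps_nth (two_minus_euler u') k) S"
      by (simp add: coeff16_def)
  qed
  have deriv: "fps_nth (fps_deriv u) k = fps_nth (fps_deriv u') k"
    if "fps_nth u (Suc k) = fps_nth u' (Suc k)" for u u' :: lambda16 and k
    by (simp add: that del: of_nat_Suc of_nat_add)
  have odd: "fps_nth (d_odd i u) k = fps_nth (d_odd i u') k"
    if "fps_nth u k = fps_nth u' k" for u u' i k
    by (simp add: d_odd_def that)
  have par: "fps_nth (parity16 u) k = fps_nth (parity16 u') k"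
    if "fps_nth u k = fps_nth u' k" for u u' k
    by (simp add: parity16_def that)
  have f': "fps_nth f k = fps_nth f' k" "fps_nth f (Suc k) = fps_nth f' (Suc k)"
    and g': "fps_nth g k = fps_nth g' k" "fps_nth g (Suc k) = fps_nth g' (Suc k)"
    if "k \<le> n" for k
    using that by (auto intro: f g)
  have "fps_nth (two_minus_euler f * fps_deriv g) n = fps_nth (two_minus_euler f' * fps_deriv g') n"
    by (rule mult; rule deg deriv; erule f' g')
  moreover have
    "fps_nth (fps_deriv f * two_minus_euler g) n = fps_nth (fps_deriv f' * two_minus_euler g') n"
    by (rule mult; rule deg deriv; erule f' g')
  moreover have "fps_nth (d_odd k (parity16 f) * d_odd (dual k) g) n =
      fps_nth (d_odd k (parity16 f') * d_odd (dual k) g') n" for k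
    apply (rule mult) apply (rule odd) apply (rule par) apply (erule f')
    apply (rule odd) apply (erule g') done
  then have "fps_nth (contraction (parity16 f) g) n = fps_nth (contraction (parity16 f') g') n"
    by (simp only: contraction_def fps_sum_nth)
  ultimately show ?thesis
    by (simp only: bracket16_eq fps_add_nth fps_sub_nth)
qed

lemma bracket16_one: "bracket16 1 g = 2 * fps_deriv g"
proof -
  have "two_minus_euler 1 = 1 + 1" "parity16 1 = 1" "d_odd k 1 = 0" for k
    by (rule coeff16_eqI; auto simp: coeff16_one simp del: one_add_one)+
  then show ?thesis by (simp add: bracket16_eq contraction_def)
qed

section \<open>Gradings\<close>

text \<open>The pairing condition makes the bracket homogeneous. The signs bound all degrees below
  by \<open>-a\<close> and make the degree grow with the power of t.\<close>

definition admissible :: "int \<Rightarrow> int list \<Rightarrow> bool" where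
  "admissible a b \<longleftrightarrow> 0 < a \<and>
     (\<forall>k\<in>{1..6}. 0 \<le> b ! (k - 1) \<and> b ! (k - 1) + b ! (dual k - 1) = a)"

text \<open>Degrees are handled through supports: homogeneity and membership in a filtration step
  become inclusions, and cancellation in sums and products does no harm.\<close>

definition degs :: "int \<Rightarrow> int list \<Rightarrow> lambda16 \<Rightarrow> int set" where
  "degs a b f = {deg16 a b n S |n S. coeff16 f n S \<noteq> 0}"

lemma degs_E:
  assumes "p \<in> degs a b f"
  obtains n S where "p = deg16 a b n S" "coeff16 f n S \<noteq> 0" "S \<subseteq> {1..6}" "finite S"
proof -
  obtain n S where "p = deg16 a b n S" "coeff16 f n S \<noteq> 0"
    using assms by (auto simp: degs_def)
  moreover have "S \<subseteq> {1..6}" "finite S"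
    using \<open>coeff16 f n S \<noteq> 0\<close> coeff16_outside coeff16_infinite by blast+
  ultimately show ?thesis using that by blast
qed

lemma degs_add: "degs a b (f + g) \<subseteq> degs a b f \<union> degs a b g"
  and degs_diff: "degs a b (f - g) \<subseteq> degs a b f \<union> degs a b g"
  and degs_scale: "degs a b (scale16 c f) \<subseteq> degs a b f"
  and degs_parity: "degs a b (parity16 f) \<subseteq> degs a b f"
  and degs_two_minus_euler: "degs a b (two_minus_euler f) \<subseteq> degs a b f"
  and degs_0 [simp]: "degs a b 0 = {}"
  by (auto simp: degs_def) (metis add.right_neutral diff_zero)+

lemma degs_sum: "degs a b (sum F A) \<subseteq> (\<Union>i\<in>A. degs a b (F i))"
proof (induction A rule: infinite_finite_induct)
  case (insert x A)
  then show ?case using degs_add[of a b "F x" "sum F A"] by auto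
qed auto

lemma degs_deriv: "degs a b (fps_deriv f) \<subseteq> (\<lambda>p. p - a) ` degs a b f"
proof
  fix p assume "p \<in> degs a b (fps_deriv f)"
  then obtain n S where "p = deg16 a b n S" "coeff16 (fps_deriv f) n S \<noteq> 0" by (rule degs_E)
  then have "coeff16 f (Suc n) S \<noteq> 0" "p = deg16 a b (Suc n) S - a"
    by (auto simp: deg16_def algebra_simps)
  then show "p \<in> (\<lambda>p. p - a) ` degs a b f" by (auto simp: degs_def)
qed

lemma degs_d_odd:
  assumes "i \<in> {1..6}"
  shows "degs a b (d_odd i f) \<subseteq> (\<lambda>p. p - b ! (i - 1)) ` degs a b f"
proof
  fix p assume "p \<in> degs a b (d_odd i f)"
  then obtain n S where p: "p = deg16 a b n S" "coeff16 (d_odd i f) n S \<noteq> 0" "finite S"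
    by (rule degs_E)
  then have "coeff16 f n (insert i S) \<noteq> 0" "p = deg16 a b n (insert i S) - b ! (i - 1)"
    by (auto simp: deg16_def split: if_splits)
  then show "p \<in> (\<lambda>p. p - b ! (i - 1)) ` degs a b f" by (auto simp: degs_def)
qed

lemma coeff16_mult_nonzero:
  assumes "coeff16 (f * g) n S \<noteq> 0"
  obtains m I where "m \<le> n" "I \<subseteq> S" "coeff16 f m I \<noteq> 0" "coeff16 g (n - m) (S - I) \<noteq> 0"
proof -
  have "(\<Sum>m = 0..n. gcoeff (fps_nth f m * fps_nth g (n - m)) S) \<noteq> 0"
    using assms by (simp add: coeff16_def fps_mult_nth)
  then obtain m where m: "m \<le> n" "gcoeff (fps_nth f m * fps_nth g (n - m)) S \<noteq> 0"
    by (metis (no_types, lifting) atLeastAtMost_iff sum.neutral)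
  then obtain I where "I \<in> Pow S" 
    "(-1) ^ inversions I (S - I) * gcoeff (fps_nth f m) I * gcoeff (fps_nth g (n - m)) (S - I) \<noteq> 0"
    unfolding times_grassmann.rep_eq by (meson sum.neutral)
  with m that[of m I] show ?thesis by (simp add: coeff16_def)
qed

text \<open>The shift by \<open>-a\<close> in \<open>deg16\<close> is present once for the product
  but twice for the factors, whence the \<open>+ a\<close>.\<close>

lemma degs_mult:
  "degs a b (f * g) \<subseteq> {p + q + a |p q. p \<in> degs a b f \<and> q \<in> degs a b g}"
proof
  fix r assume "r \<in> degs a b (f * g)"
  then obtain n S where r: "r = deg16 a b n S" "coeff16 (f * g) n S \<noteq> 0" "finite S"
    by (rule degs_E)
  then obtain m I where mI: "m \<le> n" "I \<subseteq> S" "coeff16 f m I \<noteq> 0" "coeff16 g (n - m) (S - I) \<noteq> 0"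
    using coeff16_mult_nonzero by blast
  have "(\<Sum>i\<in>S. b ! (i - 1)) = (\<Sum>i\<in>I. b ! (i - 1)) + (\<Sum>i\<in>S - I. b ! (i - 1))"
    using r(3) mI(2) by (metis add.commute sum.subset_diff)
  then have "r = deg16 a b m I + deg16 a b (n - m) (S - I) + a"
    using r(1) mI(1) by (simp add: deg16_def of_nat_diff algebra_simps)
  then show "r \<in> {p + q + a |p q. p \<in> degs a b f \<and> q \<in> degs a b g}"
    using mI(3,4) by (auto simp: degs_def)
qed

text \<open>Every term of the bracket is a product, which adds \<open>a\<close>, and carries either
  one t-derivative or one dual pair of odd derivatives, which costs exactly
  \<open>a\<close>.\<close>

lemma degs_bracket:
  assumes ab: "admissible a b" and r: "r \<in> degs a b (bracket16 f g)"
  obtains p q where "r = p + q" "p \<in> degs a b f" "q \<in> degs a b g"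
proof -
  have "r \<in> degs a b (two_minus_euler f * fps_deriv g) \<union> degs a b (fps_deriv f * two_minus_euler g)
      \<union> (\<Union>k\<in>{1..6}. degs a b (d_odd k (parity16 f) * d_odd (dual k) g))"
    using r degs_add[of a b "two_minus_euler f * fps_deriv g - fps_deriv f * two_minus_euler g"
        "contraction (parity16 f) g"]
      degs_diff[of a b "two_minus_euler f * fps_deriv g" "fps_deriv f * two_minus_euler g"]
      degs_sum[of a b "\<lambda>k. d_odd k (parity16 f) * d_odd (dual k) g" "{1..6}"]
    unfolding bracket16_eq contraction_def by blast
  then consider "r \<in> degs a b (two_minus_euler f * fps_deriv g)"
    | "r \<in> degs a b (fps_deriv f * two_minus_euler g)"
    | k where "k \<in> {1..6}" "r \<in> degs a b (d_odd k (parity16 f) * d_odd (dual k) g)"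
    by blast
  then show ?thesis
  proof cases
    case 1
    then obtain p q where pq: "r = p + q + a" "p \<in> degs a b (two_minus_euler f)"
      "q \<in> degs a b (fps_deriv g)"
      using degs_mult by blast
    moreover obtain q' where "q = q' - a" "q' \<in> degs a b g"
      using pq(3) degs_deriv by blast
    ultimately show ?thesis using that[of p q'] degs_two_minus_euler by auto
  next
    case 2
    then obtain p q where pq: "r = p + q + a" "p \<in> degs a b (fps_deriv f)"
      "q \<in> degs a b (two_minus_euler g)"
      using degs_mult by blast
    moreover obtain p' where "p = p' - a" "p' \<in> degs a b f"
      using pq(2) degs_deriv by blast
    ultimately show ?thesis using that[of p' q] degs_two_minus_euler by auto
  next
    case 3
    then obtain p q where pq: "r = p + q + a" "p \<in> degs a b (d_odd k (parity16 f))"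
      "q \<in> degs a b (d_odd (dual k) g)"
      using degs_mult by blast
    obtain p' where p': "p = p' - b ! (k - 1)" "p' \<in> degs a b f"
      using pq(2) degs_d_odd[OF 3(1)] degs_parity by blast
    obtain q' where q': "q = q' - b ! (dual k - 1)" "q' \<in> degs a b g"
      using pq(3) degs_d_odd[OF dual_in[OF 3(1)]] by blast
    have "b ! (k - 1) + b ! (dual k - 1) = a"
      using ab 3(1) by (simp add: admissible_def)
    then show ?thesis using that[of p' q'] pq(1) p' q' by simp
  qed
qed

lemma degs_ge:
  assumes "admissible a b" "p \<in> degs a b f"
  shows "- a \<le> p"
proof -
  obtain n S where p: "p = deg16 a b n S" "S \<subseteq> {1..6}"
    using assms(2) by (rule degs_E)
  have "0 \<le> (\<Sum>i\<in>S. b ! (i - 1))"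
    using assms(1) p(2) by (intro sum_nonneg) (auto simp: admissible_def)
  then show ?thesis using p assms(1) by (simp add: deg16_def admissible_def)
qed

section \<open>Homogeneous components\<close>

lemma coeff16_component16 [simp]:
  "coeff16 (component16 a b j f) n S = (if deg16 a b n S = j then coeff16 f n S else 0)"
  by (simp add: coeff16_def component16_def gfilter.rep_eq)

lemma component16_simps:
  "component16 a b j (f + g) = component16 a b j f + component16 a b j g"
  "component16 a b j (scale16 c f) = scale16 c (component16 a b j f)"
  "component16 a b j (parity16 f) = parity16 (component16 a b j f)"
  "component16 a b j 0 = 0"
  "component16 a b j (component16 a b j f) = component16 a b j f"
  by (rule coeff16_eqI; simp)+

lemma component16_sum: "component16 a b j (sum F A) = (\<Sum>i\<in>A. component16 a b j (F i))"
  by (induction A rule: infinite_finite_induct) (simp_all add: component16_simps)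

lemma degs_component16: "degs a b (component16 a b j f) \<subseteq> {j} \<inter> degs a b f"
  by (auto simp: degs_def split: if_splits)

lemma component16_homogeneous:
  assumes "degs a b f \<subseteq> {d}"
  shows "component16 a b j f = (if j = d then f else 0)"
proof (rule coeff16_eqI)
  fix n S
  have "coeff16 f n S \<noteq> 0 \<Longrightarrow> deg16 a b n S = d" using assms by (auto simp: degs_def)
  then show "coeff16 (component16 a b j f) n S = coeff16 (if j = d then f else 0) n S"
    by auto
qed

lemma component16_eq_0: "j \<notin> degs a b f \<Longrightarrow> component16 a b j f = 0"
  by (rule coeff16_eqI) (auto simp: degs_def)

lemma coeff16_component16_sum:
  "coeff16 (\<Sum>i\<in>{p..q}. component16 a b i f) n S =
    (if deg16 a b n S \<in> {p..q} then coeff16 f n S else 0)"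
  by (simp add: sum.delta)

section \<open>The Lie superalgebra $E(1,6)$\<close>

lemma dist_fps_less_iff:
  fixes f g :: "'a::group_add fps"
  shows "dist f g < inverse (2 ^ n) \<longleftrightarrow> (\<forall>k\<le>n. fps_nth f k = fps_nth g k)"
proof (cases "f = g")
  case False
  then have nz: "f - g \<noteq> 0" by simp
  have "dist f g < inverse (2 ^ n) \<longleftrightarrow> n < subdegree (f - g)"
    using False by (simp add: dist_fps_def)
  also have "\<dots> \<longleftrightarrow> (\<forall>k\<le>n. fps_nth (f - g) k = 0)"
    using subdegree_geI[OF nz, of "Suc n"]
      nth_less_subdegree_zero[of _ "f - g"]
    by (auto simp: less_Suc_eq_le Suc_le_eq)
  finally show ?thesis by simp
qed simp

lemma in_closure_fps_iff:
  fixes A :: "'a::group_add fps set"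
  shows "f \<in> closure A \<longleftrightarrow> (\<forall>n. \<exists>h\<in>A. \<forall>k\<le>n. fps_nth h k = fps_nth f k)"
proof -
  have "\<exists>n. inverse (2 ^ n) < e" if "e > 0" for e :: real
    using that real_arch_pow_inv[of e "1/2"] by (auto simp: power_one_over inverse_eq_divide)
  then have "(\<forall>e>0. \<exists>h\<in>A. dist h f < e) \<longleftrightarrow> (\<forall>n. \<exists>h\<in>A. dist h f < inverse (2 ^ n))"
    by (force intro: less_trans)
  then show ?thesis by (simp add: closure_approachable dist_fps_less_iff)
qed

text \<open>A subspace that contains a neighbourhood of 0 also contains the translates of it by its
  own elements, so openness is a condition at 0 alone.\<close>

lemma openin_fps_subspace_iff:
  assumes "K16.subspace M" "K16.subspace L"
  shows "openin (top_of_set L) M \<longleftrightarrow>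
    M \<subseteq> L \<and> (\<exists>n. \<forall>f\<in>L. (\<forall>k\<le>n. fps_nth f k = 0) \<longrightarrow> f \<in> M)"
proof (intro iffI conjI)
  assume o: "openin (top_of_set L) M"
  show "M \<subseteq> L" using o openin_imp_subset by blast
  have "0 \<in> M" using assms(1) K16.subspace_0 by blast
  then obtain e where e: "e > 0" "\<And>f. f \<in> L \<Longrightarrow> dist f 0 < e \<Longrightarrow> f \<in> M"
    using o unfolding openin_euclidean_subtopology_iff by blast
  obtain n where n: "inverse (2 ^ n) < e"
    using e(1) real_arch_pow_inv[of e "1/2"] by (auto simp: power_one_over inverse_eq_divide)
  have "f \<in> M" if "f \<in> L" "\<forall>k\<le>n. fps_nth f k = 0" for f
    using dist_fps_less_iff[of f 0 n] n that by (intro e(2)) auto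
  then show "\<exists>n. \<forall>f\<in>L. (\<forall>k\<le>n. fps_nth f k = 0) \<longrightarrow> f \<in> M" by blast
next
  assume "M \<subseteq> L \<and> (\<exists>n. \<forall>f\<in>L. (\<forall>k\<le>n. fps_nth f k = 0) \<longrightarrow> f \<in> M)"
  then obtain n where MsubL: "M \<subseteq> L" and n: "\<And>f. f \<in> L \<Longrightarrow> \<forall>k\<le>n. fps_nth f k = 0 \<Longrightarrow> f \<in> M"
    by blast
  have "g \<in> M" if "f \<in> M" "g \<in> L" "dist g f < inverse (2 ^ n)" for f g
  proof -
    have "g - f \<in> M"
      using that MsubL n[of "g - f"] K16.subspace_diff[OF assms(2)] by (auto simp: dist_fps_less_iff)
    then show ?thesis using K16.subspace_add[OF assms(1) that(1)] by fastforce
  qed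
  then show "openin (top_of_set L) M"
    unfolding openin_euclidean_subtopology_iff using MsubL
    by (intro conjI ballI exI[of _ "inverse (2 ^ n)"]) auto
qed

lemma lie_subalgebra16_hull: "lie_subalgebra16 (lie_subalgebra16 hull A)"
  by (rule hull_in) (auto simp: lie_subalgebra16_def intro!: K16.subspace_Inter)

lemma fps_nth_scale16: "fps_nth (scale16 c f) n = gscalar c * fps_nth f n"
  by (simp add: scale16_def)

lemma lie_subalgebra16_closure:
  assumes H: "lie_subalgebra16 H"
  shows "lie_subalgebra16 (closure H)"
  unfolding lie_subalgebra16_def
proof (intro conjI ballI)
  have H0: "0 \<in> H" and Hadd: "\<And>f g. f \<in> H \<Longrightarrow> g \<in> H \<Longrightarrow> f + g \<in> H"
    and Hscale: "\<And>c f. f \<in> H \<Longrightarrow> scale16 c f \<in> H"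
    and Hpar: "\<And>f. f \<in> H \<Longrightarrow> parity16 f \<in> H"
    and Hbr: "\<And>f g. f \<in> H \<Longrightarrow> g \<in> H \<Longrightarrow> bracket16 f g \<in> H"
    using H by (auto simp: lie_subalgebra16_def K16.subspace_def)
  show "K16.subspace (closure H)"
    unfolding K16.subspace_def in_closure_fps_iff
  proof (intro conjI allI ballI impI)
    fix n show "\<exists>h\<in>H. \<forall>k\<le>n. fps_nth h k = fps_nth 0 k" using H0 by blast
  next
    fix x y n
    assume "x \<in> closure H" "y \<in> closure H"
    then obtain h h' where "h \<in> H" "h' \<in> H" "\<forall>k\<le>n. fps_nth h k = fps_nth x k"
      "\<forall>k\<le>n. fps_nth h' k = fps_nth y k"
      unfolding in_closure_fps_iff by meson
    then show "\<exists>h\<in>H. \<forall>k\<le>n. fps_nth h k = fps_nth (x + y) k"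
      using Hadd by (intro bexI[of _ "h + h'"]) auto
  next
    fix c x n
    assume "x \<in> closure H"
    then obtain h where "h \<in> H" "\<forall>k\<le>n. fps_nth h k = fps_nth x k"
      unfolding in_closure_fps_iff by meson
    then show "\<exists>h\<in>H. \<forall>k\<le>n. fps_nth h k = fps_nth (scale16 c x) k"
      using Hscale by (intro bexI[of _ "scale16 c h"]) (auto simp: fps_nth_scale16)
  qed
  fix f assume f: "f \<in> closure H"
  show "parity16 f \<in> closure H"
    unfolding in_closure_fps_iff
  proof
    fix n
    obtain h where "h \<in> H" "\<forall>k\<le>n. fps_nth h k = fps_nth f k"
      using f unfolding in_closure_fps_iff by meson
    then show "\<exists>h\<in>H. \<forall>k\<le>n. fps_nth h k = fps_nth (parity16 f) k"
      using Hpar by (intro bexI[of _ "parity16 h"]) (auto simp: parity16_def)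
  qed
  fix g assume g: "g \<in> closure H"
  show "bracket16 f g \<in> closure H"
    unfolding in_closure_fps_iff
  proof
    fix n
    obtain h h' where h: "h \<in> H" "h' \<in> H" "\<forall>k\<le>Suc n. fps_nth h k = fps_nth f k"
      "\<forall>k\<le>Suc n. fps_nth h' k = fps_nth g k"
      using f g unfolding in_closure_fps_iff by meson
    have "fps_nth (bracket16 h h') k = fps_nth (bracket16 f g) k" if "k \<le> n" for k
      using that h by (intro bracket16_cong) auto
    then show "\<exists>h\<in>H. \<forall>k\<le>n. fps_nth h k = fps_nth (bracket16 f g) k"
      using Hbr h by blast
  qed
qed

lemma lie_subalgebra16_E16: "lie_subalgebra16 E16"
  unfolding E16_def by (intro lie_subalgebra16_closure lie_subalgebra16_hull)

lemma subspace_E16: "K16.subspace E16"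
  and parity16_E16: "f \<in> E16 \<Longrightarrow> parity16 f \<in> E16"
  and bracket16_E16: "f \<in> E16 \<Longrightarrow> g \<in> E16 \<Longrightarrow> bracket16 f g \<in> E16"
  using lie_subalgebra16_E16 by (auto simp: lie_subalgebra16_def)

lemmas E16_intros = K16.subspace_0[OF subspace_E16] K16.subspace_add[OF subspace_E16]
  K16.subspace_diff[OF subspace_E16] K16.subspace_scale[OF subspace_E16]
  K16.subspace_neg[OF subspace_E16] K16.subspace_sum[OF subspace_E16] parity16_E16 bracket16_E16

section \<open>The generators of \<open>E16\<close>\<close>

lemma generators_subset_E16: "g_minus1 \<union> g_0 \<union> g_minus1_dual \<union> g_1_plus \<subseteq> E16"
  unfolding E16_def by (rule order_trans[OF hull_subset closure_subset])

lemma E16_closed: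
  assumes "\<And>n. \<exists>h\<in>E16. \<forall>k\<le>n. fps_nth h k = fps_nth f k"
  shows "f \<in> E16"
proof -
  have "f \<in> closure E16" using assms by (simp add: in_closure_fps_iff)
  then show ?thesis by (simp add: E16_def)
qed

lemma odd_variables: "xi ` {1..3} \<union> eta ` {1..3} = ovar ` {1..6}"
proof -
  have "{1..3} = {1, 2, 3 :: nat}" "{1..6} = {1, 2, 3, 4, 5, 6 :: nat}" by auto
  then show ?thesis by (simp add: xi_eq_ovar eta_eq_ovar insert_commute)
qed

lemma ovar_E16: "i \<in> {1..6} \<Longrightarrow> ovar i \<in> E16"
  using generators_subset_E16 K16.span_base[of "ovar i" "ovar ` {1..6}"]
  unfolding g_minus1_def odd_variables by blast

lemma ovar_mult_ovar_E16:
  assumes "i \<in> {1..6}" "j \<in> {1..6}"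
  shows "ovar i * ovar j \<in> E16"
proof -
  have "ovar i * ovar j \<in> g_0"
    unfolding g_0_def odd_variables using assms by (intro K16.span_base) blast
  then show ?thesis using generators_subset_E16 by blast
qed

lemma t16_ovar_E16:
  assumes "i \<in> {1..6}"
  shows "t16 * ovar i \<in> E16"
proof -
  have "(\<lambda>i. t16 * xi i) ` {1..3} \<union> (\<lambda>i. t16 * eta i) ` {1..3} = (*) t16 ` ovar ` {1..6}"
    unfolding odd_variables[symmetric] by (simp add: image_Un image_image)
  then have "t16 * ovar i \<in> g_minus1_dual"
    unfolding g_minus1_dual_def using assms by (intro K16.span_base) blast
  then show ?thesis using generators_subset_E16 by blast
qed

definition homogeneous :: "int \<Rightarrow> int list \<Rightarrow> int \<Rightarrow> lambda16 \<Rightarrow> bool" where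
  "homogeneous a b d f \<longleftrightarrow> degs a b f \<subseteq> {d}"

lemma homogeneous_ovar: "i \<in> {1..6} \<Longrightarrow> homogeneous a b (b ! (i - 1) - a) (ovar i)"
  by (auto simp: homogeneous_def degs_def coeff16_ovar deg16_def split: if_splits)

lemma homogeneous_t16: "homogeneous a b 0 t16"
  by (auto simp: homogeneous_def degs_def coeff16_t16 deg16_def split: if_splits)

lemma homogeneous_mult:
  "homogeneous a b p f \<Longrightarrow> homogeneous a b q g \<Longrightarrow> homogeneous a b (p + q + a) (f * g)"
  unfolding homogeneous_def using degs_mult[of a b f g] by fastforce

lemma homogeneous_add:
  "homogeneous a b p f \<Longrightarrow> homogeneous a b q g \<Longrightarrow> p = q \<Longrightarrow> homogeneous a b p (f + g)"
  and homogeneous_diff: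
  "homogeneous a b p f \<Longrightarrow> homogeneous a b q g \<Longrightarrow> p = q \<Longrightarrow> homogeneous a b p (f - g)"
  unfolding homogeneous_def using degs_add[of a b f g] degs_diff[of a b f g] by blast+

text \<open>The product \<open>xi_j eta_j\<close> has degree 0 in every type because
  \<open>b_j + b_(j+3) = a\<close>. Hence the generators with two terms, a variable times a
  combination of such products, are homogeneous like the monomial ones.\<close>

lemma component16_generators:
  assumes ab: "admissible a b" and x: "x \<in> g_minus1 \<union> g_0 \<union> g_minus1_dual \<union> g_1_plus"
  shows "component16 a b j x \<in> E16"
proof -
  let ?W = "{f. component16 a b j f \<in> E16}"
  have W: "K16.subspace ?W"
    unfolding K16.subspace_def
    by (simp add: component16_simps E16_intros)
  have span: "K16.span A \<subseteq> ?W" if sub: "K16.span A \<subseteq> E16"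
      and hom: "\<And>f. f \<in> A \<Longrightarrow> \<exists>d. homogeneous a b d f" for A
  proof (rule K16.span_minimal[OF _ W], rule subsetI, rule CollectI)
    fix f assume "f \<in> A"
    then obtain d where "homogeneous a b d f" using hom by blast
    moreover have "f \<in> E16" using sub K16.span_base[OF \<open>f \<in> A\<close>] by (rule subsetD)
    ultimately show "component16 a b j f \<in> E16"
      using component16_homogeneous[of a b f d j] E16_intros(1) by (simp add: homogeneous_def)
  qed
  have ov: "homogeneous a b (b ! (i - 1) - a) (xi i)" "homogeneous a b (b ! (i + 2) - a) (eta i)"
    if "i \<in> {1..3}" for i
  proof -
    have i: "i \<in> {1..6}" "i + 3 \<in> {1..6}" "i + 3 - 1 = i + 2" using that by simp_all
    show "homogeneous a b (b ! (i - 1) - a) (xi i)" "homogeneous a b (b ! (i + 2) - a) (eta i)"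
      using homogeneous_ovar[OF i(1), of a b] homogeneous_ovar[OF i(2), of a b]
      unfolding xi_eq_ovar eta_eq_ovar i(3) by simp_all
  qed
  have ov': "\<exists>d. homogeneous a b d u" if "u \<in> xi ` {1..3} \<union> eta ` {1..3}" for u
    using that ov by blast
  have "\<forall>k\<in>{1..6}. b ! (k - 1) + b ! (dual k - 1) = a"
    using ab by (simp add: admissible_def)
  from bspec[OF this, of 1] bspec[OF this, of 2] bspec[OF this, of 3]
  have eqs: "b ! 3 = a - b ! 0" "b ! 4 = a - b ! 1" "b ! 5 = a - b ! 2"
    by (simp_all add: dual_def)
  have ovs: "homogeneous a b (b ! 0 - a) (xi 1)" "homogeneous a b (b ! 1 - a) (xi 2)"
    "homogeneous a b (b ! 2 - a) (xi 3)" "homogeneous a b (- b ! 0) (eta 1)"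
    "homogeneous a b (- b ! 1) (eta 2)" "homogeneous a b (- b ! 2) (eta 3)"
    using ov[of 1] ov[of 2] ov[of 3] eqs by (simp_all del: One_nat_def) simp_all
  have E: "g_minus1 \<subseteq> E16" "g_0 \<subseteq> E16" "g_minus1_dual \<subseteq> E16" "g_1_plus \<subseteq> E16"
    using generators_subset_E16 by simp_all
  have "g_minus1 \<subseteq> ?W"
    unfolding g_minus1_def using E(1)[unfolded g_minus1_def] by (rule span) (rule ov')
  moreover have "g_0 \<subseteq> ?W"
    unfolding g_0_def using E(2)[unfolded g_0_def]
  proof (rule span)
    fix f assume "f \<in> {t16} \<union> {u * v |u v. u \<in> xi ` {1..3} \<union> eta ` {1..3} \<and> v \<in> xi ` {1..3} \<union> eta ` {1..3}}"
    then consider "f = t16" | u v where "f = u * v" "u \<in> xi ` {1..3} \<union> eta ` {1..3}"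
      "v \<in> xi ` {1..3} \<union> eta ` {1..3}"
      by blast
    then show "\<exists>d. homogeneous a b d f"
      by cases (use homogeneous_t16 in blast, metis ov' homogeneous_mult)
  qed
  moreover have "g_minus1_dual \<subseteq> ?W"
    unfolding g_minus1_dual_def using E(3)[unfolded g_minus1_dual_def]
  proof (rule span)
    fix f assume "f \<in> (\<lambda>i. t16 * xi i) ` {1..3} \<union> (\<lambda>i. t16 * eta i) ` {1..3}"
    then obtain u where "f = t16 * u" "u \<in> xi ` {1..3} \<union> eta ` {1..3}" by blast
    then show "\<exists>d. homogeneous a b d f"
      by (metis ov' homogeneous_t16 homogeneous_mult)
  qed
  moreover have "g_1_plus \<subseteq> ?W"
    unfolding g_1_plus_def using E(4)[unfolded g_1_plus_def]
  proof (rule span)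
    fix f assume "f \<in> {xi 1 * xi 2 * xi 3, xi 1 * eta 2 * eta 3, xi 2 * eta 1 * eta 3,
      xi 3 * eta 1 * eta 2, xi 1 * (xi 2 * eta 2 + xi 3 * eta 3),
      xi 2 * (xi 1 * eta 1 + xi 3 * eta 3), eta 3 * (xi 1 * eta 1 - xi 2 * eta 2),
      xi 3 * (xi 1 * eta 1 + xi 2 * eta 2), eta 2 * (xi 1 * eta 1 - xi 3 * eta 3),
      eta 1 * (xi 2 * eta 2 - xi 3 * eta 3)}"
    then show "\<exists>d. homogeneous a b d f"
      by (elim insertE emptyE)
        (hypsubst, rule exI,
          (rule homogeneous_add homogeneous_diff homogeneous_mult ovs | linarith)+)+
  qed
  ultimately show ?thesis using x by blast
qed

text \<open>No degree is below \<open>-a\<close>, so a component of degree above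
  \<open>j + a\<close> cannot reach degree \<open>j\<close>, whatever its partner. This makes the
  double sum finite.\<close>

lemma component16_bracket:
  assumes ab: "admissible a b"
  shows "component16 a b j (bracket16 f g) =
    (\<Sum>i\<in>{-a..j+a}. \<Sum>k\<in>{-a..j+a}.
       component16 a b j (bracket16 (component16 a b i f) (component16 a b k g)))"
proof -
  define trunc where "trunc h = (\<Sum>i\<in>{-a..j+a}. component16 a b i h)" for h
  have rest: "j + a < p" if p: "p \<in> degs a b (h - trunc h)" for p h
  proof -
    obtain n S where nS: "p = deg16 a b n S" "coeff16 (h - trunc h) n S \<noteq> 0"
      using p by (rule degs_E)
    have "coeff16 (trunc h) n S = (if p \<in> {-a..j+a} then coeff16 h n S else 0)"
      unfolding trunc_def coeff16_component16_sum nS(1) ..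
    then have "p \<notin> {-a..j+a}" "p \<in> degs a b h"
      using nS by (auto simp: degs_def split: if_splits)
    then show ?thesis using degs_ge[OF ab] by force
  qed
  have "component16 a b j (bracket16 (f - trunc f) h) = 0" for h
  proof (intro component16_eq_0 notI)
    assume "j \<in> degs a b (bracket16 (f - trunc f) h)"
    then obtain p q where "j = p + q" "p \<in> degs a b (f - trunc f)" "q \<in> degs a b h"
      by (rule degs_bracket[OF ab])
    then show False using rest[of p f] degs_ge[OF ab, of q h] by simp
  qed
  moreover have "component16 a b j (bracket16 h (g - trunc g)) = 0" for h
  proof (intro component16_eq_0 notI)
    assume "j \<in> degs a b (bracket16 h (g - trunc g))"
    then obtain p q where "j = p + q" "p \<in> degs a b h" "q \<in> degs a b (g - trunc g)"
      by (rule degs_bracket[OF ab])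
    then show False using rest[of q g] degs_ge[OF ab, of p h] by simp
  qed
  moreover have "bracket16 f g = bracket16 (trunc f) (trunc g) + bracket16 (f - trunc f) g
      + bracket16 (trunc f) (g - trunc g)"
    by (simp add: bracket16_diff)
  ultimately have "component16 a b j (bracket16 f g) =
      component16 a b j (bracket16 (trunc f) (trunc g))"
    by (simp add: component16_simps)
  also have "\<dots> = (\<Sum>i\<in>{-a..j+a}. \<Sum>k\<in>{-a..j+a}.
       component16 a b j (bracket16 (component16 a b i f) (component16 a b k g)))"
    unfolding trunc_def bracket16_sum component16_sum by (rule sum.swap)
  finally show ?thesis .
qed

text \<open>The elements all of whose components lie in \<open>E16\<close> form a subalgebra
  containing the generators, hence the generated subalgebra. Taking a component is compatible with
  truncation in t, which extends the claim to the closure.\<close>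

lemma component16_E16:
  assumes ab: "admissible a b" and f: "f \<in> E16"
  shows "component16 a b j f \<in> E16"
proof -
  define H where "H = lie_subalgebra16 hull (g_minus1 \<union> g_0 \<union> g_minus1_dual \<union> g_1_plus)"
  define W where "W = {f. \<forall>j. component16 a b j f \<in> E16}"
  have W: "lie_subalgebra16 W"
    unfolding lie_subalgebra16_def
  proof (intro conjI ballI)
    show "K16.subspace W"
      unfolding K16.subspace_def W_def by (simp add: component16_simps E16_intros)
    fix f assume f: "f \<in> W"
    then show "parity16 f \<in> W" by (simp add: W_def component16_simps E16_intros)
    fix g assume g: "g \<in> W"
    have "component16 a b j (bracket16 (component16 a b i f) (component16 a b k g)) \<in> E16" for i j k
    proof -
      let ?z = "bracket16 (component16 a b i f) (component16 a b k g)"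
      have "degs a b ?z \<subseteq> {i + k}"
      proof
        fix r assume "r \<in> degs a b ?z"
        then obtain p q where "r = p + q" "p \<in> degs a b (component16 a b i f)"
          "q \<in> degs a b (component16 a b k g)"
          by (rule degs_bracket[OF ab])
        then show "r \<in> {i + k}" using degs_component16 by blast
      qed
      then have "component16 a b j ?z = (if j = i + k then ?z else 0)"
        by (rule component16_homogeneous)
      then show ?thesis using f g by (simp add: W_def E16_intros)
    qed
    then have "component16 a b j (bracket16 f g) \<in> E16" for j
      by (subst component16_bracket[OF ab]) (intro E16_intros)
    then show "bracket16 f g \<in> W" by (simp add: W_def)
  qed
  have "H \<subseteq> W"
    unfolding H_def using component16_generators[OF ab] W
    by (intro hull_minimal) (auto simp: W_def)
  show ?thesis
  proof (rule E16_closed)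
    fix n
    obtain h where h: "h \<in> H" "\<forall>k\<le>n. fps_nth h k = fps_nth f k"
      using f unfolding E16_def H_def[symmetric] in_closure_fps_iff by blast
    then have "\<forall>k\<le>n. fps_nth (component16 a b j h) k = fps_nth (component16 a b j f) k"
      by (simp add: component16_def)
    then show "\<exists>h\<in>E16. \<forall>k\<le>n. fps_nth h k = fps_nth (component16 a b j f) k"
      using h(1) \<open>H \<subseteq> W\<close> by (auto simp: W_def)
  qed
qed

text \<open>The definition speaks only of components; that the element itself lies in
  \<open>E16\<close> follows because \<open>E16\<close> is closed and finite sums of components
  approximate it.\<close>

lemma graded_subalgebra_E16:
  assumes ab: "admissible a b"
  shows "graded_subalgebra E16 a b = {f \<in> E16. \<forall>p\<in>degs a b f. 0 \<le> p}"
proof (intro equalityI subsetI CollectI conjI ballI)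
  fix f assume f: "f \<in> graded_subalgebra E16 a b"
  have comp: "component16 a b j f \<in> (if j \<ge> 0 then graded_part E16 a b j else {0})" for j
    using f by (simp add: graded_subalgebra_def)
  show "f \<in> E16"
  proof (rule E16_closed)
    fix n
    \<comment> \<open>An upper bound for the degree of a monomial with t-exponent at most
      \<open>n\<close>, so that the partial sum up to \<open>N\<close> agrees with \<open>f\<close>
      to order \<open>n\<close>.\<close>
    define N where "N = int n * a + (\<Sum>i\<in>{1..6}. b ! (i - 1))"
    define h where "h = (\<Sum>i\<in>{-a..N}. component16 a b i f)"
    have compE: "component16 a b j f \<in> E16" for j
      using comp[of j] E16_intros(1) by (auto simp: graded_part_def split: if_splits)
    then have "h \<in> E16" unfolding h_def by (intro E16_intros)
    moreover have "fps_nth h k = fps_nth f k" if "k \<le> n" for k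
    proof (rule grassmann_eqI)
      fix S
      have "coeff16 h k S = coeff16 f k S"
      proof (cases "coeff16 f k S = 0")
        case False
        then have S: "S \<subseteq> {1..6}" using coeff16_outside by blast
        have "- a \<le> deg16 a b k S"
          using False by (intro degs_ge[OF ab, of _ f]) (auto simp: degs_def)
        moreover have "deg16 a b k S \<le> N"
        proof -
          have "(\<Sum>i\<in>S. b ! (i - 1)) \<le> (\<Sum>i\<in>{1..6}. b ! (i - 1))"
            using S ab by (intro sum_mono2) (auto simp: admissible_def)
          moreover have "int k * a \<le> int n * a" "0 < a"
            using that ab by (simp_all add: admissible_def)
          ultimately show ?thesis unfolding deg16_def N_def by linarith
        qed
        ultimately show ?thesis unfolding h_def coeff16_component16_sum by simp
      qed (simp add: h_def coeff16_component16_sum del: coeff16_sum)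
      then show "gcoeff (fps_nth h k) S = gcoeff (fps_nth f k) S" by (simp add: coeff16_def)
    qed
    ultimately show "\<exists>h\<in>E16. \<forall>k\<le>n. fps_nth h k = fps_nth f k" by blast
  qed
  fix p assume "p \<in> degs a b f"
  then obtain n S where p: "p = deg16 a b n S" "coeff16 f n S \<noteq> 0" by (rule degs_E)
  then have "component16 a b p f \<noteq> 0"
    by (metis coeff16_component16 coeff16_simps(1))
  then show "0 \<le> p" using comp[of p] by (auto split: if_splits)
next
  fix f assume f: "f \<in> {f \<in> E16. \<forall>p\<in>degs a b f. 0 \<le> p}"
  have "component16 a b j f = 0" if "j < 0" for j
    using f that by (intro component16_eq_0) force
  then show "f \<in> graded_subalgebra E16 a b"
    using f component16_E16[OF ab]
    by (auto simp: graded_subalgebra_def graded_part_def component16_simps)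
qed

lemma one_E16: "1 \<in> E16"
proof -
  have "contraction (parity16 (ovar 1)) (ovar 4) = - 1"
    unfolding contraction_def sum_upto_3_6 by (simp add: dual_def d_odd_ovar)
  then have "bracket16 (ovar 1) (ovar 4) = - 1"
    by (simp add: bracket16_eq) (simp add: ovar_def)
  then have "1 = - bracket16 (ovar 1) (ovar 4)" by simp
  then show ?thesis
    using E16_intros(5)[OF bracket16_E16[OF ovar_E16[of 1] ovar_E16[of 4]]] by simp
qed

text \<open>The subalgebra is proper because 1 has degree \<open>-a\<close>, and open because a
  single factor t already compensates the shift: an element without t^0 terms has no negative
  degree.\<close>

lemma graded_subalgebra_properties:
  assumes ab: "admissible a b"
  shows "lie_subalgebra16 (graded_subalgebra E16 a b)" (is "lie_subalgebra16 ?T")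
    and "graded_subalgebra E16 a b \<subset> E16"
    and "openin (top_of_set E16) (graded_subalgebra E16 a b)"
proof -
  note T = graded_subalgebra_E16[OF ab]
  show L: "lie_subalgebra16 ?T"
    unfolding lie_subalgebra16_def
  proof (intro conjI ballI)
    show "K16.subspace ?T"
      unfolding K16.subspace_def T
      by (auto simp: E16_intros dest!: degs_add[THEN subsetD] degs_scale[THEN subsetD])
    fix f assume f: "f \<in> ?T"
    then show "parity16 f \<in> ?T"
      unfolding T using degs_parity[of a b f] by (auto simp: E16_intros)
    fix g assume g: "g \<in> ?T"
    have "0 \<le> r" if "r \<in> degs a b (bracket16 f g)" for r
      using that f g unfolding T by (auto elim!: degs_bracket[OF ab])
    then show "bracket16 f g \<in> ?T" using f g unfolding T by (simp add: E16_intros)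
  qed
  have "coeff16 1 0 {} \<noteq> 0" "deg16 a b 0 {} < 0"
    using ab by (simp_all add: coeff16_one deg16_def admissible_def)
  then have "1 \<notin> ?T" unfolding T by (force simp: degs_def)
  then show "?T \<subset> E16" using one_E16 unfolding T by blast
  have "f \<in> ?T" if "f \<in> E16" "fps_nth f 0 = 0" for f
  proof -
    have "0 \<le> p" if pf: "p \<in> degs a b f" for p
    proof -
      obtain n S where p: "p = deg16 a b n S" "coeff16 f n S \<noteq> 0" "S \<subseteq> {1..6}"
        using pf by (rule degs_E)
      have "n \<noteq> 0" using p(2) \<open>fps_nth f 0 = 0\<close> by (cases n) (simp_all add: coeff16_def)
      then have "1 * a \<le> int n * a"
        using ab by (intro mult_right_mono) (auto simp: admissible_def)
      moreover have "0 \<le> (\<Sum>i\<in>S. b ! (i - 1))"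
        using ab p(3) by (intro sum_nonneg) (auto simp: admissible_def)
      ultimately show ?thesis unfolding p(1) deg16_def by linarith
    qed
    then show ?thesis unfolding T using that by blast
  qed
  then show "openin (top_of_set E16) ?T"
    using L \<open>?T \<subset> E16\<close> unfolding openin_fps_subspace_iff[OF L[unfolded lie_subalgebra16_def, THEN conjunct1] subspace_E16]
    by auto
qed

section \<open>Surjectivity of $\partial/\partial t$\<close>

lemma coeff16_double [simp]: "coeff16 (2 * f) n S = 2 * coeff16 f n S"
  unfolding mult_2 by simp

lemma t16_commute: "f * t16 = t16 * f"
  by (simp add: t16_def fps_mult_fps_X_commute)

lemma t16_mult_simps [simp]:
  "fps_deriv t16 = 1" "fps_deriv (t16 * f) = f + t16 * fps_deriv f"
  "d_odd k (t16 * f) = t16 * d_odd k f" "d_odd k t16 = 0"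
  "parity16 (t16 * f) = t16 * parity16 f" "parity16 t16 = t16"
  "two_minus_euler (t16 * f) = t16 * two_minus_euler f"
  "two_minus_euler t16 = 2 * t16"
proof -
  show "fps_deriv t16 = 1" "fps_deriv (t16 * f) = f + t16 * fps_deriv f"
    by (simp_all add: t16_def)
  show "two_minus_euler t16 = 2 * t16"
    unfolding mult_2 by (rule coeff16_eqI) (simp add: coeff16_t16)
qed (rule coeff16_eqI; auto simp: coeff16_t16)+

lemma ovar_t16: "ovar i * t16 = t16 * ovar i" "ovar i * (t16 * f) = t16 * (ovar i * f)"
  using t16_commute[of "ovar i"] by (simp_all flip: mult.assoc)

lemma ovar_simps [simp]:
  "fps_deriv (ovar i) = 0" "fps_deriv (ovar i * f) = ovar i * fps_deriv f"
  by (simp_all add: ovar_def)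

lemma two_minus_euler_ovar [simp]:
  assumes "i \<in> {1..6}"
  shows "two_minus_euler (ovar i) = ovar i"
  by (rule coeff16_eqI) (simp add: coeff16_ovar[OF assms])

lemma contraction_delta:
  assumes "i \<in> {1..6}" "\<And>k. k \<in> {1..6} \<Longrightarrow> d_odd k f = (if k = i then h else 0)"
  shows "contraction f g = h * d_odd (dual i) g"
proof -
  have "contraction f g = (\<Sum>k = 1..6. if k = i then h * d_odd (dual i) g else 0)"
    unfolding contraction_def by (rule sum.cong) (use assms(2) in auto)
  then show ?thesis using assms(1) by (simp add: sum.delta)
qed

lemma bracket16_ovar:
  assumes "i \<in> {1..6}"
  shows "bracket16 (ovar i) g = ovar i * fps_deriv g - d_odd (dual i) g"
proof -
  have "contraction (parity16 (ovar i)) g = (- 1) * d_odd (dual i) g"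
    by (rule contraction_delta) (use assms in \<open>auto simp: d_odd_ovar\<close>)
  then show ?thesis using assms by (simp add: bracket16_eq)
qed

lemma bracket16_t16_ovar:
  assumes "i \<in> {1..6}"
  shows "bracket16 (t16 * ovar i) g =
    t16 * (ovar i * fps_deriv g) - ovar i * two_minus_euler g - t16 * d_odd (dual i) g"
proof -
  have "contraction (parity16 (t16 * ovar i)) g = (- t16) * d_odd (dual i) g"
    by (rule contraction_delta) (use assms in \<open>auto simp: d_odd_ovar\<close>)
  then show ?thesis using assms by (simp add: bracket16_eq mult.assoc)
qed

lemma t16_square_E16: "t16 * t16 \<in> E16"
proof -
  have i: "1 \<in> {1..6::nat}" "4 \<in> {1..6::nat}" "dual 1 = 4" by (auto simp: dual_def)
  have "bracket16 (t16 * ovar 1) (t16 * ovar 4) = - (t16 * t16)"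
    unfolding bracket16_t16_ovar[OF i(1)] i(3) using i(1,2)
    by (simp add: d_odd_ovar ovar_t16 del: One_nat_def)
  then have "t16 * t16 = - bracket16 (t16 * ovar 1) (t16 * ovar 4)" by simp
  then show ?thesis
    using E16_intros(5)[OF bracket16_E16[OF t16_ovar_E16[OF i(1)] t16_ovar_E16[OF i(2)]]] by simp
qed

lemma coeff16_bracket16_t16_square:
  "coeff16 (bracket16 (t16 * t16) g) n S =
    (if n = 0 then 0 else 2 * (of_nat n + of_nat (card S) - 3) * coeff16 g (n - 1) S)"
proof -
  have tt: "two_minus_euler (t16 * t16) = t16 * t16 + t16 * t16"
    by (rule coeff16_eqI) (simp add: coeff16_t16)
  have "contraction (parity16 (t16 * t16)) g = 0" by (simp add: contraction_def)
  then have *: "bracket16 (t16 * t16) g =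
      t16 * (t16 * fps_deriv g) + t16 * (t16 * fps_deriv g)
      - (t16 * two_minus_euler g + t16 * two_minus_euler g)"
    unfolding bracket16_eq tt by (simp add: distrib_right mult.assoc)
  then show ?thesis
    unfolding * by (cases n; cases "n - 1") (simp_all add: algebra_simps)
qed

text \<open>On each graded piece, a Casimir operator of the \<open>sl\<^sub>2\<close> spanned by \<open>1, t, t\<^sup>2\<close> up to scaling and a shift.\<close>

definition lower_raise :: "lambda16 \<Rightarrow> lambda16" where
  "lower_raise g = bracket16 1 (bracket16 (t16 * t16) g)"

lemma coeff16_lower_raise:
  "coeff16 (lower_raise g) n S =
    4 * (of_nat n + 1) * (of_nat n + of_nat (card S) - 2) * coeff16 g n S"
  unfolding lower_raise_def bracket16_one mult_2 by (simp add: coeff16_bracket16_t16_square algebra_simps)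

text \<open>The projection to the eigenvalue 0 of \<open>lower_raise\<close>, spanned by t^2, the t
  xi and the products of two distinct odd variables.\<close>

definition lower_raise_kernel :: "lambda16 \<Rightarrow> lambda16" where
  "lower_raise_kernel f = Abs_fps (\<lambda>n. gfilter (\<lambda>S. n + card S = 2) (fps_nth f n))"

lemma coeff16_lower_raise_kernel:
  "coeff16 (lower_raise_kernel f) n S = (if n + card S = 2 then coeff16 f n S else 0)"
  by (simp add: coeff16_def lower_raise_kernel_def gfilter.rep_eq)

text \<open>Induction on the set of nonzero eigenvalues that occur. Only linear combinations and
  \<open>lower_raise\<close> itself are used on \<open>z\<close>, since a single monomial of
  \<open>z\<close> need not be known to lie in \<open>E16\<close>.\<close>

lemma lower_raise_onto:
  fixes F :: "complex set"
  assumes "finite F" "0 \<notin> F" "z \<in> E16"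
    "\<And>n S. coeff16 z n S \<noteq> 0 \<Longrightarrow>
      4 * (of_nat n + 1) * (of_nat n + of_nat (card S) - 2) \<in> insert 0 F"
  shows "\<exists>w\<in>E16. z = lower_raise w + lower_raise_kernel z"
  using assms
proof (induction F arbitrary: z rule: finite_induct)
  case empty
  have "z = lower_raise_kernel z"
  proof (rule coeff16_eqI)
    fix n S
    have "n + card S = 2" if "coeff16 z n S \<noteq> 0"
    proof -
      have "(of_nat n + 1 :: complex) \<noteq> 0"
        by (metis of_nat_Suc of_nat_neq_0 add.commute)
      moreover have
        "4 * (of_nat n + 1) * (of_nat n + of_nat (card S) - 2 :: complex) = 0"
        using empty(3)[OF that] by blast
      ultimately have "(of_nat n + of_nat (card S) - 2 :: complex) = 0"
        by (metis mult_eq_0_iff zero_neq_numeral)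
      then have "complex_of_nat (n + card S) = of_nat 2" by simp
      then show ?thesis by (simp only: of_nat_eq_iff)
    qed
    then show "coeff16 z n S = coeff16 (lower_raise_kernel z) n S"
      by (auto simp: coeff16_lower_raise_kernel)
  qed
  then show ?case
    using E16_intros(1) by (intro bexI[of _ 0]) (simp_all add: lower_raise_def)
next
  case (insert m F)
  have m: "m \<noteq> 0" using insert.prems(1) by auto
  \<comment> \<open>Subtracting \<open>m\<close> times the identity removes the eigenvalue
    \<open>m\<close> from the support.\<close>
  let ?z = "lower_raise z - scale16 m z"
  have lr: "lower_raise w \<in> E16" if "w \<in> E16" for w
    unfolding lower_raise_def by (intro bracket16_E16 one_E16 t16_square_E16 that)
  have "\<exists>w\<in>E16. ?z = lower_raise w + lower_raise_kernel ?z"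
  proof (rule insert.IH)
    show "0 \<notin> F" using insert.prems(1) by auto
    show "?z \<in> E16" by (intro E16_intros lr insert.prems)
    fix n S assume nz: "coeff16 ?z n S \<noteq> 0"
    then have "coeff16 z n S \<noteq> 0" by (auto simp: coeff16_lower_raise)
    from insert.prems(3)[OF this] nz
    show "4 * (of_nat n + 1) * (of_nat n + of_nat (card S) - 2) \<in> insert 0 F"
      by (auto simp: coeff16_lower_raise)
  qed
  then obtain w where w: "w \<in> E16" "?z = lower_raise w + lower_raise_kernel ?z" by blast
  \<comment> \<open>Write T for \<open>lower_raise\<close> and K for the projection to its kernel.
    Since TK = KT = 0, the equation (T - m)z = Tw + K(T - m)z reads mz = T(z - w) + mKz; divide by
    \<open>m\<close>.\<close>
  have "z = lower_raise (scale16 (1 / m) (z - w)) + lower_raise_kernel z"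
  proof (rule coeff16_eqI)
    fix n :: nat and S :: "nat set"
    define l where "l = 4 * (of_nat n + 1) * (of_nat n + of_nat (card S) - 2 :: complex)"
    have "coeff16 ?z n S = coeff16 (lower_raise w + lower_raise_kernel ?z) n S"
      using arg_cong[OF w(2), of "\<lambda>h. coeff16 h n S"] .
    then have *: "l * coeff16 z n S - m * coeff16 z n S = l * coeff16 w n S
        + (if n + card S = 2 then l * coeff16 z n S - m * coeff16 z n S else 0)"
      unfolding coeff16_simps coeff16_lower_raise coeff16_lower_raise_kernel l_def[symmetric] .
    have l0: "l = 0" if "n + card S = 2"
    proof -
      have "complex_of_nat n + of_nat (card S) = 2"
        using that by (metis of_nat_add of_nat_numeral)
      then show ?thesis by (simp add: l_def)
    qed
    have "m * coeff16 z n S = l * (coeff16 z n S - coeff16 w n S)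
        + (if n + card S = 2 then m * coeff16 z n S else 0)"
      using * l0 by (auto simp: algebra_simps)
    then show "coeff16 z n S =
        coeff16 (lower_raise (scale16 (1 / m) (z - w)) + lower_raise_kernel z) n S"
      unfolding coeff16_simps coeff16_lower_raise coeff16_lower_raise_kernel l_def[symmetric]
      using m by (simp add: field_simps)
  qed
  then show ?case using w(1) insert.prems(2) by (blast intro: E16_intros)
qed

lemma finite_low_supports: "finite {(n, S). n \<le> (N::nat) \<and> S \<subseteq> {1..6::nat}}"
  by (rule finite_subset[of _ "{..N} \<times> Pow {1..6}"]) auto

lemma subspace_deriv_E16: "K16.subspace (fps_deriv ` E16)"
  unfolding K16.subspace_def
proof (intro conjI ballI allI)
  show "0 \<in> fps_deriv ` E16" using E16_intros(1) by (metis fps_deriv_0 image_eqI)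
  fix x y c assume x: "x \<in> fps_deriv ` E16"
  then show "scale16 c x \<in> fps_deriv ` E16"
    by (auto simp flip: scale16_simps(1) intro!: imageI E16_intros)
  assume "y \<in> fps_deriv ` E16"
  then show "x + y \<in> fps_deriv ` E16"
    using x by (auto simp flip: fps_deriv_add intro!: imageI E16_intros)
qed

text \<open>The operator \<open>lower_raise\<close> ends with ad 1, which is 2 d/dt, so its image
  consists of derivatives. The bound on the t-order leaves only finitely many eigenvalues.\<close>

lemma minus_kernel_in_deriv_E16:
  assumes z: "z \<in> E16" and bound: "\<And>n S. coeff16 z n S \<noteq> 0 \<Longrightarrow> n \<le> N"
  shows "z - lower_raise_kernel z \<in> fps_deriv ` E16"
proof -
  define F where "F = (\<lambda>(n, S). 4 * (of_nat n + 1) * (of_nat n + of_nat (card S) - 2 :: complex)) `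
    {(n, S). n \<le> N \<and> S \<subseteq> {1..6::nat}} - {0}"
  have "\<exists>w\<in>E16. z = lower_raise w + lower_raise_kernel z"
  proof (rule lower_raise_onto)
    show "finite F" unfolding F_def using finite_low_supports by blast
    show "0 \<notin> F" by (simp add: F_def)
    fix n S assume "coeff16 z n S \<noteq> 0"
    then have "n \<le> N" "S \<subseteq> {1..6}" using bound coeff16_outside by blast+
    then show "4 * (of_nat n + 1) * (of_nat n + of_nat (card S) - 2) \<in> insert 0 F"
      unfolding F_def by (auto intro!: image_eqI[where x = "(n, S)"])
  qed (rule z)
  then obtain w where w: "w \<in> E16" "z = lower_raise w + lower_raise_kernel z" by blast
  then have "z - lower_raise_kernel z = lower_raise w" by (metis add_diff_cancel_right')
  also have "\<dots> = fps_deriv (scale16 2 (bracket16 (t16 * t16) w))"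
    unfolding lower_raise_def bracket16_one mult_2 by (rule coeff16_eqI) (simp add: algebra_simps)
  finally show ?thesis
    using w(1) by (simp only:) (intro imageI E16_intros t16_square_E16)
qed

abbreviation (input) ones :: "int list" where "ones \<equiv> [1,1,1,1,1,1]"

lemma upto_6: "{1..6} = {1, 2, 3, 4, 5, 6 :: nat}"
  by auto

lemma ball_upto_6: "(\<forall>k\<in>{1..6::nat}. P k) \<longleftrightarrow> P 1 \<and> P 2 \<and> P 3 \<and> P 4 \<and> P 5 \<and> P 6"
  unfolding upto_6 by simp

lemma admissible_ones: "admissible 2 ones"
  unfolding admissible_def ball_upto_6 by (simp add: dual_def)

lemma deg16_ones:
  assumes "S \<subseteq> {1..6}"
  shows "deg16 2 ones n S = 2 * int n + int (card S) - 2"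
proof -
  have "\<forall>i\<in>{1..6}. ones ! (i - 1) = 1"
    unfolding ball_upto_6 by simp
  then have "ones ! (i - 1) = 1" if "i \<in> S" for i
    using assms that by blast
  then show ?thesis by (simp add: deg16_def)
qed

lemma homogeneous_component_supp:
  assumes "coeff16 (component16 2 ones j f) n S \<noteq> 0"
  shows "2 * int n + int (card S) - 2 = j"
proof -
  have "coeff16 f n S \<noteq> 0" "deg16 2 ones n S = j"
    using assms by (auto split: if_splits)
  then show ?thesis using deg16_ones coeff16_outside by metis
qed

text \<open>An element of degree 4 with a t^3 term is enough: its derivative has an eigenvalue-0
  part that is a multiple of t^2, and the rest is a derivative by
  \<open>minus_kernel_in_deriv_E16\<close>.\<close>

lemma t16_square_in_deriv_E16: "t16 * t16 \<in> fps_deriv ` E16"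
proof -
  have i: "1 \<in> {1..6::nat}" "2 \<in> {1..6::nat}" "5 \<in> {1..6::nat}" "dual 1 = 4" "dual 2 = 5" "dual 5 = 2"
    by (auto simp: dual_def)
  define c where "c = ovar 4 * (ovar 2 * ovar 5 - ovar 3 * ovar 6)"
  have "c = eta 1 * (xi 2 * eta 2 - xi 3 * eta 3)"
    by (simp add: c_def xi_eq_ovar eta_eq_ovar)
  then have "c \<in> g_1_plus" unfolding g_1_plus_def by (intro K16.span_base) blast
  then have cE: "c \<in> E16" using generators_subset_E16 by blast
  \<comment> \<open>Bracketing with \<open>t16 * ovar i\<close> can trade the factor
    \<open>dual i\<close> for a factor t. With \<open>i\<close> equal to 1, 2, 5 the factors 4, 5, 2
    of one term of \<open>c\<close> are replaced in turn, which ends in t^3.\<close>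
  define b where "b = bracket16 (t16 * ovar 1) c"
  define d where "d = bracket16 (t16 * ovar 2) b"
  define w where "w = bracket16 (t16 * ovar 5) d"
  have "coeff16 c 0 {2, 4, 5} = - 1"
    by (simp add: c_def coeff16_ovar gsign_insert insert_Diff_if)
  then have b: "coeff16 b 1 {2, 5} = - 1"
    unfolding b_def bracket16_t16_ovar[OF i(1)] i(4) using i(1)
    by (simp add: insert_commute gsign_insert)
  then have d: "coeff16 d 2 {2} = - 1"
    unfolding d_def bracket16_t16_ovar[OF i(2)] i(5) using i(2)
    by (simp add: insert_commute gsign_insert flip: numeral_2_eq_2)
  have w: "coeff16 w 3 {} = 1"
    unfolding w_def bracket16_t16_ovar[OF i(3)] i(6) using d i(3) by simp
  \<comment> \<open>4 is the degree of t^3 in the type with \<open>a = 2\<close> and all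
    \<open>b_i = 1\<close>.\<close>
  define z where "z = fps_deriv (component16 2 ones 4 w)"
  have "w \<in> E16" unfolding w_def d_def b_def
    by (intro bracket16_E16 t16_ovar_E16 i cE)
  then have zI: "z \<in> fps_deriv ` E16"
    unfolding z_def by (intro imageI component16_E16 admissible_ones)
  have "z \<in> E16"
  proof -
    have "z = scale16 (1/2) (bracket16 1 (component16 2 ones 4 w))"
      unfolding bracket16_one mult_2 z_def by (rule coeff16_eqI) (simp add: algebra_simps)
    then show ?thesis
      using \<open>w \<in> E16\<close> by (simp only:) (intro E16_intros one_E16 component16_E16 admissible_ones)
  qed
  have supp: "2 * int n + int (card S) = 4" if "coeff16 z n S \<noteq> 0" for n S
  proof -
    have "coeff16 (component16 2 ones 4 w) (Suc n) S \<noteq> 0"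
      using that unfolding z_def coeff16_simps by (metis mult_zero_right)
    from homogeneous_component_supp[OF this] show ?thesis by simp
  qed
  have "z - lower_raise_kernel z \<in> fps_deriv ` E16"
    using \<open>z \<in> E16\<close> by (rule minus_kernel_in_deriv_E16[where N = 2]) (use supp in fastforce)
  then have "z - (z - lower_raise_kernel z) \<in> fps_deriv ` E16"
    by (rule K16.subspace_diff[OF subspace_deriv_E16 zI])
  \<comment> \<open>The conditions \<open>2n + |S| = 4\<close> (degree) and
    \<open>n + |S| = 2\<close> (eigenvalue 0) meet only in t^2, whose coefficient 3 is that of the
    derivative of t^3.\<close>
  moreover have "z - (z - lower_raise_kernel z) = scale16 3 (t16 * t16)"
  proof (rule coeff16_eqI)
    fix n S
    have z2: "coeff16 z 2 {} = 3"
      using w by (simp add: z_def deg16_ones eval_nat_numeral)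
    have "coeff16 (lower_raise_kernel z) n S = (if n = 2 \<and> S = {} then 3 else 0)"
    proof (cases "n + card S = 2 \<and> coeff16 z n S \<noteq> 0")
      case True
      then have "n = 2" "card S = 0" using supp[of n S] by auto
      moreover have "finite S" using True coeff16_infinite by blast
      ultimately show ?thesis using z2 by (simp add: coeff16_lower_raise_kernel)
    next
      case False
      then show ?thesis using z2 by (auto simp: coeff16_lower_raise_kernel)
    qed
    then show "coeff16 (z - (z - lower_raise_kernel z)) n S = coeff16 (scale16 3 (t16 * t16)) n S"
      by (auto simp: coeff16_t16)
  qed
  ultimately have "scale16 (1/3) (scale16 3 (t16 * t16)) \<in> fps_deriv ` E16"
    using K16.subspace_scale[OF subspace_deriv_E16] by metis
  then show ?thesis by simp
qed

lemma deriv_bracket16: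
  "fps_deriv (bracket16 f g) = bracket16 (fps_deriv f) g + bracket16 f (fps_deriv g)"
proof -
  have "fps_deriv (contraction F g) = contraction (fps_deriv F) g + contraction F (fps_deriv g)" for F
    by (simp add: contraction_def fps_deriv_sum sum.distrib add.commute)
  then show ?thesis by (simp add: bracket16_eq algebra_simps)
qed

text \<open>Odd variables do not involve t, so their adjoint action commutes with d/dt and preserves
  the space of derivatives. Starting from t^2 it first yields the t xi, then the quadratic monomials
  up to a multiple of t.\<close>

lemma low_monomials_in_deriv_E16:
  assumes i: "i \<in> {1..6}" and j: "j \<in> {1..6}"
  shows "t16 * ovar i \<in> fps_deriv ` E16" "ovar i * ovar j \<in> fps_deriv ` E16"
proof -
  have ad: "bracket16 (ovar k) z \<in> fps_deriv ` E16" if k: "k \<in> {1..6}" and z: "z \<in> fps_deriv ` E16" for k z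
  proof -
    obtain w where "w \<in> E16" "z = fps_deriv w" using z by blast
    then have "bracket16 (ovar k) z = fps_deriv (bracket16 (ovar k) w)"
      by (simp add: deriv_bracket16)
    then show ?thesis
      using imageI[OF bracket16_E16[OF ovar_E16[OF k] \<open>w \<in> E16\<close>], of fps_deriv] by (simp only:)
  qed
  have lin: "t16 * ovar k \<in> fps_deriv ` E16" if k: "k \<in> {1..6}" for k
  proof -
    have "bracket16 (ovar k) (t16 * t16) = scale16 2 (t16 * ovar k)"
      using k by (intro coeff16_eqI) (simp add: bracket16_ovar coeff16_ovar ovar_t16 distrib_left)
    then have "scale16 2 (t16 * ovar k) \<in> fps_deriv ` E16"
      using ad[OF k t16_square_in_deriv_E16] by simp
    from K16.subspace_scale[OF subspace_deriv_E16 this, of "1/2"] show ?thesis by simp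
  qed
  show "t16 * ovar i \<in> fps_deriv ` E16" by (rule lin[OF i])
  have t: "t16 \<in> fps_deriv ` E16"
  proof -
    have "t16 = fps_deriv (scale16 (1/2) (t16 * t16))"
      by (rule coeff16_eqI) (auto simp: coeff16_t16)
    then show ?thesis
      using imageI[OF E16_intros(4)[OF t16_square_E16, of "1/2"], of fps_deriv] by (simp only:)
  qed
  have "bracket16 (ovar i) (t16 * ovar j) = ovar i * ovar j - (if dual i = j then t16 else 0)"
    by (simp add: bracket16_ovar[OF i] d_odd_ovar[OF dual_in[OF i] j])
  then have "ovar i * ovar j = bracket16 (ovar i) (t16 * ovar j) + (if dual i = j then t16 else 0)"
    by simp
  then show "ovar i * ovar j \<in> fps_deriv ` E16"
    using ad[OF i lin[OF j]] t K16.subspace_add[OF subspace_deriv_E16] by (auto split: if_splits)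
qed

definition monomial16 :: "nat \<Rightarrow> nat set \<Rightarrow> lambda16" where
  "monomial16 n S = Abs_fps (\<lambda>m. if m = n then gmonomial 1 S else 0)"

lemma coeff16_monomial16:
  "coeff16 (monomial16 n S) m T = (if m = n \<and> T = S \<and> S \<subseteq> {1..6} then 1 else 0)"
  by (simp add: coeff16_def monomial16_def gmonomial.rep_eq)

lemma in_subspace_of_monomials:
  assumes V: "K16.subspace V" and A: "finite A"
    and supp: "\<And>n S. coeff16 f n S \<noteq> 0 \<Longrightarrow> (n, S) \<in> A \<and> monomial16 n S \<in> V"
  shows "f \<in> V"
proof -
  define B where "B = {(n, S) \<in> A. coeff16 f n S \<noteq> 0}"
  have B: "finite B" using A by (rule rev_finite_subset) (auto simp: B_def)
  have "f = (\<Sum>p\<in>B. scale16 (coeff16 f (fst p) (snd p)) (monomial16 (fst p) (snd p)))"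
  proof (rule coeff16_eqI)
    fix n S
    have "coeff16 (\<Sum>p\<in>B. scale16 (coeff16 f (fst p) (snd p)) (monomial16 (fst p) (snd p))) n S
        = (\<Sum>p\<in>B. if p = (n, S) then coeff16 f n S else 0)"
      unfolding coeff16_sum
      by (rule sum.cong) (auto simp: coeff16_monomial16 prod_eq_iff coeff16_outside)
    then show "coeff16 f n S =
        coeff16 (\<Sum>p\<in>B. scale16 (coeff16 f (fst p) (snd p)) (monomial16 (fst p) (snd p))) n S"
      using B supp by (auto simp: sum.delta B_def)
  qed
  also have "\<dots> \<in> V"
    using supp by (intro K16.subspace_sum[OF V] K16.subspace_scale[OF V]) (auto simp: B_def)
  finally show ?thesis .
qed

text \<open>The eigenvalue-0 part is handled monomial by monomial, the rest by
  \<open>minus_kernel_in_deriv_E16\<close>. Homogeneous elements have bounded t-order, which is the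
  case needed later.\<close>

lemma deriv_onto_E16:
  assumes z: "z \<in> E16" and bound: "\<And>n S. coeff16 z n S \<noteq> 0 \<Longrightarrow> n \<le> N"
  shows "z \<in> fps_deriv ` E16"
proof -
  have "lower_raise_kernel z \<in> fps_deriv ` E16"
  proof (rule in_subspace_of_monomials[OF subspace_deriv_E16 finite_low_supports[of 2]])
    fix n S assume "coeff16 (lower_raise_kernel z) n S \<noteq> 0"
    then have nS: "n + card S = 2" "coeff16 z n S \<noteq> 0"
      by (auto simp: coeff16_lower_raise_kernel split: if_splits)
    then have S: "S \<subseteq> {1..6}" "finite S" using coeff16_outside coeff16_infinite by blast+
    consider "n = 2" "S = {}" | i where "n = 1" "S = {i}"
      | i j where "n = 0" "S = {i, j}" "i < j"
    proof -
      consider "card S = 0" | "card S = 1" | "card S = 2" using nS(1) by linarith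
      then show ?thesis
      proof cases
        case 1
        then show ?thesis using that(1) nS(1) S(2) by simp
      next
        case 2
        then show ?thesis using that(2) nS(1) by (auto simp: card_1_singleton_iff)
      next
        case 3
        then obtain x y where "S = {x, y}" "x \<noteq> y" by (meson card_2_iff)
        then show ?thesis
          using that(3)[of x y] that(3)[of y x] nS(1) 3 by (auto simp: insert_commute neq_iff)
      qed
    qed
    then have "monomial16 n S \<in> fps_deriv ` E16"
    proof cases
      case 1
      have "monomial16 n S = t16 * t16"
        by (rule coeff16_eqI) (auto simp: coeff16_monomial16 coeff16_t16 1)
      then show ?thesis using t16_square_in_deriv_E16 by simp
    next
      case (2 i)
      then have i: "i \<in> {1..6}" using S by simp
      have "monomial16 n S = t16 * ovar i"
        using i by (intro coeff16_eqI) (auto simp: coeff16_monomial16 coeff16_ovar 2)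
      then show ?thesis using low_monomials_in_deriv_E16[OF i i] by simp
    next
      case (3 i j)
      then have ij: "i \<in> {1..6}" "j \<in> {1..6}" using S by simp_all
      have "{k \<in> {i, j}. k < i} = {}" using 3 by auto
      then have "gsign i {i, j} = 1" by (simp only: gsign_def card.empty power_0)
      then have "monomial16 n S = ovar i * ovar j"
        using ij 3 by (intro coeff16_eqI) (auto simp: coeff16_monomial16 coeff16_ovar)
      then show ?thesis using low_monomials_in_deriv_E16[OF ij] by simp
    qed
    then show "(n, S) \<in> {(n, S). n \<le> 2 \<and> S \<subseteq> {1..6}} \<and> monomial16 n S \<in> fps_deriv ` E16"
      using nS S by simp
  qed
  with minus_kernel_in_deriv_E16[OF z bound]
  have "z - lower_raise_kernel z + lower_raise_kernel z \<in> fps_deriv ` E16"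
    by (rule K16.subspace_add[OF subspace_deriv_E16])
  then show ?thesis by simp
qed

section \<open>Proper open subalgebras\<close>

definition proper_open_subalgebra :: "lambda16 set \<Rightarrow> bool" where
  "proper_open_subalgebra M \<longleftrightarrow>
     lie_subalgebra16 M \<and> M \<subset> E16 \<and> openin (top_of_set E16) M"

lemma proper_open_subalgebra_D:
  assumes "proper_open_subalgebra M"
  shows "K16.subspace M" "M \<subseteq> E16" "f \<in> M \<Longrightarrow> parity16 f \<in> M"
    "f \<in> M \<Longrightarrow> g \<in> M \<Longrightarrow> bracket16 f g \<in> M"
  using assms by (auto simp: proper_open_subalgebra_def lie_subalgebra16_def)

lemma degs_ones_E:
  assumes "p \<in> degs 2 ones f"
  obtains n S where "p = 2 * int n + int (card S) - 2" "coeff16 f n S \<noteq> 0" "S \<subseteq> {1..6}"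
    "card S \<le> 6"
proof -
  obtain n S where nS: "p = deg16 2 ones n S" "coeff16 f n S \<noteq> 0" "S \<subseteq> {1..6}"
    using assms by (rule degs_E)
  moreover have "card S \<le> 6" using card_mono[OF _ nS(3)] by simp
  ultimately show ?thesis using that deg16_ones by metis
qed

text \<open>
  If \<open>x = c + \<dots>\<close> with \<open>c \<noteq> 0\<close> lies in \<open>M\<close>, then \<open>ad x\<close> acts on leading terms as \<open>2c \<partial>/\<partial>t\<close>.  As
  \<open>\<partial>/\<partial>t\<close> is onto, a subalgebra containing all elements of large degree contains everything.
\<close>

lemma even_part_no_constant:
  assumes M: "proper_open_subalgebra M" and x: "x \<in> M" "parity16 x = x"
  shows "coeff16 x 0 {} = 0"
proof (rule ccontr)
  assume c0: "coeff16 x 0 {} \<noteq> 0"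
  define c where "c = coeff16 x 0 {}"
  note sub = proper_open_subalgebra_D(1)[OF M] and MsubL = proper_open_subalgebra_D(2)[OF M]
    and br = proper_open_subalgebra_D(4)[OF M]
  define contains where "contains N \<longleftrightarrow> (\<forall>y\<in>E16. (\<forall>p\<in>degs 2 ones y. N \<le> p) \<longrightarrow> y \<in> M)" for N
  obtain n where n: "\<And>f. f \<in> E16 \<Longrightarrow> \<forall>k\<le>n. fps_nth f k = 0 \<Longrightarrow> f \<in> M"
    using M openin_fps_subspace_iff[OF sub subspace_E16]
    unfolding proper_open_subalgebra_def by blast
  \<comment> \<open>A monomial \<open>t^k e_S\<close> with \<open>k <= n\<close> has degree at most
    2n + 6 - 2 = 2n + 4, so from degree 2n + 5 on only orders above \<open>n\<close> occur.\<close>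
  have start: "contains (2 * int n + 5)"
    unfolding contains_def
  proof (intro ballI impI n allI)
    fix y k assume y: "\<forall>p\<in>degs 2 ones y. 2 * int n + 5 \<le> p" and k: "k \<le> n"
    show "fps_nth y k = 0"
    proof (rule grassmann_eqI)
      fix S
      have "coeff16 y k S = 0"
      proof (rule ccontr)
        assume nz: "coeff16 y k S \<noteq> 0"
        then have S: "S \<subseteq> {1..6}" using coeff16_outside by blast
        have "card S \<le> 6" using card_mono[OF _ S] by simp
        moreover have "deg16 2 ones k S \<in> degs 2 ones y" using nz by (auto simp: degs_def)
        ultimately show False using y k by (auto simp: deg16_ones[OF S])
      qed
      then show "gcoeff (fps_nth y k) S = gcoeff 0 S" by (simp add: coeff16_def)
    qed
  qed
  have step: "contains (N - 1)" if N: "contains N" for N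
    unfolding contains_def
  proof (intro ballI impI)
    fix y assume y: "y \<in> E16" "\<forall>p\<in>degs 2 ones y. N - 1 \<le> p"
    define z where "z = component16 2 ones (N - 1) y"
    have zE: "z \<in> E16" unfolding z_def by (rule component16_E16[OF admissible_ones y(1)])
    have "y - z \<in> M"
    proof -
      have "N \<le> p" if "p \<in> degs 2 ones (y - z)" for p
      proof -
        obtain m S where "p = deg16 2 ones m S" "coeff16 (y - z) m S \<noteq> 0"
          using \<open>p \<in> _\<close> by (rule degs_E)
        then have "p \<noteq> N - 1" "p \<in> degs 2 ones y"
          by (auto simp: z_def degs_def split: if_splits)
        then show ?thesis using y(2) by force
      qed
      then show ?thesis
        using N E16_intros(3)[OF y(1) zE] unfolding contains_def by blast
    qed
    moreover have "z \<in> M"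
    proof -
      have "z \<in> fps_deriv ` E16"
      proof (rule deriv_onto_E16[OF zE])
        fix m S assume "coeff16 z m S \<noteq> 0"
        then have "2 * int m + int (card S) - 2 = N - 1"
          unfolding z_def by (rule homogeneous_component_supp)
        then show "m \<le> nat (N + 1)" by linarith
      qed
      then obtain w0 where w0: "w0 \<in> E16" "z = fps_deriv w0" by blast
      \<comment> \<open>Differentiation lowers the degree by 2, so only the part of
        \<open>w0\<close> of degree \<open>N + 1\<close> contributes to \<open>z\<close>. That part
        already lies in \<open>M\<close>.\<close>
      define w where "w = component16 2 ones (N + 1) w0"
      have wE: "w \<in> E16" unfolding w_def by (rule component16_E16[OF admissible_ones w0(1)])
      have degs_w: "degs 2 ones w \<subseteq> {N + 1}" unfolding w_def using degs_component16 by blast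
      have zw: "z = fps_deriv w"
      proof (rule coeff16_eqI)
        fix m S
        have "coeff16 z m S = (if deg16 2 ones m S = N - 1 then coeff16 z m S else 0)"
          by (simp add: z_def)
        also have "\<dots> = coeff16 (fps_deriv w) m S"
          unfolding w0(2) by (auto simp: w_def deg16_def)
        finally show "coeff16 z m S = coeff16 (fps_deriv w) m S" .
      qed
      have "w \<in> M" using N wE degs_w unfolding contains_def by force
      then have xw: "bracket16 x w \<in> M" using br x(1) by blast
      define x' where "x' = x - scale16 c 1"
      have x'E: "x' \<in> E16" unfolding x'_def using x(1) MsubL by (intro E16_intros one_E16) blast
      \<comment> \<open>The only negative degrees are -2, the constant just removed, and -1, the odd
        variables excluded by evenness. Bracketing with \<open>x'\<close> therefore does not lower
        degrees.\<close>
      have x'_degs: "0 \<le> p" if "p \<in> degs 2 ones x'" for p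
      proof -
        obtain m S where p: "p = 2 * int m + int (card S) - 2" "coeff16 x' m S \<noteq> 0"
          "S \<subseteq> {1..6}"
          using \<open>p \<in> _\<close> by (rule degs_ones_E)
        have fin: "finite S" using p(3) finite_subset by blast
        have "coeff16 x m S = (-1) ^ card S * coeff16 x m S"
          using arg_cong[OF x(2), of "\<lambda>h. coeff16 h m S"] by simp
        then have "coeff16 x m S = 0" if "odd (card S)" using that by simp
        moreover have "coeff16 x' m S = (if m = 0 \<and> S = {} then 0 else coeff16 x m S)"
          by (simp add: x'_def coeff16_one c_def)
        ultimately have "even (card S)" "m \<noteq> 0 \<or> card S \<noteq> 0" using p(2) fin by (metis, auto)
        then have "m \<noteq> 0 \<or> 2 \<le> card S" by presburger
        then show ?thesis using p(1) by auto
      qed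
      have "bracket16 x' w \<in> M"
      proof -
        have "N \<le> r" if "r \<in> degs 2 ones (bracket16 x' w)" for r
        proof -
          obtain p q where "r = p + q" "p \<in> degs 2 ones x'" "q \<in> degs 2 ones w"
            using degs_bracket[OF admissible_ones \<open>r \<in> _\<close>] .
          then show ?thesis using x'_degs[of p] degs_w by force
        qed
        then show ?thesis using N bracket16_E16[OF x'E wE] unfolding contains_def by blast
      qed
      then have "bracket16 x w - bracket16 x' w \<in> M" using xw K16.subspace_diff[OF sub] by blast
      also have "bracket16 x w - bracket16 x' w = scale16 (2 * c) z"
        unfolding bracket16_diff(1)[symmetric] x'_def zw
        by (simp add: bracket16_scale bracket16_one) (rule coeff16_eqI, simp)
      finally have "scale16 (1 / (2 * c)) (scale16 (2 * c) z) \<in> M"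
        by (rule K16.subspace_scale[OF sub])
      then show ?thesis using c0 by (simp add: c_def)
    qed
    ultimately have "y - z + z \<in> M" by (rule K16.subspace_add[OF sub])
    then show "y \<in> M" by simp
  qed
  have "contains (2 * int n + 5 - int m)" for m
  proof (induction m)
    case (Suc m)
    then show ?case using step[of "2 * int n + 5 - int m"] by (simp add: algebra_simps)
  qed (use start in simp)
  \<comment> \<open>After 2n + 7 steps down the bound reaches -2, the lowest degree of all.\<close>
  from this[of "2 * n + 7"] have "contains (- 2)" by simp
  moreover have "- 2 \<le> p" if "p \<in> degs 2 ones y" for p y
    using degs_ge[OF admissible_ones that] .
  ultimately have "E16 \<subseteq> M" unfolding contains_def by blast
  then show False using M by (auto simp: proper_open_subalgebra_def)
qed

section \<open>Unipotent inner automorphisms\<close>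

text \<open>An element of so(6), the Lie algebra of the form paired by \<open>dual\<close>, acting
  by derivations; \<open>bracket16_ovar_ovar\<close> identifies it with ad of a quadratic
  monomial.\<close>

definition rot :: "nat \<Rightarrow> nat \<Rightarrow> lambda16 \<Rightarrow> lambda16" where
  "rot a b f = ovar b * d_odd (dual a) f - ovar a * d_odd (dual b) f"

text \<open>The exponential series of \<open>s\<close> times \<open>rot a b\<close>, cut after the
  second order; the cut is exact for independent non-dual \<open>a\<close>, \<open>b\<close> by
  \<open>rot_cubed\<close>.\<close>

definition unipotent :: "nat \<Rightarrow> nat \<Rightarrow> complex \<Rightarrow> lambda16 \<Rightarrow> lambda16" where
  "unipotent a b s f = f + scale16 s (rot a b f) + scale16 (s\<^sup>2 / 2) (rot a b (rot a b f))"

section \<open>Quadratic elements as derivations\<close>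

lemma bracket16_ovar_ovar:
  assumes a: "a \<in> {1..6}" and b: "b \<in> {1..6}" and ab: "a \<noteq> b"
  shows "bracket16 (ovar a * ovar b) f = rot a b f"
proof -
  have "two_minus_euler (ovar a * ovar b) = 0"
  proof (rule coeff16_eqI)
    fix n S
    show "coeff16 (two_minus_euler (ovar a * ovar b)) n S = coeff16 0 n S"
    proof (cases "a \<in> S \<and> S - {a} = {b}")
      case True
      then have "S = {a, b}" by blast
      then show ?thesis using ab by simp
    next
      case False
      then show ?thesis using coeff16_ovar[OF b] coeff16_ovar_mult[OF a] by simp
    qed
  qed
  moreover have "contraction (parity16 (ovar a * ovar b)) f = rot a b f"
  proof -
    have "d_odd k (parity16 (ovar a * ovar b)) * d_odd (dual k) f =
        (if k = a then ovar b * d_odd (dual a) f else 0)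
        - (if k = b then ovar a * d_odd (dual b) f else 0)" if "k \<in> {1..6}" for k
      unfolding parity16_mult parity16_ovar minus_mult_minus d_odd_ovar_mult[OF that a]
        d_odd_ovar[OF that b] using ab by simp
    then have "contraction (parity16 (ovar a * ovar b)) f =
        (\<Sum>k = 1..6. (if k = a then ovar b * d_odd (dual a) f else 0)
           - (if k = b then ovar a * d_odd (dual b) f else 0))"
      unfolding contraction_def by (intro sum.cong) auto
    then show ?thesis using a b by (simp add: sum_subtractf sum.delta rot_def)
  qed
  ultimately show ?thesis by (simp add: bracket16_eq)
qed

lemma ovar_d_odd_mult:
  assumes "i \<in> {1..6}" "j \<in> {1..6}"
  shows "ovar i * d_odd j (f * g) = ovar i * d_odd j f * g + f * (ovar i * d_odd j g)"
  using assms ovar_supercommute[of i f]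
  by (simp add: d_odd_mult distrib_left flip: mult.assoc)

lemma d_odd_ovar_d_odd:
  assumes "k \<in> {1..6}" "i \<in> {1..6}"
  shows "d_odd k (ovar i * d_odd j f) = (if k = i then d_odd j f else 0) + ovar i * d_odd j (d_odd k f)"
  using assms d_odd_d_odd[of k j f] by (simp add: d_odd_ovar_mult)

lemma two_minus_euler_ovar_d_odd:
  assumes "i \<in> {1..6}" "j \<in> {1..6}" "i \<noteq> j"
  shows "two_minus_euler (ovar i * d_odd j f) = ovar i * d_odd j (two_minus_euler f)"
proof (rule coeff16_eqI)
  fix n S
  show "coeff16 (two_minus_euler (ovar i * d_odd j f)) n S =
      coeff16 (ovar i * d_odd j (two_minus_euler f)) n S"
  proof (cases "finite S \<and> i \<in> S \<and> j \<notin> S")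
    case True
    then have "card (insert j (S - {i})) = card S"
      by (metis DiffD1 card_Suc_Diff1 card_insert_disjoint finite_Diff)
    then show ?thesis using True assms by simp
  next
    case False
    then show ?thesis using assms by (auto simp: coeff16_infinite)
  qed
qed

context
  fixes a b :: nat
  assumes a: "a \<in> {1..6}" and b: "b \<in> {1..6}" and ab: "a \<noteq> b" "dual a \<noteq> b"
begin

lemma dual_indices: "dual a \<in> {1..6}" "dual b \<in> {1..6}" "dual b \<noteq> a" "dual a \<noteq> a" "dual b \<noteq> b"
  "dual a \<noteq> dual b"
  using dual_in[OF a] dual_in[OF b] dual_eq_iff[OF b a] dual_neq[OF a] dual_neq[OF b] ab
    dual_dual[OF a] dual_dual[OF b]
  by metis+

lemma rot_add: "rot a b (f + g) = rot a b f + rot a b g"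
  and rot_diff: "rot a b (f - g) = rot a b f - rot a b g"
  and rot_scale: "rot a b (scale16 c f) = scale16 c (rot a b f)"
  and rot_0: "rot a b 0 = 0"
  by (simp_all add: rot_def algebra_simps scale16_mult_right K16.scale_right_diff_distrib)

lemma rot_sum: "rot a b (sum F A) = (\<Sum>i\<in>A. rot a b (F i))"
  by (induction A rule: infinite_finite_induct) (simp_all add: rot_add rot_0)

lemma rot_mult: "rot a b (f * g) = rot a b f * g + f * rot a b g"
  using a b dual_indices by (simp add: rot_def ovar_d_odd_mult algebra_simps)

lemma rot_deriv: "rot a b (fps_deriv f) = fps_deriv (rot a b f)"
  by (simp add: rot_def)

lemma rot_parity: "rot a b (parity16 f) = parity16 (rot a b f)"
  by (simp add: rot_def d_odd_parity16 parity16_mult)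

lemma rot_two_minus_euler: "rot a b (two_minus_euler f) = two_minus_euler (rot a b f)"
  using a b ab dual_indices by (simp add: rot_def two_minus_euler_ovar_d_odd)

lemma d_odd_rot:
  "k \<in> {1..6} \<Longrightarrow> d_odd k (rot a b f) = rot a b (d_odd k f)
     + (if k = b then d_odd (dual a) f else 0) - (if k = a then d_odd (dual b) f else 0)"
  using a b by (simp add: rot_def d_odd_ovar_d_odd)

text \<open>Invariance of the form. Commuting \<open>rot a b\<close> past the odd derivatives leaves
  correction terms at \<open>a\<close>, \<open>b\<close> and at their duals, and these cancel in
  pairs because \<open>contraction\<close> sums over dual pairs.\<close>

lemma rot_contraction:
  "rot a b (contraction f g) = contraction (rot a b f) g + contraction f (rot a b g)"
proof -
  let ?L = "\<lambda>k. (if k = b then d_odd (dual a) f * d_odd (dual b) g else 0)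
    - (if k = a then d_odd (dual b) f * d_odd (dual a) g else 0)"
  let ?R = "\<lambda>k. (if k = dual b then d_odd (dual b) f * d_odd (dual a) g else 0)
    - (if k = dual a then d_odd (dual a) f * d_odd (dual b) g else 0)"
  have "contraction (rot a b f) g + contraction f (rot a b g) =
    (\<Sum>k = 1..6. rot a b (d_odd k f * d_odd (dual k) g) + ?L k + ?R k)"
    unfolding contraction_def sum.distrib[symmetric]
  proof (rule sum.cong)
    fix k :: nat assume k: "k \<in> {1..6}"
    have "dual k = b \<longleftrightarrow> k = dual b" "dual k = a \<longleftrightarrow> k = dual a"
      using dual_eq_iff[OF k a] dual_eq_iff[OF k b] by auto
    then have "d_odd k (rot a b f) * d_odd (dual k) g = rot a b (d_odd k f) * d_odd (dual k) g + ?L k"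
      "d_odd k f * d_odd (dual k) (rot a b g) = d_odd k f * rot a b (d_odd (dual k) g) + ?R k"
      unfolding d_odd_rot[OF k] d_odd_rot[OF dual_in[OF k]]
      by (simp_all only: if_distrib[of "\<lambda>h. _ * h"]) (auto simp: algebra_simps)
    then show "d_odd k (rot a b f) * d_odd (dual k) g + d_odd k f * d_odd (dual k) (rot a b g) =
        rot a b (d_odd k f * d_odd (dual k) g) + ?L k + ?R k"
      by (simp add: rot_mult)
  qed simp
  also have "\<dots> = rot a b (contraction f g) + (\<Sum>k = 1..6. ?L k) + (\<Sum>k = 1..6. ?R k)"
    by (simp only: sum.distrib contraction_def rot_sum)
  also have "(\<Sum>k = 1..6. ?L k) = d_odd (dual a) f * d_odd (dual b) g - d_odd (dual b) f * d_odd (dual a) g"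
    using a b by (simp add: sum_subtractf sum.delta)
  also have "(\<Sum>k = 1..6. ?R k) = d_odd (dual b) f * d_odd (dual a) g - d_odd (dual a) f * d_odd (dual b) g"
    using dual_indices(1,2) by (simp add: sum_subtractf sum.delta)
  finally show ?thesis by simp
qed

lemma rot_bracket:
  "rot a b (bracket16 f g) = bracket16 (rot a b f) g + bracket16 f (rot a b g)"
  unfolding bracket16_eq rot_add rot_diff rot_mult rot_deriv rot_two_minus_euler rot_contraction
    rot_parity
  by (simp add: algebra_simps)

text \<open>As \<open>a\<close>, \<open>b\<close> are distinct and not dual, \<open>rot a b\<close>
  is a difference A - B of commuting operators of square zero. Then (A - B)^2 = -2AB, which A - B
  kills.\<close>

lemma rot_cubed: "rot a b (rot a b (rot a b f)) = 0"
proof -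
  define A where "A f = ovar b * d_odd (dual a) f" for f
  define B where "B f = ovar a * d_odd (dual b) f" for f
  have rot: "rot a b f = A f - B f" for f by (simp add: rot_def A_def B_def)
  have AB_diff: "A (f - g) = A f - A g" "B (f - g) = B f - B g"
    and AB_minus: "A (- f) = - A f" "B (- f) = - B f" for f g
    by (simp_all add: A_def B_def algebra_simps)
  have nil: "ovar i * (ovar i * h) = 0" "d_odd i (d_odd i h) = 0" if "i \<in> {1..6}" for i h
    using that by (intro coeff16_eqI; auto)+
  have A2: "A (A f) = 0" for f
    unfolding A_def using a b ab dual_indices by (simp add: d_odd_ovar_d_odd nil)
  have B2: "B (B f) = 0" for f
    unfolding B_def using a b ab dual_indices by (simp add: d_odd_ovar_d_odd nil)
  have BA: "B (A f) = A (B f)" for f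
    unfolding A_def B_def using a b ab dual_indices ovar_anticommute[OF a b]
      d_odd_d_odd[of "dual a" "dual b"]
    by (simp add: d_odd_ovar_d_odd)
  have A0: "A 0 = 0" "B 0 = 0" by (simp_all add: A_def B_def)
  show ?thesis by (simp add: rot AB_diff AB_minus A2 B2 BA A0)
qed

section \<open>The one-parameter groups of quadratic elements\<close>

lemma unipotent_add: "unipotent a b s (f + g) = unipotent a b s f + unipotent a b s g"
  by (simp add: unipotent_def rot_add K16.scale_right_distrib algebra_simps)

lemma unipotent_scale: "unipotent a b s (scale16 c f) = scale16 c (unipotent a b s f)"
  by (simp add: unipotent_def rot_scale K16.scale_right_distrib algebra_simps)

lemma unipotent_parity: "unipotent a b s (parity16 f) = parity16 (unipotent a b s f)"
  by (simp add: unipotent_def rot_parity)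

lemma unipotent_unipotent:
  "unipotent a b s (unipotent a b r f) = unipotent a b (s + r) f"
proof -
  define D where "D = rot a b f"
  define E where "E = rot a b D"
  have "rot a b (unipotent a b r f) = D + scale16 r E"
    using rot_cubed[of f] by (simp add: unipotent_def rot_add rot_scale D_def E_def)
  moreover have "rot a b (D + scale16 r E) = E"
    using rot_cubed[of f] by (simp add: rot_add rot_scale D_def E_def)
  ultimately have "unipotent a b s (unipotent a b r f) =
      f + scale16 r D + scale16 (r\<^sup>2 / 2) E + scale16 s (D + scale16 r E) + scale16 (s\<^sup>2 / 2) E"
    by (simp add: unipotent_def D_def E_def)
  also have "\<dots> = f + scale16 (s + r) D + scale16 ((s + r)\<^sup>2 / 2) E"
    by (rule coeff16_eqI) (simp add: field_simps power2_eq_square)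
  finally show ?thesis by (simp add: unipotent_def D_def E_def)
qed

lemma unipotent_0: "unipotent a b 0 f = f"
  by (simp add: unipotent_def)

text \<open>The exponential of a derivation is multiplicative, but here the right side has terms up
  to \<open>s^4\<close> and the left stops at \<open>s^2\<close>. The excess vanishes because the
  cube of \<open>rot a b\<close> kills the bracket as well.\<close>

lemma unipotent_bracket:
  "unipotent a b s (bracket16 f g) = bracket16 (unipotent a b s f) (unipotent a b s g)"
proof -
  define f1 f2 g1 g2 where "f1 = rot a b f" and "f2 = rot a b f1"
    and "g1 = rot a b g" and "g2 = rot a b g1"
  have rots: "rot a b f = f1" "rot a b f1 = f2" "rot a b g = g1" "rot a b g1 = g2"
    "rot a b f2 = 0" "rot a b g2 = 0"
    using rot_cubed[of f] rot_cubed[of g] by (simp_all add: f1_def f2_def g1_def g2_def)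
  have 2: "rot a b (rot a b (bracket16 f g)) =
      bracket16 f2 g + scale16 2 (bracket16 f1 g1) + bracket16 f g2"
    unfolding rot_bracket rot_add rots by (rule coeff16_eqI) simp
  have 22: "bracket16 f2 g2 = 0"
  proof -
    \<comment> \<open>In the Leibniz expansion of the fourth power only the middle term survives,
      with binomial coefficient 6. For the third power the two surviving terms have coefficient
      3.\<close>
    have "scale16 6 (bracket16 f2 g2) = rot a b (rot a b (rot a b (rot a b (bracket16 f g))))"
      unfolding 2 rot_bracket rot_add rot_scale rots rot_0 by (rule coeff16_eqI) simp
    also have "\<dots> = 0" by (rule rot_cubed)
    finally have "scale16 (1/6) (scale16 6 (bracket16 f2 g2)) = 0" by simp
    then show ?thesis by simp
  qed
  have 12: "bracket16 f2 g1 + bracket16 f1 g2 = 0"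
  proof -
    have "scale16 3 (bracket16 f2 g1 + bracket16 f1 g2) = rot a b (rot a b (rot a b (bracket16 f g)))"
      unfolding 2 rot_bracket rot_add rot_scale rots rot_0 by (rule coeff16_eqI) simp
    also have "\<dots> = 0" by (rule rot_cubed)
    finally have "scale16 (1/3) (scale16 3 (bracket16 f2 g1 + bracket16 f1 g2)) = 0" by simp
    then show ?thesis by simp
  qed
  have "unipotent a b s (bracket16 f g) = bracket16 f g + scale16 s (bracket16 f1 g + bracket16 f g1)
      + scale16 (s\<^sup>2 / 2) (bracket16 f2 g + scale16 2 (bracket16 f1 g1) + bracket16 f g2)"
    unfolding unipotent_def 2 unfolding rot_bracket rots ..
  also have "\<dots> = bracket16 (f + scale16 s f1 + scale16 (s\<^sup>2 / 2) f2)
      (g + scale16 s g1 + scale16 (s\<^sup>2 / 2) g2)"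
  proof (rule coeff16_eqI)
    fix n S
    have br22: "coeff16 (bracket16 f2 g2) n S = 0"
      and br12: "coeff16 (bracket16 f2 g1) n S = - coeff16 (bracket16 f1 g2) n S"
      using 22 arg_cong[OF 12, of "\<lambda>h. coeff16 h n S"] by (simp_all add: eq_neg_iff_add_eq_0)
    show "coeff16 (bracket16 f g + scale16 s (bracket16 f1 g + bracket16 f g1)
        + scale16 (s\<^sup>2 / 2) (bracket16 f2 g + scale16 2 (bracket16 f1 g1) + bracket16 f g2)) n S =
      coeff16 (bracket16 (f + scale16 s f1 + scale16 (s\<^sup>2 / 2) f2)
        (g + scale16 s g1 + scale16 (s\<^sup>2 / 2) g2)) n S"
      by (simp add: bracket16_add bracket16_scale br22 br12 field_simps power2_eq_square)
  qed
  finally show ?thesis by (simp add: unipotent_def f1_def f2_def g1_def g2_def)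
qed

lemma rot_E16: "f \<in> E16 \<Longrightarrow> rot a b f \<in> E16"
  using bracket16_ovar_ovar[OF a b ab(1)] bracket16_E16[OF ovar_mult_ovar_E16[OF a b]] by metis

lemma unipotent_E16: "f \<in> E16 \<Longrightarrow> unipotent a b s f \<in> E16"
  unfolding unipotent_def by (intro E16_intros rot_E16)

text \<open>Without t-derivatives the map acts on each power of t separately; this is what makes it
  continuous.\<close>

lemma fps_nth_unipotent_cong:
  assumes "fps_nth f n = fps_nth g n"
  shows "fps_nth (unipotent a b s f) n = fps_nth (unipotent a b s g) n"
proof -
  have rot: "fps_nth (rot a b u) n = fps_nth (rot a b v) n" if "fps_nth u n = fps_nth v n" for u v
    using that by (simp add: rot_def ovar_def d_odd_def)
  show ?thesis
    unfolding unipotent_def fps_add_nth fps_nth_scale16 using assms rot[OF assms] rot[OF rot[OF assms]]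
    by simp
qed

lemma continuous_unipotent: "continuous_on A (unipotent a b s)"
  unfolding continuous_on_iff
proof (intro ballI allI impI)
  fix f and e :: real assume "0 < e"
  then obtain n where n: "inverse (2 ^ n) < e"
    using real_arch_pow_inv[of e "1/2"] by (auto simp: power_one_over inverse_eq_divide)
  have "dist (unipotent a b s g) (unipotent a b s f) < e" if "dist g f < inverse (2 ^ n)" for g
  proof -
    have "dist (unipotent a b s g) (unipotent a b s f) < inverse (2 ^ n)"
      using that fps_nth_unipotent_cong unfolding dist_fps_less_iff by blast
    then show ?thesis using n by linarith
  qed
  then show "\<exists>d>0. \<forall>g\<in>A. dist g f < d \<longrightarrow> dist (unipotent a b s g) (unipotent a b s f) < e"
    by (intro exI[of _ "inverse (2 ^ n)"]) simp
qed

lemma bij_unipotent: "bij_betw (unipotent a b s) E16 E16"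
  by (rule bij_betw_byWitness[where f' = "unipotent a b (- s)"])
    (auto simp: unipotent_unipotent unipotent_0 unipotent_E16)

lemma continuous_automorphism_unipotent:
  "continuous_automorphism E16 (restrict (unipotent a b s) E16)"
  unfolding continuous_automorphism_def
proof (intro conjI)
  show "restrict (unipotent a b s) E16 \<in> Bij E16"
    using bij_unipotent by (simp add: Bij_def cong: bij_betw_cong)
  show "continuous_on E16 (restrict (unipotent a b s) E16)"
    using continuous_unipotent by (simp cong: continuous_on_cong)
qed (simp_all add: unipotent_add unipotent_scale unipotent_parity unipotent_bracket E16_intros)

lemma exp_ad_sums_unipotent:
  "exp_ad_sums (scale16 s (ovar a * ovar b)) x (unipotent a b s x)"
proof -
  have ad: "bracket16 (scale16 s (ovar a * ovar b)) f = scale16 s (rot a b f)" for f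
    by (simp add: bracket16_scale bracket16_ovar_ovar[OF a b ab(1)])
  have zero: "(bracket16 (scale16 s (ovar a * ovar b)) ^^ k) x = 0" if "3 \<le> k" for k
    using that
  proof (induction k rule: dec_induct)
    case base
    show ?case by (simp add: eval_nat_numeral ad rot_scale rot_cubed)
  qed simp
  show ?thesis
    unfolding exp_ad_sums_def
  proof (intro allI)
    fix n S
    let ?h = "\<lambda>k. coeff16 (scale16 (1 / fact k) ((bracket16 (scale16 s (ovar a * ovar b)) ^^ k) x)) n S"
    have "?h sums sum ?h {..<3}"
      by (rule sums_finite) (auto simp: zero)
    moreover have "sum ?h {..<3} = coeff16 (unipotent a b s x) n S"
      by (simp add: eval_nat_numeral ad unipotent_def rot_scale)
    ultimately show "?h sums coeff16 (unipotent a b s x) n S" by simp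
  qed
qed

lemma exp_ad_unipotent:
  "exp_ad E16 (scale16 s (ovar a * ovar b)) = restrict (unipotent a b s) E16"
proof -
  have "(THE y. exp_ad_sums (scale16 s (ovar a * ovar b)) x y) = unipotent a b s x" for x
  proof (rule the_equality[where P = "exp_ad_sums (scale16 s (ovar a * ovar b)) x"])
    show "exp_ad_sums (scale16 s (ovar a * ovar b)) x (unipotent a b s x)"
      by (rule exp_ad_sums_unipotent)
    fix y assume y: "exp_ad_sums (scale16 s (ovar a * ovar b)) x y"
    show "y = unipotent a b s x"
    proof (rule coeff16_eqI)
      fix n S show "coeff16 y n S = coeff16 (unipotent a b s x) n S"
        using y exp_ad_sums_unipotent[of s x] unfolding exp_ad_sums_def by (meson sums_unique2)
    qed
  qed
  then show ?thesis by (simp add: exp_ad_def)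
qed

lemma unipotent_inner: "restrict (unipotent a b s) E16 \<in> inner_automorphisms E16"
proof -
  have "exponentiable E16 (scale16 s (ovar a * ovar b))"
    unfolding exponentiable_def K16.scale_scale exp_ad_unipotent
    using exp_ad_sums_unipotent continuous_automorphism_unipotent ovar_mult_ovar_E16[OF a b]
    by (auto simp: parity16_mult E16_intros)
  then show ?thesis
    unfolding inner_automorphisms_def exp_ad_unipotent[symmetric]
    by (intro generate.incl) blast
qed

text \<open>The quadratic term of the exponential contributes nothing: on linear parts
  \<open>rot a b\<close> has its image in the isotropic plane of \<open>a\<close> and
  \<open>b\<close>, which it annihilates.\<close>

lemma linear_part_unipotent:
  "coeff16 (unipotent a b s f) 0 {i} = coeff16 f 0 {i}
     + (if i = b then s * coeff16 f 0 {dual a} else 0) - (if i = a then s * coeff16 f 0 {dual b} else 0)"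
proof -
  have rot: "coeff16 (rot a b f) 0 {i} =
      (if i = b then coeff16 f 0 {dual a} else 0) - (if i = a then coeff16 f 0 {dual b} else 0)" for f i
    using a b by (auto simp: rot_def gsign_insert)
  have "coeff16 (rot a b (rot a b f)) 0 {i} = 0"
    using ab dual_indices by (simp add: rot)
  then show ?thesis by (simp add: unipotent_def rot algebra_simps)
qed

end

section \<open>Low order terms of a proper open subalgebra\<close>

definition even_part :: "lambda16 \<Rightarrow> lambda16" where
  "even_part f = scale16 (1 / 2) (f + parity16 f)"

definition odd_part :: "lambda16 \<Rightarrow> lambda16" where
  "odd_part f = scale16 (1 / 2) (f - parity16 f)"

lemma coeff16_even_part [simp]:
  "coeff16 (even_part f) n S = (if even (card S) then coeff16 f n S else 0)"
  and coeff16_odd_part [simp]: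
  "coeff16 (odd_part f) n S = (if odd (card S) then coeff16 f n S else 0)"
  by (simp_all add: even_part_def odd_part_def)

lemma parity16_even_part: "parity16 (even_part f) = even_part f"
  and parity16_odd_part: "parity16 (odd_part f) = - odd_part f"
  by (rule coeff16_eqI; simp)+

lemma coeff16_mult_low:
  "coeff16 (f * g) 0 {} = coeff16 f 0 {} * coeff16 g 0 {}"
  "coeff16 (f * g) 0 {i} = coeff16 f 0 {} * coeff16 g 0 {i} + coeff16 f 0 {i} * coeff16 g 0 {}"
  "i < j \<Longrightarrow> coeff16 (f * g) 0 {i, j} =
     coeff16 f 0 {} * coeff16 g 0 {i, j} + coeff16 f 0 {i, j} * coeff16 g 0 {}
     + coeff16 f 0 {i} * coeff16 g 0 {j} - coeff16 f 0 {j} * coeff16 g 0 {i}"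
  by (simp_all add: coeff16_def gcoeff_mult_low)

lemma coeff16_bracket_odd_odd:
  "coeff16 (bracket16 (odd_part x) (odd_part y)) 0 {} =
    - (\<Sum>k = 1..6. coeff16 x 0 {k} * coeff16 y 0 {dual k})"
  by (simp add: bracket16_eq contraction_def parity16_odd_part coeff16_mult_low sum_negf)

lemma coeff16_bracket_even_odd:
  assumes "coeff16 x 0 {} = 0"
  shows "coeff16 (bracket16 (even_part x) (odd_part y)) 0 {i} =
    - coeff16 x 1 {} * coeff16 y 0 {i} + (\<Sum>k = 1..6. coeff16 (d_odd k x) 0 {i} * coeff16 y 0 {dual k})"
proof -
  have "coeff16 (d_odd k (even_part x)) 0 {i} = coeff16 (d_odd k x) 0 {i}" for k
    by simp
  then show ?thesis using assms
    by (simp add: bracket16_eq contraction_def parity16_even_part coeff16_mult_low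
        del: coeff16_simps(8)) simp
qed

lemma coeff16_bracket_odd_odd_pair:
  assumes "p < q" "coeff16 x 0 {p} = 0" "coeff16 x 0 {q} = 0" "coeff16 y 0 {p} = 0" "coeff16 y 0 {q} = 0"
  shows "coeff16 (bracket16 (odd_part x) (odd_part y)) 0 {p, q} =
    - (\<Sum>k = 1..6. coeff16 x 0 {k} * coeff16 (d_odd (dual k) y) 0 {p, q}
        + coeff16 (d_odd k x) 0 {p, q} * coeff16 y 0 {dual k})"
proof -
  have odd: "coeff16 (d_odd k (odd_part z)) 0 {p, q} = coeff16 (d_odd k z) 0 {p, q}"
    "coeff16 (d_odd k (odd_part z)) 0 {} = coeff16 z 0 {k}"
    "coeff16 (d_odd k (odd_part z)) 0 {r} = 0" for k z r
    using assms(1) by simp_all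
  have "coeff16 (contraction (parity16 (odd_part x)) (odd_part y)) 0 {p, q} =
    - (\<Sum>k = 1..6. coeff16 x 0 {k} * coeff16 (d_odd (dual k) y) 0 {p, q}
        + coeff16 (d_odd k x) 0 {p, q} * coeff16 y 0 {dual k})"
    unfolding contraction_def parity16_odd_part d_odd_simps mult_minus_left coeff16_simps(4)
      coeff16_sum coeff16_mult_low(3)[OF assms(1)] odd sum_negf[symmetric]
    by (intro sum.cong refl) simp
  then show ?thesis
    using assms by (simp add: bracket16_eq coeff16_mult_low(3))
qed

context
  fixes M assumes M: "proper_open_subalgebra M"
begin

lemma parts_in_M:
  assumes "x \<in> M" shows "even_part x \<in> M" "odd_part x \<in> M"
  using assms proper_open_subalgebra_D[OF M] unfolding even_part_def odd_part_def
  by (simp_all add: K16.subspace_add K16.subspace_diff K16.subspace_scale)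

lemma constant_term_zero: "x \<in> M \<Longrightarrow> coeff16 x 0 {} = 0"
  using even_part_no_constant[OF M parts_in_M(1) parity16_even_part, of x] by simp

text \<open>The bracket of two odd parts has as constant term minus the invariant form of the linear
  parts, and elements of \<open>M\<close> have no constant term.\<close>

lemma linear_parts_isotropic:
  assumes "x \<in> M" "y \<in> M"
  shows "(\<Sum>k = 1..6. coeff16 x 0 {k} * coeff16 y 0 {dual k}) = 0"
  using constant_term_zero[OF proper_open_subalgebra_D(4)[OF M parts_in_M(2)[OF assms(1)]
        parts_in_M(2)[OF assms(2)]]]
  unfolding coeff16_bracket_odd_odd by simp

text \<open>The even part of \<open>X\<close> sends the basis vector \<open>i\<close>, the linear
  part of \<open>x\<close>, to a linear part whose coordinate \<open>j\<close> is, up to sign, the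
  coefficient of \<open>{dual i, j}\<close>.\<close>

lemma pair_coefficient_zero:
  assumes x: "x \<in> M" "\<And>k. k \<in> {1..6} \<Longrightarrow> coeff16 x 0 {k} = (if k = i then 1 else 0)"
    and i: "i \<in> {1..6}" and j: "j \<in> {1..6}" "j \<noteq> i" "j \<noteq> dual i"
    and lin: "\<And>y. y \<in> M \<Longrightarrow> coeff16 y 0 {j} = 0" and X: "X \<in> M"
  shows "coeff16 X 0 {dual i, j} = 0"
proof -
  have "bracket16 (even_part X) (odd_part x) \<in> M"
    using proper_open_subalgebra_D(4)[OF M] parts_in_M x(1) X by blast
  then have "0 = coeff16 (bracket16 (even_part X) (odd_part x)) 0 {j}"
    using lin by simp
  also have "\<dots> = (\<Sum>k = 1..6. coeff16 (d_odd k X) 0 {j} * coeff16 x 0 {dual k})"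
    using coeff16_bracket_even_odd[OF constant_term_zero[OF X]] x(2)[OF j(1)] j(2) by simp
  also have "\<dots> = (\<Sum>k = 1..6. if k = dual i then coeff16 (d_odd (dual i) X) 0 {j} else 0)"
  proof (rule sum.cong)
    fix k :: nat assume k: "k \<in> {1..6}"
    show "coeff16 (d_odd k X) 0 {j} * coeff16 x 0 {dual k} =
        (if k = dual i then coeff16 (d_odd (dual i) X) 0 {j} else 0)"
      using x(2)[OF dual_in[OF k]] dual_eq_iff[OF k i] by simp
  qed simp
  also have "\<dots> = coeff16 (d_odd (dual i) X) 0 {j}"
    using dual_in[OF i] by (simp add: sum.delta)
  also have "\<dots> = gsign (dual i) {j} * coeff16 X 0 {dual i, j}"
    using j(3) by simp
  finally show ?thesis by (simp add: gsign_def)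
qed

text \<open>A polarisation argument. Up to sign the \<open>{p, q}\<close> coefficient of a bracket
  of odd parts is \<open>y_i t(z) + t(y) z_i\<close>, with \<open>t\<close> the cubic coefficient in
  question. Taking \<open>y = z = x\<close> gives \<open>t(x) = 0\<close>, and then
  \<open>y = x\<close>, \<open>z = X\<close> gives \<open>t(X) = 0\<close>.\<close>

lemma triple_coefficient_zero:
  assumes x: "x \<in> M" "coeff16 x 0 {i} = 1"
    and i: "i \<in> {1..6}" "dual i \<noteq> p" "dual i \<noteq> q" and pq: "p < q"
    and pair: "\<And>y. y \<in> M \<Longrightarrow> coeff16 y 0 {p, q} = 0"
    and p0: "\<And>y. y \<in> M \<Longrightarrow> coeff16 y 0 {p} = 0" and q0: "\<And>y. y \<in> M \<Longrightarrow> coeff16 y 0 {q} = 0"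
    and other: "\<And>y k. y \<in> M \<Longrightarrow> k \<in> {1..6} \<Longrightarrow> k \<noteq> i \<Longrightarrow> dual k \<noteq> p \<Longrightarrow> dual k \<noteq> q
      \<Longrightarrow> coeff16 y 0 {k} = 0"
    and X: "X \<in> M"
  shows "coeff16 X 0 {dual i, p, q} = 0"
proof -
  define t where "t y = coeff16 y 0 {dual i, p, q}" for y
  have rel: "coeff16 y 0 {i} * t z + t y * coeff16 z 0 {i} = 0" if y: "y \<in> M" and z: "z \<in> M" for y z
  proof -
    \<comment> \<open>For \<open>dual k\<close> in \<open>{p, q}\<close> the derivative has no
      \<open>{p, q}\<close> term, and the remaining \<open>k\<close> other than \<open>i\<close>
      have no linear coefficient; only \<open>k = i\<close> contributes.\<close>
    have cubic: "coeff16 v 0 {k} * coeff16 (d_odd (dual k) w) 0 {p, q} =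
        (if k = i then gsign (dual i) {p, q} * (coeff16 v 0 {i} * t w) else 0)"
      if "v \<in> M" "k \<in> {1..6}" for v w k
      using i pq other[OF that] by (cases "k = i") (auto simp: t_def)
    have "bracket16 (odd_part y) (odd_part z) \<in> M"
      using proper_open_subalgebra_D(4)[OF M] parts_in_M y z by blast
    then have "0 = coeff16 (bracket16 (odd_part y) (odd_part z)) 0 {p, q}"
      using pair by simp
    also have "\<dots> = - (\<Sum>k = 1..6. coeff16 y 0 {k} * coeff16 (d_odd (dual k) z) 0 {p, q}
        + coeff16 (d_odd k y) 0 {p, q} * coeff16 z 0 {dual k})"
      by (intro coeff16_bracket_odd_odd_pair pq p0 q0 y z)
    also have "\<dots> = - (\<Sum>k = 1..6. (if k = i then gsign (dual i) {p, q} * (coeff16 y 0 {i} * t z) else 0)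
        + (if k = dual i then gsign (dual i) {p, q} * (coeff16 z 0 {i} * t y) else 0))"
    proof (intro arg_cong[where f = uminus] sum.cong arg_cong2[where f = "(+)"] cubic[OF y])
      fix k :: nat assume k: "k \<in> {1..6}"
      have "coeff16 z 0 {dual k} * coeff16 (d_odd (dual (dual k)) y) 0 {p, q} =
        (if dual k = i then gsign (dual i) {p, q} * (coeff16 z 0 {i} * t y) else 0)"
        by (rule cubic[OF z dual_in[OF k]])
      then show "coeff16 (d_odd k y) 0 {p, q} * coeff16 z 0 {dual k} =
        (if k = dual i then gsign (dual i) {p, q} * (coeff16 z 0 {i} * t y) else 0)"
        using dual_dual[OF k] dual_eq_iff[OF k i(1)] by (simp only: mult.commute)
    qed simp_all
    also have "\<dots> = - (gsign (dual i) {p, q} * (coeff16 y 0 {i} * t z + t y * coeff16 z 0 {i}))"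
      using i(1) dual_in[OF i(1)] by (simp add: sum.distrib sum.delta algebra_simps)
    finally show ?thesis by (simp add: gsign_def)
  qed
  have "t x = 0" using rel[OF x(1) x(1)] x(2) by simp
  then show ?thesis using rel[OF x(1) X] x(2) by (simp add: t_def)
qed

text \<open>The two quadratic elements carry the coordinate \<open>x_j\<close> to positions
  \<open>i\<close> and \<open>dual i\<close>. The images pair to the square of \<open>x_j\<close>,
  which isotropy forces to be 0.\<close>

lemma linear_coefficient_zero:
  assumes j: "j \<in> {1..6}" and i: "i \<in> {1..6}" "i \<noteq> j" "i \<noteq> dual j"
    and quad: "ovar (dual j) * ovar i \<in> M" "ovar (dual j) * ovar (dual i) \<in> M"
    and x: "x \<in> M"
  shows "coeff16 x 0 {j} = 0"
proof -
  have di: "dual i \<in> {1..6}" "dual i \<noteq> j" "dual i \<noteq> dual j"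
    using i dual_eq_iff[OF i(1) j] dual_dual[OF i(1)] dual_dual[OF j] dual_in[OF i(1)] by metis+
  have rot: "coeff16 (rot (dual j) m x) 0 {k} =
      (if k = m then coeff16 x 0 {j} else 0) - (if k = dual j then coeff16 x 0 {dual m} else 0)"
    if "m \<in> {1..6}" for m k
    unfolding rot_def using that dual_in[OF j] dual_dual[OF j] by (auto simp: gsign_insert)
  have "rot (dual j) i x \<in> M" "rot (dual j) (dual i) x \<in> M"
    using proper_open_subalgebra_D(4)[OF M quad(1) x] proper_open_subalgebra_D(4)[OF M quad(2) x]
      bracket16_ovar_ovar[OF dual_in[OF j] i(1)] bracket16_ovar_ovar[OF dual_in[OF j] di(1)] i(3) di(3)
    by metis+
  from linear_parts_isotropic[OF this]
  have "0 = (\<Sum>k = 1..6. if k = i then coeff16 x 0 {j} * coeff16 x 0 {j} else 0)"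
  proof (rule trans[OF sym], intro sum.cong)
    fix k :: nat assume k: "k \<in> {1..6}"
    have "dual k = dual i \<longleftrightarrow> k = i" "dual k = dual j \<longleftrightarrow> k = j" "k = dual j \<longleftrightarrow> dual k = j"
      using dual_dual k i(1) j dual_eq_iff[OF k j] by metis+
    then show "coeff16 (rot (dual j) i x) 0 {k} * coeff16 (rot (dual j) (dual i) x) 0 {dual k} =
        (if k = i then coeff16 x 0 {j} * coeff16 x 0 {j} else 0)"
      unfolding rot[OF i(1)] rot[OF di(1)] using i di k by auto
  qed simp
  then show ?thesis using i(1) by (simp add: sum.delta)
qed

end

section \<open>Containment in the four graded subalgebras\<close>

lemma deg16_upto_6:
  assumes "S \<subseteq> {1..6}"
  shows "deg16 a b n S = int n * a - a + (if 1 \<in> S then b ! 0 else 0) + (if 2 \<in> S then b ! 1 else 0)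
    + (if 3 \<in> S then b ! 2 else 0) + (if 4 \<in> S then b ! 3 else 0) + (if 5 \<in> S then b ! 4 else 0)
    + (if 6 \<in> S then b ! 5 else 0)"
proof -
  have "(\<Sum>i\<in>S. b ! (i - 1)) = (\<Sum>i\<in>{1..6} \<inter> S. b ! (i - 1))"
    using assms by (simp add: Int_absorb1)
  also have "\<dots> = (\<Sum>i = 1..6. if i \<in> S then b ! (i - 1) else 0)"
    by (rule sum.inter_restrict) simp
  finally show ?thesis unfolding deg16_def sum_upto_3_6 by simp
qed

lemma admissible_types:
  "admissible 2 [2,1,1,0,1,1]" "admissible 1 [1,1,1,0,0,0]" "admissible 1 [1,1,0,0,0,1]"
  unfolding admissible_def ball_upto_6 by (simp_all add: dual_def)

text \<open>In terms of the space of linear parts of \<open>M\<close>: it contains the basis vector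
  \<open>i\<close>. Correspondingly \<open>linear_vanish\<close> places that space in a coordinate
  hyperplane.\<close>

definition contains_unit :: "lambda16 set \<Rightarrow> nat \<Rightarrow> bool" where
  "contains_unit M i \<longleftrightarrow>
     (\<exists>x\<in>M. \<forall>k\<in>{1..6}. coeff16 x 0 {k} = (if k = i then 1 else 0))"

definition linear_vanish :: "lambda16 set \<Rightarrow> nat \<Rightarrow> bool" where
  "linear_vanish M j \<longleftrightarrow> (\<forall>y\<in>M. coeff16 y 0 {j} = 0)"

lemma contains_unit_ovar: "i \<in> {1..6} \<Longrightarrow> ovar i \<in> M \<Longrightarrow> contains_unit M i"
  unfolding contains_unit_def by (intro bexI[of _ "ovar i"]) (auto simp: coeff16_ovar)

context
  fixes M assumes M: "proper_open_subalgebra M"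
begin

lemma subset_graded_subalgebra:
  assumes "admissible a b"
    and "\<And>n S. S \<subseteq> {1..6} \<Longrightarrow> deg16 a b n S < 0 \<Longrightarrow> n = 0 \<and> (\<forall>y\<in>M. coeff16 y 0 S = 0)"
  shows "M \<subseteq> graded_subalgebra E16 a b"
proof
  fix y assume y: "y \<in> M"
  have "0 \<le> p" if p: "p \<in> degs a b y" for p
  proof -
    obtain n S where "p = deg16 a b n S" "coeff16 y n S \<noteq> 0" "S \<subseteq> {1..6}"
      using p by (rule degs_E)
    then show ?thesis using assms(2)[of S n] y by (cases "p < 0") auto
  qed
  then show "y \<in> graded_subalgebra E16 a b"
    using graded_subalgebra_E16[OF assms(1)] proper_open_subalgebra_D(2)[OF M] y by blast
qed

lemma pair_vanishes:
  assumes "contains_unit M i" "linear_vanish M j" "i \<in> {1..6}" "j \<in> {1..6}" "j \<noteq> i" "j \<noteq> dual i"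
  shows "\<forall>y\<in>M. coeff16 y 0 {dual i, j} = 0"
  using assms pair_coefficient_zero[OF M] unfolding contains_unit_def linear_vanish_def by metis

lemma unit_imp_dual_vanish:
  assumes "contains_unit M i" "i \<in> {1..6}"
  shows "linear_vanish M (dual i)"
  unfolding linear_vanish_def
proof
  fix y assume "y \<in> M"
  obtain x where x: "x \<in> M" "\<forall>k\<in>{1..6}. coeff16 x 0 {k} = (if k = i then 1 else 0)"
    using assms(1) by (auto simp: contains_unit_def)
  have "0 = (\<Sum>k = 1..6. coeff16 x 0 {k} * coeff16 y 0 {dual k})"
    using linear_parts_isotropic[OF M x(1) \<open>y \<in> M\<close>] by simp
  also have "\<dots> = (\<Sum>k = 1..6. if k = i then coeff16 y 0 {dual i} else 0)"
    by (rule sum.cong) (use x(2) in auto)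
  finally show "coeff16 y 0 {dual i} = 0" using assms(2) by (simp add: sum.delta)
qed

lemma constant_vanishes: "\<forall>y\<in>M. coeff16 y 0 {} = 0"
  using constant_term_zero[OF M] by blast

lemma subset_type_1:
  assumes "\<And>j. j \<in> {1..6} \<Longrightarrow> linear_vanish M j"
  shows "M \<subseteq> graded_subalgebra E16 2 ones"
proof (rule subset_graded_subalgebra[OF admissible_ones])
  fix n S assume S: "S \<subseteq> {1..6::nat}" and neg: "deg16 2 ones n S < 0"
  then have n: "n = 0" "card S \<le> 1" using deg16_ones[OF S, of n] by auto
  have "finite S" using S finite_subset by blast
  then have "S = {} \<or> (\<exists>j. S = {j})" using n(2) by (cases "card S") (auto simp: card_1_singleton_iff)
  then show "n = 0 \<and> (\<forall>y\<in>M. coeff16 y 0 S = 0)"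
    using n(1) S constant_vanishes assms by (auto simp: linear_vanish_def)
qed

text \<open>The monomials of negative degree are 1, \<open>eta_1\<close>, the \<open>e_j\<close> and
  the \<open>eta_1 e_j\<close> with \<open>j\<close> in {2,3,5,6}. The last ones vanish because
  quadratic parts preserve the line of \<open>xi_1\<close>.\<close>

lemma subset_type_2:
  assumes unit: "contains_unit M 1" and van: "\<And>j. j \<in> {2,3,5,6} \<Longrightarrow> linear_vanish M j"
  shows "M \<subseteq> graded_subalgebra E16 2 [2,1,1,0,1,1]"
proof (rule subset_graded_subalgebra[OF admissible_types(1)])
  fix n S assume S: "S \<subseteq> {1..6::nat}" and neg: "deg16 2 [2,1,1,0,1,1] n S < 0"
  \<comment> \<open>Membership indicators as integers, so that the combinatorics of \<open>S\<close>
    becomes linear arithmetic.\<close>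
  define c :: "nat \<Rightarrow> int" where "c i = (if i \<in> S then 1 else 0)" for i
  have c0: "0 \<le> c i" and c1: "i \<in> S \<Longrightarrow> c i = 1" for i by (simp_all add: c_def)
  have "deg16 2 [2,1,1,0,1,1] n S = 2 * int n - 2 + 2 * c 1 + c 2 + c 3 + c 5 + c 6"
    unfolding deg16_upto_6[OF S] by (simp add: c_def)
  then have le: "2 * int n + 2 * c 1 + c 2 + c 3 + c 5 + c 6 \<le> 1" using neg by simp
  note c0s = c0[of 1] c0[of 2] c0[of 3] c0[of 5] c0[of 6]
  have n: "n = 0" using le c0s by linarith
  have "1 \<notin> S"
  proof
    assume "1 \<in> S"
    from c1[OF this] show False using le c0s by linarith
  qed
  have one: "i = j" if "i \<in> {2,3,5,6}" "j \<in> {2,3,5,6}" "i \<in> S" "j \<in> S" for i j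
  proof (rule ccontr)
    assume "i \<noteq> j"
    then have "c i + c j \<le> c 2 + c 3 + c 5 + c 6" using that(1,2) c0s by auto
    then show False using c1[OF that(3)] c1[OF that(4)] le c0s by linarith
  qed
  have 4: "linear_vanish M 4"
    using unit_imp_dual_vanish[OF unit] by (simp add: dual_def)
  have pair: "\<forall>y\<in>M. coeff16 y 0 {4, j} = 0" if "j \<in> {2,3,5,6}" for j
  proof -
    have j: "1 \<in> {1..6::nat}" "dual 1 = 4" "j \<in> {1..6}" "j \<noteq> 1" "j \<noteq> dual 1"
      using that by (auto simp: dual_def)
    show ?thesis using pair_vanishes[OF unit van[OF that] j(1,3,4,5)] unfolding j(2) .
  qed
  have S': "S \<subseteq> {2,3,4,5,6}" using S \<open>1 \<notin> S\<close> unfolding upto_6 by blast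
  have "S = {} \<or> S = {4} \<or> (\<exists>j\<in>{2,3,5,6}. S = {j} \<or> S = {4, j})"
  proof (cases "S \<inter> {2,3,5,6} = {}")
    case True
    then show ?thesis using S' by blast
  next
    case False
    then obtain j where j: "j \<in> {2,3,5,6}" "j \<in> S" by blast
    have "x = 4 \<or> x = j" if "x \<in> S" for x
      using one[OF j(1) _ j(2) that] S' that by blast
    then have "S = {j} \<or> S = {4, j}" using j(2) by (cases "4 \<in> S") auto
    then show ?thesis using j(1) by blast
  qed
  then show "n = 0 \<and> (\<forall>y\<in>M. coeff16 y 0 S = 0)"
    using n constant_vanishes 4 van pair unfolding linear_vanish_def by (elim disjE bexE) auto
qed

text \<open>Negative degree means a product of \<open>eta\<close>s without t. Pairs vanish by
  invariance of the linear parts, and the product of all three by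
  \<open>triple_coefficient_zero\<close> at \<open>i = 1\<close>. The hypotheses cover both the
  plane of \<open>xi_1\<close>, \<open>xi_2\<close> and its extension by
  \<open>xi_3\<close>.\<close>

lemma subset_type_3:
  assumes unit: "contains_unit M 1" "contains_unit M 2" and 6: "linear_vanish M 6"
  shows "M \<subseteq> graded_subalgebra E16 1 [1,1,1,0,0,0]"
proof (rule subset_graded_subalgebra[OF admissible_types(2)])
  fix n S assume S: "S \<subseteq> {1..6::nat}" and neg: "deg16 1 [1,1,1,0,0,0] n S < 0"
  define c :: "nat \<Rightarrow> int" where "c i = (if i \<in> S then 1 else 0)" for i
  have c0: "0 \<le> c i" and c1: "i \<in> S \<Longrightarrow> c i = 1" for i by (simp_all add: c_def)
  have "deg16 1 [1,1,1,0,0,0] n S = int n - 1 + c 1 + c 2 + c 3"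
    unfolding deg16_upto_6[OF S] by (simp add: c_def)
  then have le: "int n + c 1 + c 2 + c 3 \<le> 0" using neg by simp
  note c0s = c0[of 1] c0[of 2] c0[of 3]
  have n: "n = 0" and "c 1 = 0" "c 2 = 0" "c 3 = 0" using le c0s by linarith+
  then have "1 \<notin> S" "2 \<notin> S" "3 \<notin> S" by (auto dest: c1)
  then have "S \<in> Pow {4,5,6}" using S unfolding upto_6 by blast
  then have cases: "S = {} \<or> S = {4} \<or> S = {5} \<or> S = {6} \<or> S = {4,5} \<or> S = {4,6} \<or> S = {5,6} \<or> S = {4,5,6}"
    unfolding Pow_insert by auto
  have 45: "linear_vanish M 4" "linear_vanish M 5"
    using unit_imp_dual_vanish[OF unit(1)] unit_imp_dual_vanish[OF unit(2)] by (simp_all add: dual_def)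
  have pairs: "\<forall>y\<in>M. coeff16 y 0 {4, 5} = 0" "\<forall>y\<in>M. coeff16 y 0 {4, 6} = 0"
    "\<forall>y\<in>M. coeff16 y 0 {5, 6} = 0"
    using pair_vanishes[OF unit(1) 45(2)] pair_vanishes[OF unit(1) 6] pair_vanishes[OF unit(2) 6]
    by (simp_all add: dual_def)
  obtain x where x: "x \<in> M" "\<forall>k\<in>{1..6}. coeff16 x 0 {k} = (if k = 1 then 1 else 0)"
    using unit(1) by (auto simp: contains_unit_def)
  have "coeff16 y 0 {dual 1, 5, 6} = 0" if y: "y \<in> M" for y
  proof (rule triple_coefficient_zero[OF M x(1) _ _ _ _ _ _ _ _ _ y])
    show "coeff16 x 0 {1} = 1" using x(2) by simp
    fix y k assume *: "y \<in> M" "k \<in> {1..6}" "k \<noteq> 1" "dual k \<noteq> 5" "dual k \<noteq> 6"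
    then have "k = 4 \<or> k = 5 \<or> k = 6" unfolding upto_6 by (auto simp: dual_def)
    then show "coeff16 y 0 {k} = 0" using * 45 6 by (auto simp: linear_vanish_def)
  qed (use pairs 45 6 in \<open>auto simp: dual_def linear_vanish_def\<close>)
  then have "\<forall>y\<in>M. coeff16 y 0 {4, 5, 6} = 0" by (simp add: dual_def)
  then show "n = 0 \<and> (\<forall>y\<in>M. coeff16 y 0 S = 0)"
    using n cases constant_vanishes 45 6 pairs unfolding linear_vanish_def by (elim disjE) auto
qed

text \<open>The same argument with \<open>xi_3\<close> and \<open>eta_3\<close> exchanged; the
  critical triple is now \<open>{3, 4, 5}\<close>.\<close>

lemma subset_type_4:
  assumes unit: "contains_unit M 1" "contains_unit M 2" and 3: "linear_vanish M 3"
  shows "M \<subseteq> graded_subalgebra E16 1 [1,1,0,0,0,1]"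
proof (rule subset_graded_subalgebra[OF admissible_types(3)])
  fix n S assume S: "S \<subseteq> {1..6::nat}" and neg: "deg16 1 [1,1,0,0,0,1] n S < 0"
  define c :: "nat \<Rightarrow> int" where "c i = (if i \<in> S then 1 else 0)" for i
  have c0: "0 \<le> c i" and c1: "i \<in> S \<Longrightarrow> c i = 1" for i by (simp_all add: c_def)
  have "deg16 1 [1,1,0,0,0,1] n S = int n - 1 + c 1 + c 2 + c 6"
    unfolding deg16_upto_6[OF S] by (simp add: c_def)
  then have le: "int n + c 1 + c 2 + c 6 \<le> 0" using neg by simp
  note c0s = c0[of 1] c0[of 2] c0[of 6]
  have n: "n = 0" and "c 1 = 0" "c 2 = 0" "c 6 = 0" using le c0s by linarith+
  then have "1 \<notin> S" "2 \<notin> S" "6 \<notin> S" by (auto dest: c1)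
  then have "S \<in> Pow {4,3,5}" using S unfolding upto_6 by blast
  then have cases: "S = {} \<or> S = {4} \<or> S = {5} \<or> S = {3} \<or> S = {4,5} \<or> S = {4,3} \<or> S = {5,3} \<or> S = {4,3,5}"
    unfolding Pow_insert by auto
  have 45: "linear_vanish M 4" "linear_vanish M 5"
    using unit_imp_dual_vanish[OF unit(1)] unit_imp_dual_vanish[OF unit(2)] by (simp_all add: dual_def)
  have pairs: "\<forall>y\<in>M. coeff16 y 0 {4, 5} = 0" "\<forall>y\<in>M. coeff16 y 0 {4, 3} = 0"
    "\<forall>y\<in>M. coeff16 y 0 {5, 3} = 0"
    using pair_vanishes[OF unit(1) 45(2)] pair_vanishes[OF unit(1) 3] pair_vanishes[OF unit(2) 3]
    by (simp_all add: dual_def)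
  obtain x where x: "x \<in> M" "\<forall>k\<in>{1..6}. coeff16 x 0 {k} = (if k = 1 then 1 else 0)"
    using unit(1) by (auto simp: contains_unit_def)
  have "coeff16 y 0 {dual 1, 3, 5} = 0" if y: "y \<in> M" for y
  proof (rule triple_coefficient_zero[OF M x(1) _ _ _ _ _ _ _ _ _ y])
    show "coeff16 x 0 {1} = 1" using x(2) by simp
    fix y k assume *: "y \<in> M" "k \<in> {1..6}" "k \<noteq> 1" "dual k \<noteq> 3" "dual k \<noteq> 5"
    then have "k = 4 \<or> k = 5 \<or> k = 3" unfolding upto_6 by (auto simp: dual_def)
    then show "coeff16 y 0 {k} = 0" using * 45 3 by (auto simp: linear_vanish_def)
  qed (use pairs 45 3 in \<open>auto simp: dual_def linear_vanish_def insert_commute\<close>)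
  then have "\<forall>y\<in>M. coeff16 y 0 {4, 3, 5} = 0" by (simp add: dual_def)
  then show "n = 0 \<and> (\<forall>y\<in>M. coeff16 y 0 S = 0)"
    using n cases constant_vanishes 45 3 pairs unfolding linear_vanish_def by (elim disjE) auto
qed

end

section \<open>Maximality of the four graded subalgebras\<close>

lemma ovar_in_graded_subalgebra:
  assumes ab: "admissible a b" and i: "i \<in> {1..6}" and deg: "b ! (i - 1) = a"
  shows "ovar i \<in> graded_subalgebra E16 a b"
  using homogeneous_ovar[OF i, of a b] ovar_E16[OF i] deg
  unfolding graded_subalgebra_E16[OF ab] homogeneous_def by auto

lemma quadratic_in_graded_subalgebra:
  assumes ab: "admissible a b" and ij: "i \<in> {1..6}" "j \<in> {1..6}"
    and deg: "b ! (i - 1) + b ! (j - 1) = a"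
  shows "ovar i * ovar j \<in> graded_subalgebra E16 a b"
  using homogeneous_mult[OF homogeneous_ovar[OF ij(1), of a b] homogeneous_ovar[OF ij(2), of a b]]
    ovar_mult_ovar_E16[OF ij] deg
  unfolding graded_subalgebra_E16[OF ab] homogeneous_def by auto

lemma maximal_open_subalgebra_iff:
  "maximal_open_subalgebra E16 M \<longleftrightarrow> proper_open_subalgebra M \<and>
     (\<forall>N. proper_open_subalgebra N \<and> M \<subseteq> N \<longrightarrow> N = M)"
  by (auto simp: maximal_open_subalgebra_def proper_open_subalgebra_def)

lemma proper_open_graded_subalgebra:
  "admissible a b \<Longrightarrow> proper_open_subalgebra (graded_subalgebra E16 a b)"
  using graded_subalgebra_properties by (simp add: proper_open_subalgebra_def)

text \<open>All products of two odd variables have degree 0, so a larger proper open subalgebra also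
  has full so(6) acting on its linear parts and these must vanish.\<close>

lemma maximal_type_1: "maximal_open_subalgebra E16 (graded_subalgebra E16 2 ones)"
  unfolding maximal_open_subalgebra_iff
proof (intro conjI allI impI proper_open_graded_subalgebra admissible_ones)
  fix N assume "proper_open_subalgebra N \<and> graded_subalgebra E16 2 ones \<subseteq> N"
  then have N: "proper_open_subalgebra N" and sub: "graded_subalgebra E16 2 ones \<subseteq> N" by auto
  have nth: "\<forall>i\<in>{1..6}. ones ! (i - 1) = 1" unfolding ball_upto_6 by simp
  have quad: "ovar i * ovar j \<in> N" if "i \<in> {1..6}" "j \<in> {1..6}" for i j
    using quadratic_in_graded_subalgebra[OF admissible_ones that] that nth sub by auto
  have "linear_vanish N j" if j: "j \<in> {1..6}" for j
  proof -
    obtain i where i: "i \<in> {1..6}" "i \<noteq> j" "i \<noteq> dual j"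
    proof (cases "j = 1 \<or> j = 4")
      case True
      then show ?thesis using that[of 2] by (auto simp: dual_def)
    next
      case False
      then have "1 \<noteq> dual j" using j by (auto simp: dual_def split: if_splits)
      then show ?thesis using that[of 1] False by simp
    qed
    show ?thesis unfolding linear_vanish_def
      using linear_coefficient_zero[OF N j i quad quad] dual_in[OF j] dual_in[OF i(1)] i(1) by blast
  qed
  from subset_type_1[OF N this] sub show "N = graded_subalgebra E16 2 ones" by auto
qed

text \<open>The quadratic elements in the indices 2, 3, 5, 6 have degree 0. They form an so(4),
  enough to exclude any linear part beyond the line of \<open>xi_1\<close>.\<close>

lemma maximal_type_2: "maximal_open_subalgebra E16 (graded_subalgebra E16 2 [2,1,1,0,1,1])"
  unfolding maximal_open_subalgebra_iff
proof (intro conjI allI impI proper_open_graded_subalgebra admissible_types)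
  let ?b = "[2,1,1,0,1,1] :: int list"
  fix N assume "proper_open_subalgebra N \<and> graded_subalgebra E16 2 ?b \<subseteq> N"
  then have N: "proper_open_subalgebra N" and sub: "graded_subalgebra E16 2 ?b \<subseteq> N" by auto
  have unit: "contains_unit N 1"
    using ovar_in_graded_subalgebra[OF admissible_types(1), of 1] sub
    by (intro contains_unit_ovar) auto
  have quad: "ovar i * ovar j \<in> N" if "i \<in> {2,3,5,6}" "j \<in> {2,3,5,6}" for i j
    using quadratic_in_graded_subalgebra[OF admissible_types(1), of i j] that sub by auto
  have "linear_vanish N j" if j: "j \<in> {2,3,5,6}" for j
  proof -
    have dual: "dual i \<in> {2,3,5,6}" "i \<in> {1..6}" if "i \<in> {2,3,5,6}" for i
      using that by (auto simp: dual_def)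
    obtain i where i: "i \<in> {2,3,5,6}" "i \<noteq> j" "i \<noteq> dual j"
    proof (cases "j = 2 \<or> j = 5")
      case True
      then show ?thesis using that[of 3] by (auto simp: dual_def)
    next
      case False
      then show ?thesis using that[of 2] j by (auto simp: dual_def)
    qed
    show ?thesis unfolding linear_vanish_def
      using linear_coefficient_zero[OF N dual(2)[OF j] dual(2)[OF i(1)] i(2,3) quad quad]
        dual(1)[OF j] dual(1)[OF i(1)] i(1) by blast
  qed
  from subset_type_2[OF N unit this] sub show "N = graded_subalgebra E16 2 ?b" by auto
qed

text \<open>Here the linear parts already fill a maximal isotropic subspace, so isotropy alone
  prevents them from growing.\<close>

lemma maximal_type_3: "maximal_open_subalgebra E16 (graded_subalgebra E16 1 [1,1,1,0,0,0])"
  unfolding maximal_open_subalgebra_iff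
proof (intro conjI allI impI proper_open_graded_subalgebra admissible_types)
  let ?b = "[1,1,1,0,0,0] :: int list"
  fix N assume "proper_open_subalgebra N \<and> graded_subalgebra E16 1 ?b \<subseteq> N"
  then have N: "proper_open_subalgebra N" and sub: "graded_subalgebra E16 1 ?b \<subseteq> N" by auto
  have unit: "contains_unit N i" if "i \<in> {1,2,3}" for i
    using ovar_in_graded_subalgebra[OF admissible_types(2), of i] sub that
    by (intro contains_unit_ovar) auto
  have "linear_vanish N 6" using unit_imp_dual_vanish[OF N unit[of 3]] by (simp add: dual_def)
  from subset_type_3[OF N unit unit this] sub show "N = graded_subalgebra E16 1 ?b" by auto
qed

lemma maximal_type_4: "maximal_open_subalgebra E16 (graded_subalgebra E16 1 [1,1,0,0,0,1])"
  unfolding maximal_open_subalgebra_iff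
proof (intro conjI allI impI proper_open_graded_subalgebra admissible_types)
  let ?b = "[1,1,0,0,0,1] :: int list"
  fix N assume "proper_open_subalgebra N \<and> graded_subalgebra E16 1 ?b \<subseteq> N"
  then have N: "proper_open_subalgebra N" and sub: "graded_subalgebra E16 1 ?b \<subseteq> N" by auto
  have unit: "contains_unit N i" if "i \<in> {1,2,6}" for i
    using ovar_in_graded_subalgebra[OF admissible_types(3), of i] sub that
    by (intro contains_unit_ovar) auto
  have "linear_vanish N 3" using unit_imp_dual_vanish[OF N unit[of 6]] by (simp add: dual_def)
  from subset_type_4[OF N unit unit this] sub show "N = graded_subalgebra E16 1 ?b" by auto
qed

section \<open>Conjugation of the linear part\<close>

text \<open>An inner automorphism is carried together with its inverse, and continuity is recorded
  for both: the inverse is used to transport open subalgebras and to pull a graded subalgebra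
  back.\<close>

definition inner_pair :: "(lambda16 \<Rightarrow> lambda16) \<Rightarrow> (lambda16 \<Rightarrow> lambda16) \<Rightarrow> bool" where
  "inner_pair \<phi> \<psi> \<longleftrightarrow> \<phi> \<in> inner_automorphisms E16 \<and> \<psi> \<in> inner_automorphisms E16 \<and>
     continuous_automorphism E16 \<phi> \<and> continuous_automorphism E16 \<psi> \<and>
     (\<forall>x\<in>E16. \<phi> (\<psi> x) = x \<and> \<psi> (\<phi> x) = x)"

text \<open>The linear maps induced on $\mathfrak{g}_{-1}$ by inner automorphisms.\<close>

definition linear_realized :: "((nat \<Rightarrow> complex) \<Rightarrow> nat \<Rightarrow> complex) \<Rightarrow> bool" where
  "linear_realized g \<longleftrightarrow> (\<exists>\<phi> \<psi>. inner_pair \<phi> \<psi> \<and>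
     (\<forall>x\<in>E16. (\<lambda>i. coeff16 (\<phi> x) 0 {i}) = g (\<lambda>i. coeff16 x 0 {i})))"

text \<open>The Siegel (Eichler) transformation of the six-dimensional orthogonal space along the
  isotropic plane of \<open>a\<close> and \<open>b\<close>.\<close>

definition transvection :: "nat \<Rightarrow> nat \<Rightarrow> complex \<Rightarrow> (nat \<Rightarrow> complex) \<Rightarrow> nat \<Rightarrow> complex" where
  "transvection a b s u = (\<lambda>i. u i + (if i = b then s * u (dual a) else 0)
     - (if i = a then s * u (dual b) else 0))"

section \<open>Composition of inner automorphisms\<close>

lemma continuous_automorphism_maps: "continuous_automorphism L \<phi> \<Longrightarrow> x \<in> L \<Longrightarrow> \<phi> x \<in> L"
  by (auto simp: continuous_automorphism_def dest: Bij_imp_funcset)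

lemma inner_pair_sym: "inner_pair \<phi> \<psi> \<Longrightarrow> inner_pair \<psi> \<phi>"
  by (auto simp: inner_pair_def)

lemma compose_inner:
  assumes "\<phi> \<in> inner_automorphisms E16" "\<psi> \<in> inner_automorphisms E16"
    "\<phi> \<in> Bij E16" "\<psi> \<in> Bij E16"
  shows "compose E16 \<phi> \<psi> \<in> inner_automorphisms E16"
  using generate.eng[of \<phi> "BijGroup E16" _ \<psi>] assms
  unfolding inner_automorphisms_def BijGroup_def by simp

lemma compose_continuous_automorphism:
  assumes "continuous_automorphism L \<phi>" "continuous_automorphism L \<psi>" "lie_subalgebra16 L"
  shows "continuous_automorphism L (compose L \<phi> \<psi>)"
proof -
  have maps: "\<And>x. x \<in> L \<Longrightarrow> \<psi> x \<in> L"
    using continuous_automorphism_maps[OF assms(2)] .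
  have L: "\<And>f g. f \<in> L \<Longrightarrow> g \<in> L \<Longrightarrow> f + g \<in> L" "\<And>c f. f \<in> L \<Longrightarrow> scale16 c f \<in> L"
    "\<And>f. f \<in> L \<Longrightarrow> parity16 f \<in> L" "\<And>f g. f \<in> L \<Longrightarrow> g \<in> L \<Longrightarrow> bracket16 f g \<in> L"
    using assms(3) by (auto simp: lie_subalgebra16_def K16.subspace_def)
  have "continuous_on L (\<phi> \<circ> \<psi>)"
    using assms maps unfolding continuous_automorphism_def
    by (intro continuous_on_compose) (auto intro: continuous_on_subset)
  then have "continuous_on L (compose L \<phi> \<psi>)"
    by (rule continuous_on_eq) (simp add: compose_def)
  moreover have "compose L \<phi> \<psi> \<in> Bij L"
    using assms(1,2) by (simp add: continuous_automorphism_def compose_Bij)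
  moreover have "compose L \<phi> \<psi> x = \<phi> (\<psi> x)" if "x \<in> L" for x
    using that by (simp add: compose_def)
  ultimately show ?thesis
    using assms(1,2) maps L unfolding continuous_automorphism_def by simp
qed

lemma inner_pair_compose:
  assumes "inner_pair \<phi> \<psi>" "inner_pair \<phi>' \<psi>'"
  shows "inner_pair (compose E16 \<phi> \<phi>') (compose E16 \<psi>' \<psi>)"
proof -
  have autos: "continuous_automorphism E16 \<phi>" "continuous_automorphism E16 \<psi>"
    "continuous_automorphism E16 \<phi>'" "continuous_automorphism E16 \<psi>'"
    using assms by (auto simp: inner_pair_def)
  then have bij: "\<phi> \<in> Bij E16" "\<psi> \<in> Bij E16" "\<phi>' \<in> Bij E16" "\<psi>' \<in> Bij E16"
    by (auto simp: continuous_automorphism_def)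
  show ?thesis
    unfolding inner_pair_def
  proof (intro conjI ballI)
    show "compose E16 \<phi> \<phi>' \<in> inner_automorphisms E16" "compose E16 \<psi>' \<psi> \<in> inner_automorphisms E16"
      using assms bij by (auto simp: inner_pair_def intro: compose_inner)
    show "continuous_automorphism E16 (compose E16 \<phi> \<phi>')"
      "continuous_automorphism E16 (compose E16 \<psi>' \<psi>)"
      by (intro compose_continuous_automorphism autos lie_subalgebra16_E16)+
    fix x assume x: "x \<in> E16"
    then show "compose E16 \<phi> \<phi>' (compose E16 \<psi>' \<psi> x) = x" "compose E16 \<psi>' \<psi> (compose E16 \<phi> \<phi>' x) = x"
      using assms autos[THEN continuous_automorphism_maps] by (simp_all add: inner_pair_def compose_def)
  qed
qed

lemma linear_realized_compose:
  assumes "linear_realized g" "linear_realized h"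
  shows "linear_realized (g \<circ> h)"
proof -
  obtain \<phi> \<psi> where 1: "inner_pair \<phi> \<psi>"
    "\<forall>x\<in>E16. (\<lambda>i. coeff16 (\<phi> x) 0 {i}) = g (\<lambda>i. coeff16 x 0 {i})"
    using assms(1) by (auto simp: linear_realized_def)
  obtain \<phi>' \<psi>' where 2: "inner_pair \<phi>' \<psi>'"
    "\<forall>x\<in>E16. (\<lambda>i. coeff16 (\<phi>' x) 0 {i}) = h (\<lambda>i. coeff16 x 0 {i})"
    using assms(2) by (auto simp: linear_realized_def)
  have "\<phi>' x \<in> E16" if "x \<in> E16" for x
    using 2(1) continuous_automorphism_maps that by (auto simp: inner_pair_def)
  then have "\<forall>x\<in>E16. (\<lambda>i. coeff16 (compose E16 \<phi> \<phi>' x) 0 {i}) = (g \<circ> h) (\<lambda>i. coeff16 x 0 {i})"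
    using 1(2) 2(2) by (simp add: compose_def)
  then show ?thesis
    unfolding linear_realized_def using inner_pair_compose[OF 1(1) 2(1)] by blast
qed

lemma linear_realized_transvection:
  assumes "a \<in> {1..6}" "b \<in> {1..6}" "a \<noteq> b" "dual a \<noteq> b"
  shows "linear_realized (transvection a b s)"
proof -
  have "inner_pair (restrict (unipotent a b s) E16) (restrict (unipotent a b (- s)) E16)"
    unfolding inner_pair_def
    using unipotent_inner[OF assms] continuous_automorphism_unipotent[OF assms] unipotent_E16[OF assms]
      unipotent_unipotent[OF assms] unipotent_0[OF assms] by simp
  then show ?thesis
    unfolding linear_realized_def
    by (intro exI conjI ballI, assumption)
      (simp add: transvection_def linear_part_unipotent[OF assms])
qed

section \<open>Normal forms of vectors under transvections\<close>

lemma linear_realized_id: "linear_realized id"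
proof -
  have "transvection 1 2 0 = id" by (auto simp: transvection_def fun_eq_iff)
  then show ?thesis using linear_realized_transvection[of 1 2 0] by (simp add: dual_def)
qed

text \<open>A nonzero coordinate 1 is created and then used as a pivot to clear the coordinates 2,
  3, 5, 6. Coordinate 4 changes along the way and is left open: for an isotropic vector it is forced
  to be 0 afterwards.\<close>

lemma move_to_first:
  assumes "i \<in> {1..6}" "u i \<noteq> 0"
  shows "\<exists>g. linear_realized g \<and> g u 1 \<noteq> 0 \<and> (\<forall>j\<in>{2,3,5,6}. g u j = 0)"
proof -
  have side: "\<exists>g. linear_realized g \<and> g u 1 \<noteq> 0" if j: "j \<in> {2,3,5,6}" and nz: "u j \<noteq> 0" for u j
  proof (cases "u 1 = 0")
    case True
    have "transvection (dual j) 1 1 u 1 \<noteq> 0" "linear_realized (transvection (dual j) 1 1)"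
      using j nz True by (auto simp: transvection_def dual_def intro!: linear_realized_transvection)
    then show ?thesis by blast
  next
    case False
    then show ?thesis using linear_realized_id by (metis id_apply)
  qed
  have "\<exists>g. linear_realized g \<and> g u 1 \<noteq> 0"
  proof -
    consider "u 1 \<noteq> 0" | j where "j \<in> {2,3,5,6}" "u j \<noteq> 0" | "u 4 \<noteq> 0" "u 1 = 0" "u 2 = 0"
      using assms unfolding upto_6 by blast
    then show ?thesis
    proof cases
      case 1
      then show ?thesis using linear_realized_id by (metis id_apply)
    next
      case 2
      then show ?thesis by (rule side)
    next
      case 3
      \<comment> \<open>No single transvection carries coordinate 4 to its dual coordinate 1, hence
        the detour through coordinate 2.\<close>
      have "transvection 1 2 1 u 2 \<noteq> 0" "linear_realized (transvection 1 2 1)"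
        using 3 by (auto simp: transvection_def dual_def intro!: linear_realized_transvection)
      moreover obtain g where "linear_realized g" "g (transvection 1 2 1 u) 1 \<noteq> 0"
        using side[of 2 "transvection 1 2 1 u"] calculation(1) by auto
      ultimately show ?thesis using linear_realized_compose by (metis comp_apply)
    qed
  qed
  then obtain g where g: "linear_realized g" "g u 1 \<noteq> 0" by blast
  \<comment> \<open>With \<open>a = 4\<close> the multiple of \<open>v (dual 4) = v 1\<close> is
    added to coordinate \<open>j\<close>; the factor is chosen to cancel \<open>v j\<close>, and
    apart from \<open>j\<close> only coordinate 4 moves.\<close>
  define kill where "kill j v = transvection 4 j (- v j / v 1) v" for j :: nat and v
  have kill: "\<exists>h. linear_realized h \<and> h v = kill j v" if "j \<in> {2,3,5,6}" for j v
    unfolding kill_def using that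
    by (intro exI[of _ "transvection 4 j (- v j / v 1)"] conjI refl linear_realized_transvection)
      (auto simp: dual_def)
  have kill_at: "kill j v k = (if k = j then 0 else v k)" if "v 1 \<noteq> 0" "k \<noteq> 4" "j \<noteq> 4" for j k v
    using that by (auto simp: kill_def transvection_def dual_def)
  obtain h2 where h2: "linear_realized h2" "h2 (g u) = kill 2 (g u)" using kill[of 2 "g u"] by auto
  obtain h3 where h3: "linear_realized h3" "h3 (kill 2 (g u)) = kill 3 (kill 2 (g u))"
    using kill[of 3 "kill 2 (g u)"] by auto
  obtain h5 where h5: "linear_realized h5" "h5 (kill 3 (kill 2 (g u))) = kill 5 (kill 3 (kill 2 (g u)))"
    using kill[of 5 "kill 3 (kill 2 (g u))"] by auto
  obtain h6 where h6: "linear_realized h6"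
    "h6 (kill 5 (kill 3 (kill 2 (g u)))) = kill 6 (kill 5 (kill 3 (kill 2 (g u))))"
    using kill[of 6 "kill 5 (kill 3 (kill 2 (g u)))"] by auto
  have "linear_realized (h6 \<circ> (h5 \<circ> (h3 \<circ> (h2 \<circ> g))))"
    by (intro linear_realized_compose g h2 h3 h5 h6)
  moreover have "(h6 \<circ> (h5 \<circ> (h3 \<circ> (h2 \<circ> g)))) u = kill 6 (kill 5 (kill 3 (kill 2 (g u))))"
    by (simp add: h2 h3 h5 h6)
  moreover have "kill 6 (kill 5 (kill 3 (kill 2 (g u)))) 1 \<noteq> 0"
    "\<forall>j\<in>{2,3,5,6}. kill 6 (kill 5 (kill 3 (kill 2 (g u)))) j = 0"
    using g(2) by (simp_all add: kill_at)
  ultimately show ?thesis by metis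
qed

text \<open>The same pivoting inside the orthogonal space of the indices 2, 3, 5, 6, whose
  transvections leave \<open>e\<close> and the coordinate 4 alone. Coordinate 5 is left to
  isotropy.\<close>

lemma move_to_second:
  assumes i: "i \<in> {2,3,5,6}" "u i \<noteq> 0" and e: "\<forall>j\<in>{2,3,5,6}. e j = 0"
  shows "\<exists>g. linear_realized g \<and> g e = e \<and> g u 4 = u 4 \<and> g u 2 \<noteq> 0 \<and>
    g u 3 = 0 \<and> g u 6 = 0"
proof -
  have fix_e: "transvection a b s e = e" if "a \<in> {2,3,5,6}" "b \<in> {2,3,5,6}" for a b s
    using that e by (auto simp: transvection_def fun_eq_iff dual_def)
  have fix_4: "transvection a b s v 4 = v 4" if "a \<in> {2,3,5,6}" "b \<in> {2,3,5,6}" for a b s v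
    using that by (auto simp: transvection_def)
  define P where "P v g \<longleftrightarrow> linear_realized g \<and> g e = e \<and> g v 4 = v 4" for v g
  have P_id: "P v id" for v by (simp add: P_def linear_realized_id)
  have P_comp: "P v (h \<circ> g)" if "P v g" "P (g v) h" for v g h
    using that by (simp add: P_def linear_realized_compose)
  have P_trans: "P v (transvection a b s)" if "a \<in> {2,3,5,6}" "b \<in> {2,3,5,6}" "a \<noteq> b" "dual a \<noteq> b" for v a b s
    unfolding P_def using that fix_e[OF that(1,2)] fix_4[OF that(1,2)]
    by (intro conjI linear_realized_transvection) auto
  have side: "\<exists>g. P v g \<and> g v 2 \<noteq> 0" if j: "j \<in> {3,6}" and nz: "v j \<noteq> 0" for v j
  proof (cases "v 2 = 0")
    case True
    have "transvection (dual j) 2 1 v 2 \<noteq> 0" "P v (transvection (dual j) 2 1)"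
      using j nz True by (auto simp: transvection_def dual_def intro!: P_trans)
    then show ?thesis by blast
  next
    case False
    then show ?thesis using P_id by (metis id_apply)
  qed
  have "\<exists>g. P u g \<and> g u 2 \<noteq> 0"
  proof -
    consider "u 2 \<noteq> 0" | j where "j \<in> {3,6}" "u j \<noteq> 0" | "u 5 \<noteq> 0" "u 2 = 0" "u 3 = 0"
      using i by blast
    then show ?thesis
    proof cases
      case 1
      then show ?thesis using P_id by (metis id_apply)
    next
      case 2
      then show ?thesis by (rule side)
    next
      case 3
      have *: "transvection 2 3 1 u 3 \<noteq> 0" "P u (transvection 2 3 1)"
        using 3 by (auto simp: transvection_def dual_def intro!: P_trans)
      obtain g where "P (transvection 2 3 1 u) g" "g (transvection 2 3 1 u) 2 \<noteq> 0"
        using side[of 3 "transvection 2 3 1 u"] *(1) by auto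
      then show ?thesis using P_comp[OF *(2)] by (metis comp_apply)
    qed
  qed
  then obtain g where g: "P u g" "g u 2 \<noteq> 0" by blast
  define kill where "kill j v = transvection 5 j (- v j / v 2)" for j :: nat and v :: "nat \<Rightarrow> complex"
  have kill: "P v (kill j v)" if "j \<in> {3,6}" for j v
    unfolding kill_def using that by (intro P_trans) (auto simp: dual_def)
  have kill_at: "kill j v v k = (if k = j then 0 else v k)" if "v 2 \<noteq> 0" "k \<noteq> 5" "j \<noteq> 5" for j k v
    using that by (auto simp: kill_def transvection_def dual_def)
  let ?v = "kill 3 (g u) (g u)"
  let ?w = "kill 6 ?v ?v"
  have "P u (kill 6 ?v \<circ> (kill 3 (g u) \<circ> g))"
    by (intro P_comp g) (simp_all add: kill)
  moreover have "?v 2 \<noteq> 0" "?w 2 \<noteq> 0" "?w 3 = 0" "?w 6 = 0"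
    using g(2) by (simp_all add: kill_at)
  ultimately show ?thesis
    by (intro exI[of _ "kill 6 ?v \<circ> (kill 3 (g u) \<circ> g)"]) (simp add: P_def)
qed

section \<open>Conjugate subalgebras\<close>

definition conjugate :: "lambda16 set \<Rightarrow> lambda16 set \<Rightarrow> bool" where
  "conjugate M N \<longleftrightarrow> (\<exists>\<phi> \<psi>. inner_pair \<phi> \<psi> \<and> N = \<phi> ` M)"

text \<open>Openness is inherited because the image is the preimage of \<open>M\<close> under the
  continuous inverse.\<close>

lemma proper_open_image:
  assumes "inner_pair \<phi> \<psi>" and M: "proper_open_subalgebra M"
  shows "proper_open_subalgebra (\<phi> ` M)" "\<psi> ` \<phi> ` M = M"
proof -
  have auto: "continuous_automorphism E16 \<phi>" "continuous_automorphism E16 \<psi>"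
    and inv: "\<And>x. x \<in> E16 \<Longrightarrow> \<phi> (\<psi> x) = x" "\<And>x. x \<in> E16 \<Longrightarrow> \<psi> (\<phi> x) = x"
    using assms(1) by (auto simp: inner_pair_def)
  note maps = auto[THEN continuous_automorphism_maps]
  note MD = proper_open_subalgebra_D[OF M]
  show inv_image: "\<psi> ` \<phi> ` M = M"
    using inv(2) MD(2) by (force simp: image_image)
  have hom: "\<And>f g. f \<in> E16 \<Longrightarrow> g \<in> E16 \<Longrightarrow> \<phi> (f + g) = \<phi> f + \<phi> g"
    "\<And>c f. f \<in> E16 \<Longrightarrow> \<phi> (scale16 c f) = scale16 c (\<phi> f)"
    "\<And>f. f \<in> E16 \<Longrightarrow> \<phi> (parity16 f) = parity16 (\<phi> f)"
    "\<And>f g. f \<in> E16 \<Longrightarrow> g \<in> E16 \<Longrightarrow> \<phi> (bracket16 f g) = bracket16 (\<phi> f) (\<phi> g)"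
    using auto(1) by (auto simp: continuous_automorphism_def)
  have ME: "x \<in> E16" if "x \<in> M" for x using that MD(2) by blast
  have sub: "lie_subalgebra16 (\<phi> ` M)"
    unfolding lie_subalgebra16_def
  proof (intro conjI ballI)
    show "K16.subspace (\<phi> ` M)"
      unfolding K16.subspace_def
    proof (intro conjI ballI allI)
      have "\<phi> (scale16 0 0) = scale16 0 (\<phi> 0)" by (rule hom(2)) (rule E16_intros(1))
      then have "\<phi> 0 = 0" by simp
      then show "0 \<in> \<phi> ` M" using K16.subspace_0[OF MD(1)] by force
      fix x y c assume "x \<in> \<phi> ` M"
      then obtain x' where x': "x' \<in> M" "x = \<phi> x'" by blast
      then show "scale16 c x \<in> \<phi> ` M"
        using hom(2)[OF ME[OF x'(1)], of c] K16.subspace_scale[OF MD(1) x'(1), of c] by force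
      assume "y \<in> \<phi> ` M"
      then obtain y' where y': "y' \<in> M" "y = \<phi> y'" by blast
      then show "x + y \<in> \<phi> ` M"
        using hom(1)[OF ME[OF x'(1)] ME[OF y'(1)]] K16.subspace_add[OF MD(1) x'(1) y'(1)] x'(2)
        by force
    qed
    fix x assume "x \<in> \<phi> ` M"
    then obtain x' where x': "x' \<in> M" "x = \<phi> x'" by blast
    then show "parity16 x \<in> \<phi> ` M"
      using hom(3)[OF ME[OF x'(1)]] MD(3)[OF x'(1)] by force
    fix y assume "y \<in> \<phi> ` M"
    then obtain y' where y': "y' \<in> M" "y = \<phi> y'" by blast
    then show "bracket16 x y \<in> \<phi> ` M"
      using hom(4)[OF ME[OF x'(1)] ME[OF y'(1)]] MD(4)[OF x'(1) y'(1)] x'(2) by force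
  qed
  have "\<phi> ` M = E16 \<inter> \<psi> -` M"
  proof (intro equalityI subsetI)
    fix x assume "x \<in> E16 \<inter> \<psi> -` M"
    then show "x \<in> \<phi> ` M" using inv(1)[of x] by (metis IntE image_eqI vimageE)
  qed (use inv(2) ME maps(1) in auto)
  moreover have "openin (top_of_set E16) (E16 \<inter> \<psi> -` M)"
    using auto(2) maps(2) M
    by (intro continuous_openin_preimage[where T = E16])
      (auto simp: continuous_automorphism_def proper_open_subalgebra_def)
  moreover have "\<phi> ` M \<subset> E16"
  proof -
    have "\<phi> ` M \<noteq> E16"
    proof
      assume "\<phi> ` M = E16"
      then have "E16 \<subseteq> \<psi> ` \<phi> ` M" using inv(2) maps(1) by (metis image_eqI subsetI)
      then show False using inv_image M by (auto simp: proper_open_subalgebra_def)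
    qed
    then show ?thesis using maps(1) ME by blast
  qed
  ultimately show "proper_open_subalgebra (\<phi> ` M)"
    using sub by (simp add: proper_open_subalgebra_def)
qed

lemma conjugate_trans:
  assumes M: "M \<subseteq> E16" and "conjugate M N" "conjugate N P"
  shows "conjugate M P"
proof -
  obtain \<phi> \<psi> \<phi>' \<psi>' where 1: "inner_pair \<phi> \<psi>" "N = \<phi> ` M" "inner_pair \<phi>' \<psi>'" "P = \<phi>' ` N"
    using assms(2,3) by (auto simp: conjugate_def)
  have "P = compose E16 \<phi>' \<phi> ` M"
    unfolding 1(2,4) image_image using M by (intro image_cong) (auto simp: compose_def)
  then show ?thesis
    unfolding conjugate_def using inner_pair_compose[OF 1(3,1)] by blast
qed

lemma conjugate_realize:
  assumes "linear_realized g" and M: "proper_open_subalgebra M"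
  obtains N where "conjugate M N" "proper_open_subalgebra N"
    "\<And>x. x \<in> M \<Longrightarrow> \<exists>y\<in>N. (\<lambda>i. coeff16 y 0 {i}) = g (\<lambda>i. coeff16 x 0 {i})"
proof -
  obtain \<phi> \<psi> where 1: "inner_pair \<phi> \<psi>"
    "\<forall>x\<in>E16. (\<lambda>i. coeff16 (\<phi> x) 0 {i}) = g (\<lambda>i. coeff16 x 0 {i})"
    using assms(1) by (auto simp: linear_realized_def)
  show ?thesis
  proof (rule that)
    show "conjugate M (\<phi> ` M)" using 1(1) by (auto simp: conjugate_def)
    show "proper_open_subalgebra (\<phi> ` M)" by (rule proper_open_image(1)[OF 1(1) M])
    show "\<exists>y\<in>\<phi> ` M. (\<lambda>i. coeff16 y 0 {i}) = g (\<lambda>i. coeff16 x 0 {i})" if "x \<in> M" for x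
      using 1(2) that proper_open_subalgebra_D(2)[OF M] by blast
  qed
qed

text \<open>Pulled back by the inverse, \<open>T\<close> becomes a proper open subalgebra containing
  \<open>M\<close>, so maximality turns the inclusion into equality.\<close>

lemma maximal_conjugate_to_graded:
  assumes M: "maximal_open_subalgebra E16 M" and "conjugate M N" "N \<subseteq> T"
    and T: "proper_open_subalgebra T"
  shows "\<exists>\<phi>\<in>inner_automorphisms E16. M = \<phi> ` T"
proof -
  have Mp: "proper_open_subalgebra M"
    and max: "\<And>N. proper_open_subalgebra N \<Longrightarrow> M \<subseteq> N \<Longrightarrow> N = M"
    using M by (auto simp: maximal_open_subalgebra_iff)
  obtain \<phi> \<psi> where 1: "inner_pair \<phi> \<psi>" "N = \<phi> ` M"
    using assms(2) by (auto simp: conjugate_def)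
  have "M \<subseteq> \<psi> ` T"
    using image_mono[OF assms(3), of \<psi>] proper_open_image(2)[OF 1(1) Mp] 1(2) by simp
  then have "\<psi> ` T = M"
    using max proper_open_image(1)[OF inner_pair_sym[OF 1(1)] T] by blast
  then show ?thesis using 1(1) by (auto simp: inner_pair_def)
qed

section \<open>Normal form of the linear parts and classification\<close>

lemma isotropic_upto_6:
  assumes "proper_open_subalgebra M" "x \<in> M" "y \<in> M"
  shows "coeff16 x 0 {1} * coeff16 y 0 {4} + coeff16 x 0 {2} * coeff16 y 0 {5}
    + coeff16 x 0 {3} * coeff16 y 0 {6} + coeff16 x 0 {4} * coeff16 y 0 {1}
    + coeff16 x 0 {5} * coeff16 y 0 {2} + coeff16 x 0 {6} * coeff16 y 0 {3} = 0"
  using linear_parts_isotropic[OF assms] unfolding sum_upto_3_6 by (simp add: dual_def)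

lemma conjugate_contains_first:
  assumes M: "proper_open_subalgebra M" and x: "x \<in> M" and i: "i \<in> {1..6}" "coeff16 x 0 {i} \<noteq> 0"
  obtains N where "conjugate M N" "proper_open_subalgebra N" "contains_unit N 1"
proof -
  obtain g where g: "linear_realized g" "g (\<lambda>i. coeff16 x 0 {i}) 1 \<noteq> 0"
    "\<forall>j\<in>{2,3,5,6}. g (\<lambda>i. coeff16 x 0 {i}) j = 0"
    using move_to_first[of i "\<lambda>i. coeff16 x 0 {i}"] i by blast
  obtain N where N: "conjugate M N" "proper_open_subalgebra N"
    and lift: "\<And>x. x \<in> M \<Longrightarrow> \<exists>y\<in>N. (\<lambda>i. coeff16 y 0 {i}) = g (\<lambda>i. coeff16 x 0 {i})"
    using conjugate_realize[OF g(1) M] by blast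
  obtain y where y: "y \<in> N" "(\<lambda>i. coeff16 y 0 {i}) = g (\<lambda>i. coeff16 x 0 {i})"
    using lift[OF x] by blast
  have y1: "coeff16 y 0 {1} \<noteq> 0" and yj: "\<forall>j\<in>{2,3,5,6}. coeff16 y 0 {j} = 0"
    using g(2,3) unfolding y(2)[symmetric] .
  \<comment> \<open>Only the coordinates 1 and 4 are left, so isotropy of the vector with itself
    says that twice their product is 0.\<close>
  have y4: "coeff16 y 0 {4} = 0"
    using isotropic_upto_6[OF N(2) y(1) y(1)] y1 yj by simp
  have "contains_unit N 1"
    unfolding contains_unit_def
  proof (intro bexI[of _ "scale16 (1 / coeff16 y 0 {1}) y"])
    show "\<forall>k\<in>{1..6}. coeff16 (scale16 (1 / coeff16 y 0 {1}) y) 0 {k} = (if k = 1 then 1 else 0)"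
      unfolding ball_upto_6 using y1 yj y4 by simp
  qed (intro K16.subspace_scale proper_open_subalgebra_D N y)
  then show ?thesis using that N by blast
qed

lemma conjugate_contains_second:
  assumes M: "proper_open_subalgebra M" and unit: "contains_unit M 1"
    and z: "z \<in> M" and i: "i \<in> {2,3,5,6}" "coeff16 z 0 {i} \<noteq> 0"
  obtains N where "conjugate M N" "proper_open_subalgebra N" "contains_unit N 1" "contains_unit N 2"
proof -
  obtain x where x: "x \<in> M" "\<forall>k\<in>{1..6}. coeff16 x 0 {k} = (if k = 1 then 1 else 0)"
    using unit by (auto simp: contains_unit_def)
  have "\<forall>j\<in>{2,3,5,6}. coeff16 x 0 {j} = 0" using x(2) by auto
  then obtain g where g: "linear_realized g" "g (\<lambda>i. coeff16 x 0 {i}) = (\<lambda>i. coeff16 x 0 {i})"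
    "g (\<lambda>i. coeff16 z 0 {i}) 4 = coeff16 z 0 {4}" "g (\<lambda>i. coeff16 z 0 {i}) 2 \<noteq> 0"
    "g (\<lambda>i. coeff16 z 0 {i}) 3 = 0" "g (\<lambda>i. coeff16 z 0 {i}) 6 = 0"
    using move_to_second[of i "\<lambda>i. coeff16 z 0 {i}" "\<lambda>i. coeff16 x 0 {i}"] i by blast
  obtain N where N: "conjugate M N" "proper_open_subalgebra N"
    and lift: "\<And>x. x \<in> M \<Longrightarrow> \<exists>y\<in>N. (\<lambda>i. coeff16 y 0 {i}) = g (\<lambda>i. coeff16 x 0 {i})"
    using conjugate_realize[OF g(1) M] by blast
  obtain x' where x': "x' \<in> N" "(\<lambda>i. coeff16 x' 0 {i}) = g (\<lambda>i. coeff16 x 0 {i})"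
    using lift[OF x(1)] by blast
  obtain z' where z': "z' \<in> N" "(\<lambda>i. coeff16 z' 0 {i}) = g (\<lambda>i. coeff16 z 0 {i})"
    using lift[OF z] by blast
  have x'_lin: "\<forall>k\<in>{1..6}. coeff16 x' 0 {k} = (if k = 1 then 1 else 0)"
    using x(2) fun_cong[OF trans[OF x'(2) g(2)]] by simp
  have unit': "contains_unit N 1" using x'(1) x'_lin unfolding contains_unit_def by blast
  have "coeff16 z 0 {4} = 0"
    using unit_imp_dual_vanish[OF M unit] z by (simp add: linear_vanish_def dual_def)
  then have z'_lin: "coeff16 z' 0 {4} = 0" "coeff16 z' 0 {2} \<noteq> 0" "coeff16 z' 0 {3} = 0"
    "coeff16 z' 0 {6} = 0"
    using g(3-6) unfolding z'(2)[symmetric] by simp_all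
  then have z'5: "coeff16 z' 0 {5} = 0"
    using isotropic_upto_6[OF N(2) z'(1) z'(1)] by simp
  \<comment> \<open>Coordinate 1 was not controlled by \<open>move_to_second\<close>; it is removed
    with the element whose linear part is \<open>xi_1\<close>.\<close>
  let ?w = "scale16 (1 / coeff16 z' 0 {2}) (z' - scale16 (coeff16 z' 0 {1}) x')"
  have "contains_unit N 2"
    unfolding contains_unit_def
  proof (intro bexI[of _ ?w])
    show "\<forall>k\<in>{1..6}. coeff16 ?w 0 {k} = (if k = 2 then 1 else 0)"
      using z'_lin z'5 x'_lin unfolding ball_upto_6 by simp
  qed (intro K16.subspace_scale K16.subspace_diff proper_open_subalgebra_D N x' z')
  then show ?thesis using that N unit' by blast
qed

text \<open>Modulo the plane of \<open>xi_1\<close>, \<open>xi_2\<close> the linear parts lie in the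
  hyperbolic plane of \<open>xi_3\<close>, \<open>eta_3\<close>, whose only isotropic lines are the
  two coordinate axes.\<close>

lemma third_linear_vanish:
  assumes M: "proper_open_subalgebra M" and unit: "contains_unit M 1" "contains_unit M 2"
  shows "linear_vanish M 3 \<or> linear_vanish M 6"
proof (rule ccontr)
  assume "\<not> (linear_vanish M 3 \<or> linear_vanish M 6)"
  then obtain v w where v: "v \<in> M" "coeff16 v 0 {3} \<noteq> 0" and w: "w \<in> M" "coeff16 w 0 {6} \<noteq> 0"
    by (auto simp: linear_vanish_def)
  have "linear_vanish M 4" "linear_vanish M 5"
    using unit_imp_dual_vanish[OF M unit(1)] unit_imp_dual_vanish[OF M unit(2)]
    by (simp_all add: dual_def)
  then have 45: "coeff16 y 0 {4} = 0" "coeff16 y 0 {5} = 0" if "y \<in> M" for y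
    using that by (auto simp: linear_vanish_def)
  have "coeff16 v 0 {6} = 0"
    using isotropic_upto_6[OF M v(1) v(1)] 45[OF v(1)] v(2) by simp
  then show False
    using isotropic_upto_6[OF M v(1) w(1)] 45[OF v(1)] 45[OF w(1)] v(2) w(2) by simp
qed

lemma conjugate_refl:
  assumes M: "proper_open_subalgebra M"
  shows "conjugate M M"
proof -
  have ab: "1 \<in> {1..6::nat}" "2 \<in> {1..6::nat}" "1 \<noteq> (2::nat)" "dual 1 \<noteq> 2"
    by (auto simp: dual_def)
  let ?\<phi> = "restrict (unipotent 1 2 0) E16"
  have "inner_pair ?\<phi> ?\<phi>"
    unfolding inner_pair_def
    using unipotent_inner[OF ab] continuous_automorphism_unipotent[OF ab] unipotent_0[OF ab] by simp
  moreover have "?\<phi> ` M = M"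
  proof -
    have "?\<phi> x = x" if "x \<in> M" for x
      using that proper_open_subalgebra_D(2)[OF M] unipotent_0[OF ab] by auto
    then show ?thesis by simp
  qed
  ultimately show ?thesis unfolding conjugate_def by metis
qed

lemma maximal_open_classification:
  assumes M: "maximal_open_subalgebra E16 M"
  shows "\<exists>\<phi>\<in>inner_automorphisms E16. \<exists>(a, b)\<in>{(2, [1,1,1,1,1,1]), (2, [2,1,1,0,1,1]),
    (1, [1,1,1,0,0,0]), (1, [1,1,0,0,0,1])}. M = \<phi> ` graded_subalgebra E16 a b"
proof -
  have Mp: "proper_open_subalgebra M" using M by (simp add: maximal_open_subalgebra_iff)
  note ME = proper_open_subalgebra_D(2)[OF Mp]
  have finish: ?thesis
    if "admissible a b" "conjugate M N" "N \<subseteq> graded_subalgebra E16 a b"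
      "(a, b) \<in> {(2, [1,1,1,1,1,1]), (2, [2,1,1,0,1,1]), (1, [1,1,1,0,0,0]), (1, [1,1,0,0,0,1])}"
    for a b N
    using maximal_conjugate_to_graded[OF M that(2,3) proper_open_graded_subalgebra[OF that(1)]] that(4)
    by blast
  show ?thesis
  proof (cases "\<forall>j\<in>{1..6}. linear_vanish M j")
    case True
    then show ?thesis
      using finish[OF admissible_ones conjugate_refl[OF Mp] subset_type_1[OF Mp]] by simp
  next
    case False
    then obtain x i where "x \<in> M" "i \<in> {1..6}" "coeff16 x 0 {i} \<noteq> 0"
      by (auto simp: linear_vanish_def)
    then obtain N where N: "conjugate M N" "proper_open_subalgebra N" "contains_unit N 1"
      using conjugate_contains_first[OF Mp] by blast
    show ?thesis
    proof (cases "\<forall>j\<in>{2,3,5,6}. linear_vanish N j")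
      case True
      then have "linear_vanish N j" if "j \<in> {2,3,5,6}" for j using that by blast
      then show ?thesis
        using finish[OF admissible_types(1) N(1) subset_type_2[OF N(2,3)]] by simp
    next
      case False
      then obtain z j where "z \<in> N" "j \<in> {2,3,5,6}" "coeff16 z 0 {j} \<noteq> 0"
        unfolding linear_vanish_def by blast
      then obtain P where P: "conjugate N P" "proper_open_subalgebra P" "contains_unit P 1"
        "contains_unit P 2"
        using conjugate_contains_second[OF N(2,3)] by blast
      note MP = conjugate_trans[OF ME N(1) P(1)]
      show ?thesis
        using third_linear_vanish[OF P(2-4)]
      proof
        assume "linear_vanish P 3"
        then show ?thesis
          using finish[OF admissible_types(3) MP subset_type_4[OF P(2-4)]] by simp
      next
        assume "linear_vanish P 6"
        then show ?thesis
          using finish[OF admissible_types(2) MP subset_type_3[OF P(2-4)]] by simp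
      qed
    qed
  qed
qed

theorem theorem7p5:
  shows "let types = {(2, [1,1,1,1,1,1]), (2, [2,1,1,0,1,1]),
                      (1, [1,1,1,0,0,0]), (1, [1,1,0,0,0,1])}
         in (\<forall>(a, b)\<in>types. maximal_open_subalgebra E16 (graded_subalgebra E16 a b)) \<and>
            (\<forall>M. maximal_open_subalgebra E16 M \<longrightarrow>
              (\<exists>\<phi>\<in>inner_automorphisms E16. \<exists>(a, b)\<in>types. M = \<phi> ` graded_subalgebra E16 a b))"
  unfolding Let_def
proof (intro conjI allI impI)
  show "\<forall>(a, b)\<in>{(2, [1,1,1,1,1,1]), (2, [2,1,1,0,1,1]), (1, [1,1,1,0,0,0]), (1, [1,1,0,0,0,1])}.
      maximal_open_subalgebra E16 (graded_subalgebra E16 a b)"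
    using maximal_type_1 maximal_type_2 maximal_type_3 maximal_type_4 by simp
qed (rule maximal_open_classification)

end
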